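(* Consider the NIRVAR model $\boldsymbol y^{(q)}=(X'\otimes I_N)R(A)\boldsymbol\gamma(A)+\mathbf u^{(q)}$ with true restrictions $A\in\{0,1\}^{N\times NQ}$, and let $\hat A\in\{0,1\}^{N\times NQ}$ be the (given) estimated restrictions. Let $$\hat{\boldsymbol\gamma}(\hat A)=\{R(\hat A)'(XX'\otimes\Sigma^{-1})R(\hat A)\}^{-1}R(\hat A)'(X\otimes\Sigma^{-1})\boldsymbol y^{(q)}$$ and $$C=\{R(\hat A)'(XX'\otimes\Sigma^{-1})R(\hat A)\}^{-1}R(\hat A)'(XX'\otimes\Sigma^{-1})R(A).$$ Then, as $T\to\infty$, $\hat{\boldsymbol\gamma}(\hat A)$ is a consistent estimator of $C\boldsymbol\gamma(A)$, i.e. $\hat{\boldsymbol\gamma}(\hat A)-C\boldsymbol\gamma(A)\to0$ in probability, and $$\sqrt T\left\{\hat{\boldsymbol\gamma}(\hat A)-C\boldsymbol\gamma(A)\right\}\xrightarrow{d}\mathcal N\left(0,\left\{R(\hat A)'(\Gamma\otimes\Sigma^{-1})R(\hat A)\right\}^{-1}\right),$$ where $\Gamma=\mathbb E(\boldsymbol X_t\boldsymbol X_t')=\operatorname{plim}_{T\to\infty}XX'/T$.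
   Context: Prime denotes transpose, $\mathrm{vec}$ column-stacking, $\otimes$ Kronecker product, $\odot$ Hadamard product, $|\cdot|_0$ number of nonzero entries, $\operatorname{plim}$ limit in probability. $N,Q$ are fixed, $q\in\{1,\dots,Q\}$ is a fixed response feature, and $T$ is the sample size. NIRVAR model: $\boldsymbol X^{(q)}_t=\sum_{r=1}^Q (A^{(r)}\odot\tilde\Phi^{(r)})\boldsymbol X^{(r)}_{t-1}+\boldsymbol\epsilon^{(q)}_t\in\mathbb R^N$, a zero-mean second-order stationary process, with $A^{(r)}\in\{0,1\}^{N\times N}$ (a realisation of) the adjacency matrix of a stochastic block model (treated as given) and $\tilde\Phi^{(r)}$ fixed $N\times N$ weight matrices (both may depend on $q$, suppressed in the notation). Put $\Phi^{(r)}=A^{(r)}\odot\tilde\Phi^{(r)}$, $\Phi=(\Phi^{(1)}|\cdots|\Phi^{(Q)})$ and $A=(A^{(1)}|\cdots|A^{(Q)})\in\{0,1\}^{N\times NQ}$ (column-wise concatenation). Every feature follows such an equation, so the stacked vector $\boldsymbol X_t=(\boldsymbol X_t^{(1)\prime},\dots,\boldsymbol X_t^{(Q)\prime})'\in\mathbb R^{NQ}$ is a VAR(1), assumed stable (coefficient matrix with spectral radius less than $1$) and stationary. The noise is white noise: $\boldsymbol\epsilon^{(q)}_t$ are continuous random vectors with $\mathbb E\boldsymbol\epsilon^{(q)}_t=0$, $\Sigma=\mathbb E\{\boldsymbol\epsilon^{(q)}_t\boldsymbol\epsilon^{(q)\prime}_t\}$ nonsingular, $\boldsymbol\epsilon^{(q)}_t$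 and $\boldsymbol\epsilon^{(r)}_s$ independent for $t\ne s$ and $q\neq r$, and fourth-order moments $\mathbb E|\epsilon^{(q)}_{i,t}\epsilon^{(q)}_{j,t}\epsilon^{(q)}_{l,t}\epsilon^{(q)}_{m,t}|\le c<\infty$ for a finite constant $c$, for all $t$, $q$ and $i,j,l,m$. Data matrices: $Y^{(q)}=(\boldsymbol X^{(q)}_1,\dots,\boldsymbol X^{(q)}_T)$, $X=(\boldsymbol X_0,\dots,\boldsymbol X_{T-1})$, $U^{(q)}=(\boldsymbol\epsilon^{(q)}_1,\dots,\boldsymbol\epsilon^{(q)}_T)$, $\boldsymbol y^{(q)}=\mathrm{vec}(Y^{(q)})$, $\mathbf u^{(q)}=\mathrm{vec}(U^{(q)})$, $\boldsymbol\beta=\mathrm{vec}(\Phi)$. Restriction matrices: for a binary matrix $B\in\{0,1\}^{N\times NQ}$ with $M_B=|B|_0$, $R(B)\in\{0,1\}^{N^2Q\times M_B}$ is defined by $[R(B)]_{ij}=\mathrm{vec}(B)_i\,\mathbf 1\{\sum_{k=1}^{i-1}\mathrm{vec}(B)_k=j-1\}$, and $\boldsymbol\gamma(B)\in\mathbb R^{M_B}$ is the vector of those entries $\beta_i$ with $\mathrm{vec}(B)_i\ne0$ (in order). Thus $\boldsymbol\beta=R(A)\boldsymbol\gamma(A)$. The restrictions $\hat A$ are treated as given (non-random, not varying with $T$). *)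

theory Defs
  imports
    "HOL-Probability.Probability"
    "Jordan_Normal_Form.Spectral_Radius"
    "Jordan_Normal_Form.Gauss_Jordan_Elimination"
begin

no_notation Finite_Cartesian_Product.vec_nth (infixl "$" 90)
hide_const (open) Finite_Cartesian_Product.vec

section \<open>Matrix operations\<close>

text \<open>All indices (rows, columns, features) are counted from \<open>0\<close>.\<close>

definition vectorise :: "'a mat \<Rightarrow> 'a vec" where
  "vectorise B = vec (dim_row B * dim_col B) (\<lambda>k. B $$ (k mod dim_row B, k div dim_row B))"

definition kronecker :: "'a::times mat \<Rightarrow> 'a mat \<Rightarrow> 'a mat" (infixl "\<otimes>\<^sub>K" 71) where
  "B \<otimes>\<^sub>K D = mat (dim_row B * dim_row D) (dim_col B * dim_col D)
     (\<lambda>(i, j). B $$ (i div dim_row D, j div dim_col D) * D $$ (i mod dim_row D, j mod dim_col D))"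

definition hadamard :: "'a::times mat \<Rightarrow> 'a mat \<Rightarrow> 'a mat" (infixl "\<odot>\<^sub>H" 71) where
  "B \<odot>\<^sub>H D = mat (dim_row B) (dim_col B) (\<lambda>(i, j). B $$ (i, j) * D $$ (i, j))"

text \<open>The library inverse is partial; it is completed by the zero matrix on singular matrices.\<close>

definition inv_mat :: "real mat \<Rightarrow> real mat" where
  "inv_mat B = (case mat_inverse B of Some D \<Rightarrow> D | None \<Rightarrow> 0\<^sub>m (dim_row B) (dim_col B))"

definition binary_mat :: "real mat \<Rightarrow> bool" where
  "binary_mat B \<longleftrightarrow> elements_mat B \<subseteq> {0, 1}"

definition nnz :: "real mat \<Rightarrow> nat" where
  "nnz B = card {(i, j). i < dim_row B \<and> j < dim_col B \<and> B $$ (i, j) \<noteq> 0}"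

text \<open>The concatenation \<open>(F 0 | \<dots> | F (Q - 1))\<close> of \<open>N \<times> N\<close> blocks.\<close>

definition concat_cols :: "nat \<Rightarrow> nat \<Rightarrow> (nat \<Rightarrow> real mat) \<Rightarrow> real mat" where
  "concat_cols N Q F = mat N (N * Q) (\<lambda>(i, j). F (j div N) $$ (i, j mod N))"

text \<open>The square matrix whose block in block row \<open>p\<close> and block column \<open>r\<close> is \<open>F p r\<close>.\<close>

definition block_mat :: "nat \<Rightarrow> nat \<Rightarrow> (nat \<Rightarrow> nat \<Rightarrow> real mat) \<Rightarrow> real mat" where
  "block_mat N Q F = mat (N * Q) (N * Q) (\<lambda>(i, j). F (i div N) (j div N) $$ (i mod N, j mod N))"

text \<open>Since column indices start at \<open>0\<close>, the partial sum is compared with \<open>j\<close> instead of \<open>j - 1\<close>.\<close>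

definition restriction_mat :: "real mat \<Rightarrow> real mat" where
  "restriction_mat B = mat (dim_row B * dim_col B) (nnz B)
     (\<lambda>(i, j). vectorise B $ i * (if (\<Sum>k<i. vectorise B $ k) = real j then 1 else 0))"

definition restricted_params :: "real vec \<Rightarrow> real mat \<Rightarrow> real vec" where
  "restricted_params \<beta> B =
     vec_of_list (map (\<lambda>i. \<beta> $ i) (filter (\<lambda>i. vectorise B $ i \<noteq> 0) [0..<dim_vec \<beta>]))"


section \<open>Random vectors and modes of convergence\<close>

text \<open>The Borel space of \<open>\<real>\<^sup>n\<close> is represented by the product of \<open>n\<close> copies of \<open>borel\<close>.\<close>

definition coords :: "nat \<Rightarrow> real vec \<Rightarrow> nat \<Rightarrow> real" where
  "coords n v = (\<lambda>i\<in>{..<n}. v $ i)"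

definition random_vec :: "'a measure \<Rightarrow> nat \<Rightarrow> ('a \<Rightarrow> real vec) \<Rightarrow> bool" where
  "random_vec M n Z \<longleftrightarrow>
     (\<forall>\<omega>\<in>space M. Z \<omega> \<in> carrier_vec n) \<and> (\<forall>i<n. (\<lambda>\<omega>. Z \<omega> $ i) \<in> borel_measurable M)"

definition cross_moment ::
    "'a measure \<Rightarrow> nat \<Rightarrow> ('a \<Rightarrow> real vec) \<Rightarrow> ('a \<Rightarrow> real vec) \<Rightarrow> real mat" where
  "cross_moment M n Z W = mat n n (\<lambda>(i, j). \<integral>\<omega>. Z \<omega> $ i * W \<omega> $ j \<partial>M)"

definition tends_to_0_in_prob :: "'a measure \<Rightarrow> nat \<Rightarrow> (nat \<Rightarrow> 'a \<Rightarrow> real vec) \<Rightarrow> bool" where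
  "tends_to_0_in_prob M n Z \<longleftrightarrow>
     (\<forall>T. random_vec M n (Z T)) \<and>
     (\<forall>e>0. (\<lambda>T. measure M {\<omega> \<in> space M. sqrt (scalar_prod (Z T \<omega>) (Z T \<omega>)) > e}) \<longlonglongrightarrow> 0)"

text \<open>
  Convergence in distribution of \<open>\<real>\<^sup>n\<close>-valued random vectors to a law \<open>L\<close>, by bounded continuous
  test functions. Points of \<open>\<real>\<^sup>n\<close> are functions that are \<open>undefined\<close> outside \<open>{..<n}\<close>; every
  bounded continuous function on \<open>\<real>\<^sup>n\<close> is the restriction of one that is continuous for the product
  topology of \<open>nat \<Rightarrow> real\<close>, and conversely.
\<close>

definition tends_to_in_dist ::
    "'a measure \<Rightarrow> nat \<Rightarrow> (nat \<Rightarrow> 'a \<Rightarrow> real vec) \<Rightarrow> (nat \<Rightarrow> real) measure \<Rightarrow> bool" where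
  "tends_to_in_dist M n Z L \<longleftrightarrow>
     (\<forall>T. random_vec M n (Z T)) \<and>
     (\<forall>f :: (nat \<Rightarrow> real) \<Rightarrow> real. continuous_on UNIV f \<and> bounded (range f) \<longrightarrow>
        (\<lambda>T. \<integral>\<omega>. f (coords n (Z T \<omega>)) \<partial>M) \<longlonglongrightarrow> (\<integral>x. f x \<partial>L))"

text \<open>The law \<open>\<N>(\<mu>, V)\<close> on \<open>\<real>\<^sup>n\<close> for a positive definite covariance matrix \<open>V\<close>, by its density.\<close>

definition multivariate_normal :: "nat \<Rightarrow> real vec \<Rightarrow> real mat \<Rightarrow> (nat \<Rightarrow> real) measure" where
  "multivariate_normal n \<mu> V = density (\<Pi>\<^sub>M i\<in>{..<n}. lborel)
     (\<lambda>x. ennreal (exp (- (scalar_prod (vec n x - \<mu>) (inv_mat V *\<^sub>v (vec n x - \<mu>))) / 2)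
                   / sqrt ((2 * pi) ^ n * det V)))"


section \<open>The NIRVAR model\<close>

definition stacked :: "nat \<Rightarrow> nat \<Rightarrow> (nat \<Rightarrow> int \<Rightarrow> 'a \<Rightarrow> real vec) \<Rightarrow> int \<Rightarrow> 'a \<Rightarrow> real vec" where
  "stacked N Q X t \<omega> = vec (N * Q) (\<lambda>k. X (k div N) t \<omega> $ (k mod N))"

text \<open>
  \<open>Adj p r\<close> and \<open>W p r\<close> are the adjacency and weight matrices with which feature \<open>r\<close> enters the
  equation of feature \<open>p\<close>, and \<open>Sig p\<close> is the noise covariance of feature \<open>p\<close>. The adjacency matrix
  of a stochastic block model being treated as given, it is an arbitrary fixed \<open>0\<close>-\<open>1\<close> matrix. White
  noise is read as joint independence of the vectors \<open>eps p t\<close> over all features \<open>p\<close> and times \<open>t\<close>;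
  they need not be identically distributed. A continuous random vector is one with a
  Lebesgue density. The process is indexed by all integer times, and no causality is assumed.
\<close>

locale nirvar = prob_space M for M :: "'a measure" +
  fixes N Q :: nat
    and Adj W :: "nat \<Rightarrow> nat \<Rightarrow> real mat"
    and X eps :: "nat \<Rightarrow> int \<Rightarrow> 'a \<Rightarrow> real vec"
    and Sig :: "nat \<Rightarrow> real mat"
  assumes N_pos: "0 < N"
    and Q_pos: "0 < Q"
    and Adj_carrier: "\<And>p r. p < Q \<Longrightarrow> r < Q \<Longrightarrow> Adj p r \<in> carrier_mat N N"
    and Adj_binary: "\<And>p r. p < Q \<Longrightarrow> r < Q \<Longrightarrow> binary_mat (Adj p r)"
    and W_carrier: "\<And>p r. p < Q \<Longrightarrow> r < Q \<Longrightarrow> W p r \<in> carrier_mat N N"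
    and X_random: "\<And>p t. p < Q \<Longrightarrow> random_vec M N (X p t)"
    and eps_random: "\<And>p t. p < Q \<Longrightarrow> random_vec M N (eps p t)"
    and model: "\<And>p t. p < Q \<Longrightarrow> AE \<omega> in M. \<forall>i<N.
          X p t \<omega> $ i = (\<Sum>r<Q. ((Adj p r \<odot>\<^sub>H W p r) *\<^sub>v X r (t - 1) \<omega>) $ i) + eps p t \<omega> $ i"
    and stable: "spectral_radius
          (map_mat complex_of_real (block_mat N Q (\<lambda>p r. Adj p r \<odot>\<^sub>H W p r))) < 1"
    and X_square_integrable:
          "\<And>p t i. p < Q \<Longrightarrow> i < N \<Longrightarrow> integrable M (\<lambda>\<omega>. (X p t \<omega> $ i)\<^sup>2)"
    and X_zero_mean: "\<And>p t i. p < Q \<Longrightarrow> i < N \<Longrightarrow> expectation (\<lambda>\<omega>. X p t \<omega> $ i) = 0"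
    and X_stationary: "\<And>h s t.
          cross_moment M (N * Q) (stacked N Q X (t + h)) (stacked N Q X t) =
          cross_moment M (N * Q) (stacked N Q X (s + h)) (stacked N Q X s)"
    and eps_continuous: "\<And>p t. p < Q \<Longrightarrow>
          \<exists>f. distributed M (\<Pi>\<^sub>M i\<in>{..<N}. lborel) (\<lambda>\<omega>. coords N (eps p t \<omega>)) f"
    and eps_independent: "indep_vars (\<lambda>_. \<Pi>\<^sub>M i\<in>{..<N}. borel)
          (\<lambda>(p, t) \<omega>. coords N (eps p t \<omega>)) ({..<Q} \<times> UNIV)"
    and eps_zero_mean: "\<And>p t i. p < Q \<Longrightarrow> i < N \<Longrightarrow> expectation (\<lambda>\<omega>. eps p t \<omega> $ i) = 0"
    and eps_covariance: "\<And>p t. p < Q \<Longrightarrow> cross_moment M N (eps p t) (eps p t) = Sig p"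
    and Sig_nonsingular: "\<And>p. p < Q \<Longrightarrow> invertible_mat (Sig p)"
    and eps_fourth_moments: "\<exists>c. \<forall>p<Q. \<forall>t. \<forall>i<N. \<forall>j<N. \<forall>l<N. \<forall>m<N.
          integrable M (\<lambda>\<omega>. eps p t \<omega> $ i * eps p t \<omega> $ j * eps p t \<omega> $ l * eps p t \<omega> $ m) \<and>
          expectation (\<lambda>\<omega>. \<bar>eps p t \<omega> $ i * eps p t \<omega> $ j * eps p t \<omega> $ l * eps p t \<omega> $ m\<bar>) \<le> c"

text \<open>The matrix \<open>(X\<^sub>0, \<dots>, X\<^bsub>T-1\<^esub>)\<close> of stacked regressors.\<close>

definition regressors ::
    "nat \<Rightarrow> nat \<Rightarrow> (nat \<Rightarrow> int \<Rightarrow> 'a \<Rightarrow> real vec) \<Rightarrow> nat \<Rightarrow> 'a \<Rightarrow> real mat" where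
  "regressors N Q X T \<omega> = mat_of_cols (N * Q) (map (\<lambda>t. stacked N Q X (int t) \<omega>) [0..<T])"

text \<open>The vectorised matrix \<open>(X\<^sub>1, \<dots>, X\<^sub>T)\<close> of observations of one feature.\<close>

definition responses :: "nat \<Rightarrow> (int \<Rightarrow> 'a \<Rightarrow> real vec) \<Rightarrow> nat \<Rightarrow> 'a \<Rightarrow> real vec" where
  "responses N Xq T \<omega> = vectorise (mat_of_cols N (map (\<lambda>t. Xq (int t) \<omega>) [1..<T + 1]))"

definition gls_estimator :: "real mat \<Rightarrow> real mat \<Rightarrow> real mat \<Rightarrow> real vec \<Rightarrow> real vec" where
  "gls_estimator S B D y =
     inv_mat ((restriction_mat B)\<^sup>T * ((D * D\<^sup>T) \<otimes>\<^sub>K inv_mat S) * restriction_mat B)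
       * (restriction_mat B)\<^sup>T * (D \<otimes>\<^sub>K inv_mat S) *\<^sub>v y"

text \<open>The matrix \<open>C\<close> for restrictions \<open>B\<close>, true restrictions \<open>A\<close> and regressors \<open>D\<close>.\<close>

definition misspec_mat :: "real mat \<Rightarrow> real mat \<Rightarrow> real mat \<Rightarrow> real mat \<Rightarrow> real mat" where
  "misspec_mat S B A D =
     inv_mat ((restriction_mat B)\<^sup>T * ((D * D\<^sup>T) \<otimes>\<^sub>K inv_mat S) * restriction_mat B)
       * (restriction_mat B)\<^sup>T * ((D * D\<^sup>T) \<otimes>\<^sub>K inv_mat S) * restriction_mat A"

end

theory Submission
  imports Defs
begin

text \<open>
  Write \<open>R\<close> for the restriction matrix of the estimated restrictions and \<open>D\<close> for the matrix of regressors.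
  Almost surely, the estimation error is the inverse of \<open>R\<^sup>T (D D\<^sup>T \<otimes> \<Sigma>\<inverse>) R\<close> applied to the score
  \<open>R\<^sup>T (D \<otimes> \<Sigma>\<inverse>) u\<close>. Iterating the autoregression \<open>m\<close> times expresses the regressors through the last
  \<open>m\<close> noise vectors up to a remainder that stationarity and stability make small in mean square, uniformly in
  time. The truncated regressors are \<open>m\<close>-dependent with constant second moments, so a variance bound gives the
  law of large numbers for \<open>D D\<^sup>T / T\<close>. Every linear combination of the truncated scores is a sum of \<open>m\<close>-dependent
  martingale differences with constant variance \<open>v\<close>, and each summand multiplies the characteristic function of
  the normalised sum by \<open>1 - v / (2 T)\<close> up to an error of order \<open>T\<^bsup>-3/2\<^esup>\<close>. Orthogonality of the summands
  makes the truncation error uniform in \<open>T\<close>, so the limit passes to the scores themselves.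
  In dimension \<open>n\<close>, convergence of characteristic functions and tightness yield weak convergence through
  trigonometric polynomials, and the characteristic function of the normal density is found by completing the
  square in one coordinate at a time.
\<close>

section \<open>Characteristic functions of \<open>m\<close>-dependent sums\<close>

text \<open>The noise is not identically distributed, and causality of the process is not given, so
  no ergodic theorem and no martingale limit theorem applies to the regressors directly. What is
  constant in time is only second moments; fourth moments are merely bounded. Four moments suffice
  because a truncated regressor is independent of the noise vector that it multiplies, so the fourth
  moment of the product factorises. The centring \<open>C\<close> contains the realised regressors
  and the true restrictions: since R(A) gamma(A) = beta, the systematic part cancels exactly for
  every choice of estimated restrictions, and misspecification leaves no bias. Write H = R' (Gamma x
  Sigma^-1) R. The score has limiting variance R' (Gamma x Sigma^-1 Sigma Sigma^-1) R = H, which is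
  why the sandwich H^-1 H H^-1 collapses to H^-1. Gram matrices may be singular on some samples; H
  is positive definite, so inversion is continuous there and such samples have vanishing
  probability. Consistency is read off from tightness of the scaled error.\<close>

lemma iexp_diff_le: "cmod (iexp x - iexp y) \<le> \<bar>x - y\<bar>"
proof -
  have "iexp x - iexp y = iexp y * (iexp (x - y) - 1)"
    by (simp add: algebra_simps flip: exp_add)
  then have "cmod (iexp x - iexp y) = cmod (iexp (x - y) - 1)"
    by (simp add: norm_mult)
  also have "\<dots> \<le> \<bar>x - y\<bar>"
    using iexp_approx1[of "x - y" 0] by simp
  finally show ?thesis .
qed

lemma iexp_second_order: "cmod (iexp x - (1 + \<i> * x - x\<^sup>2 / 2)) \<le> \<bar>x\<bar> ^ 3 / 6"
proof -
  have "(\<Sum>k\<le>2. (\<i> * x) ^ k / fact k) = 1 + \<i> * x - x\<^sup>2 / 2"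
    by (simp add: numeral_2_eq_2 power2_eq_square complex_eq_iff)
  moreover have "\<bar>x\<bar> ^ Suc 2 / fact (Suc 2) = \<bar>x\<bar> ^ 3 / 6"
    by (simp add: eval_nat_numeral)
  ultimately show ?thesis using iexp_approx1[of x 2] by metis
qed

text \<open>The larger of the two absolute values dominates the product. Third absolute moments thus
  control the mixed terms that arise when \<open>S k\<close> is replaced by an earlier sum.\<close>

lemma abs_mult_square_le_cubes:
  fixes x y :: real
  shows "\<bar>x\<bar> * y\<^sup>2 \<le> \<bar>x\<bar> ^ 3 + \<bar>y\<bar> ^ 3"
proof (cases "\<bar>x\<bar> \<le> \<bar>y\<bar>")
  case True
  then have "\<bar>x\<bar> * y\<^sup>2 \<le> \<bar>y\<bar> * \<bar>y\<bar>\<^sup>2" by (intro mult_mono) auto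
  also have "\<dots> = \<bar>y\<bar> ^ 3" by (simp add: power2_eq_square power3_eq_cube)
  finally show ?thesis by (simp add: add_increasing)
next
  case False
  then have "y\<^sup>2 \<le> x\<^sup>2" by (simp add: abs_le_square_iff[symmetric])
  then have "\<bar>x\<bar> * y\<^sup>2 \<le> \<bar>x\<bar> * \<bar>x\<bar>\<^sup>2" by (intro mult_mono) auto
  also have "\<dots> = \<bar>x\<bar> ^ 3" by (simp add: power2_eq_square power3_eq_cube)
  finally show ?thesis by (simp add: add_increasing2)
qed

lemma abs_le_1_plus_cube: "\<bar>x :: real\<bar> \<le> 1 + \<bar>x\<bar> ^ 3"
proof (cases "\<bar>x\<bar> \<le> 1")
  case False
  then have "\<bar>x\<bar> ^ 1 \<le> \<bar>x\<bar> ^ 3" by (intro power_increasing) auto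
  then show ?thesis by simp
qed (simp add: add_increasing2)

lemma square_le_1_plus_cube: "(x :: real)\<^sup>2 \<le> 1 + \<bar>x\<bar> ^ 3"
proof (cases "\<bar>x\<bar> \<le> 1")
  case True
  then have "x\<^sup>2 \<le> 1" by (simp add: abs_square_le_1)
  then show ?thesis by (simp add: add_increasing2)
next
  case False
  then have "\<bar>x\<bar> ^ 2 \<le> \<bar>x\<bar> ^ 3" by (intro power_increasing) auto
  then show ?thesis by simp
qed

text \<open>
  The characteristic function of \<open>S\<^bsub>k+1\<^esub>\<close> is compared with \<open>1 - \<theta>\<^sup>2 v / 2\<close> times that of \<open>S\<^sub>k\<close>.
  In the second order term \<open>S\<^sub>k\<close> is replaced by \<open>S\<^bsub>k-m\<^esub>\<close>, which is uncorrelated with \<open>\<xi>\<^sub>k\<^sup>2\<close>;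
  this costs only a third order error.
\<close>

lemma (in prob_space) char_step_m_dependent:
  fixes \<xi> :: "nat \<Rightarrow> 'a \<Rightarrow> real" and v C \<theta> :: real
  defines "S \<equiv> \<lambda>n \<omega>. \<Sum>k<n. \<xi> k \<omega>"
  assumes meas[measurable]: "\<And>k. \<xi> k \<in> borel_measurable M"
    and int3: "\<And>k. integrable M (\<lambda>\<omega>. \<bar>\<xi> k \<omega>\<bar> ^ 3)"
    and bound3: "\<And>k. expectation (\<lambda>\<omega>. \<bar>\<xi> k \<omega>\<bar> ^ 3) \<le> C"
    and mart: "(\<integral>\<omega>. iexp (\<theta> * S k \<omega>) * \<xi> k \<omega> \<partial>M) = 0"
    and var: "(\<integral>\<omega>. iexp (\<theta> * S (k - m) \<omega>) * (\<xi> k \<omega>)\<^sup>2 \<partial>M) =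
                v * (\<integral>\<omega>. iexp (\<theta> * S (k - m) \<omega>) \<partial>M)"
    and \<theta>: "\<theta> \<ge> 0"
  shows "cmod ((\<integral>\<omega>. iexp (\<theta> * S (Suc k) \<omega>) \<partial>M) - (1 - \<theta>\<^sup>2 * v / 2) * (\<integral>\<omega>. iexp (\<theta> * S k \<omega>) \<partial>M))
           \<le> \<theta> ^ 3 * (C / 6 + m * (2 * C + \<bar>v\<bar> * (1 + C)) / 2)"
proof -
  define j where "j = k - m"
  have S_meas[measurable]: "S n \<in> borel_measurable M" for n unfolding S_def by measurable
  have int1: "integrable M (\<lambda>\<omega>. \<bar>\<xi> i \<omega>\<bar>)" for i
    by (rule Bochner_Integration.integrable_bound[of _ "\<lambda>\<omega>. 1 + \<bar>\<xi> i \<omega>\<bar> ^ 3"])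
       (use int3 abs_le_1_plus_cube in \<open>auto intro!: order_trans[OF abs_le_1_plus_cube]\<close>)
  have int2: "integrable M (\<lambda>\<omega>. (\<xi> i \<omega>)\<^sup>2)" for i
    by (rule Bochner_Integration.integrable_bound[of _ "\<lambda>\<omega>. 1 + \<bar>\<xi> i \<omega>\<bar> ^ 3"])
       (use int3 in \<open>auto intro!: order_trans[OF square_le_1_plus_cube]\<close>)
  have int12: "integrable M (\<lambda>\<omega>. \<bar>\<xi> i \<omega>\<bar> * (\<xi> l \<omega>)\<^sup>2)" for i l
    by (rule Bochner_Integration.integrable_bound[of _ "\<lambda>\<omega>. \<bar>\<xi> i \<omega>\<bar> ^ 3 + \<bar>\<xi> l \<omega>\<bar> ^ 3"])
       (use int3 in \<open>auto intro!: order_trans[OF abs_mult_square_le_cubes] simp: abs_mult\<close>)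
  have E1: "expectation (\<lambda>\<omega>. \<bar>\<xi> i \<omega>\<bar>) \<le> 1 + C" for i
  proof -
    have "expectation (\<lambda>\<omega>. \<bar>\<xi> i \<omega>\<bar>) \<le> expectation (\<lambda>\<omega>. 1 + \<bar>\<xi> i \<omega>\<bar> ^ 3)"
      using int1 int3 by (intro integral_mono) (auto intro: abs_le_1_plus_cube)
    then show ?thesis using bound3[of i] int3 by (simp add: prob_space)
  qed
  have E12: "expectation (\<lambda>\<omega>. \<bar>\<xi> i \<omega>\<bar> * (\<xi> l \<omega>)\<^sup>2) \<le> 2 * C" for i l
  proof -
    have "expectation (\<lambda>\<omega>. \<bar>\<xi> i \<omega>\<bar> * (\<xi> l \<omega>)\<^sup>2) \<le> expectation (\<lambda>\<omega>. \<bar>\<xi> i \<omega>\<bar> ^ 3 + \<bar>\<xi> l \<omega>\<bar> ^ 3)"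
      using int12 int3 by (intro integral_mono) (auto intro: abs_mult_square_le_cubes)
    then show ?thesis using bound3[of i] bound3[of l] int3 by simp
  qed
  have C0: "C \<ge> 0" using bound3[of 0] by (rule order_trans[rotated]) (auto intro: integral_nonneg_AE)
  \<comment> \<open>The last two summands have expectation zero by \<open>mart\<close> and
    \<open>var\<close>. Adding them leaves the expectation of the wanted difference unchanged but
    makes the integrand of third order in \<theta> pointwise.\<close>
  define D where "D = (\<lambda>\<omega>. iexp (\<theta> * S (Suc k) \<omega>) - (1 - \<theta>\<^sup>2 * v / 2) * iexp (\<theta> * S k \<omega>)
      - \<i> * \<theta> * (iexp (\<theta> * S k \<omega>) * \<xi> k \<omega>)
      + \<theta>\<^sup>2 / 2 * (iexp (\<theta> * S j \<omega>) * (\<xi> k \<omega>)\<^sup>2 - v * iexp (\<theta> * S j \<omega>)))"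
  have ie: "integrable M (\<lambda>\<omega>. iexp (\<theta> * S n \<omega>))" for n
    by (rule integrable_const_bound[where B=1]) auto
  have ie1: "integrable M (\<lambda>\<omega>. iexp (\<theta> * S n \<omega>) * \<xi> k \<omega>)" for n
    by (rule Bochner_Integration.integrable_bound[OF int1[of k]]) (auto simp: norm_mult)
  have ie2: "integrable M (\<lambda>\<omega>. iexp (\<theta> * S n \<omega>) * (\<xi> k \<omega>)\<^sup>2)" for n
    by (rule Bochner_Integration.integrable_bound[OF int2[of k]]) (auto simp: norm_mult norm_power)
  have lin: "(\<integral>\<omega>. f1 \<omega> - c2 * f2 \<omega> - c3 * f3 \<omega> + c4 * (f4 \<omega> - c5 * f5 \<omega>) \<partial>M) =
      (\<integral>\<omega>. f1 \<omega> \<partial>M) - c2 * (\<integral>\<omega>. f2 \<omega> \<partial>M) - c3 * (\<integral>\<omega>. f3 \<omega> \<partial>M)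
        + c4 * ((\<integral>\<omega>. f4 \<omega> \<partial>M) - c5 * (\<integral>\<omega>. f5 \<omega> \<partial>M))"
    if "integrable M f1" "integrable M f2" "integrable M f3" "integrable M f4" "integrable M f5"
    for f1 f2 f3 f4 f5 :: "'a \<Rightarrow> complex" and c2 c3 c4 c5
    using that by simp
  have "(\<integral>\<omega>. D \<omega> \<partial>M) = (\<integral>\<omega>. iexp (\<theta> * S (Suc k) \<omega>) \<partial>M) - (1 - \<theta>\<^sup>2 * v / 2) * (\<integral>\<omega>. iexp (\<theta> * S k \<omega>) \<partial>M)
      - \<i> * \<theta> * (\<integral>\<omega>. iexp (\<theta> * S k \<omega>) * \<xi> k \<omega> \<partial>M)
      + \<theta>\<^sup>2 / 2 * ((\<integral>\<omega>. iexp (\<theta> * S j \<omega>) * (\<xi> k \<omega>)\<^sup>2 \<partial>M) - v * (\<integral>\<omega>. iexp (\<theta> * S j \<omega>) \<partial>M))"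
    unfolding D_def by (rule lin[OF ie ie ie1 ie2 ie])
  then have ED: "(\<integral>\<omega>. D \<omega> \<partial>M) =
      (\<integral>\<omega>. iexp (\<theta> * S (Suc k) \<omega>) \<partial>M) - (1 - \<theta>\<^sup>2 * v / 2) * (\<integral>\<omega>. iexp (\<theta> * S k \<omega>) \<partial>M)"
    using mart var unfolding j_def by simp
  \<comment> \<open>Pointwise majorant of \<open>D\<close>: the cubic Taylor remainder, and
    \<theta>^2/2 times |\<xi>_k^2 - v| times the Lipschitz bound for the exponential over the window
    from \<open>j\<close> to \<open>k\<close>.\<close>
  define R :: "'a \<Rightarrow> real" where "R = (\<lambda>\<omega>. \<theta> ^ 3 * (\<bar>\<xi> k \<omega>\<bar> ^ 3 / 6 +
      (\<Sum>i\<in>{j..<k}. \<bar>\<xi> i \<omega>\<bar> * (\<xi> k \<omega>)\<^sup>2 + \<bar>v\<bar> * \<bar>\<xi> i \<omega>\<bar>) / 2))"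
  have bound: "cmod (D \<omega>) \<le> R \<omega>" for \<omega>
  proof -
    define r where "r = iexp (\<theta> * \<xi> k \<omega>) - (1 + \<i> * (\<theta> * \<xi> k \<omega>) - (\<theta> * \<xi> k \<omega>)\<^sup>2 / 2)"
    have r: "cmod r \<le> \<theta> ^ 3 * \<bar>\<xi> k \<omega>\<bar> ^ 3 / 6"
      using iexp_second_order[of "\<theta> * \<xi> k \<omega>"] \<theta> unfolding r_def
      by (simp add: abs_mult power_mult_distrib)
    have "iexp (\<theta> * S (Suc k) \<omega>) = iexp (\<theta> * S k \<omega>) * iexp (\<theta> * \<xi> k \<omega>)"
      by (simp add: S_def algebra_simps flip: exp_add)
    also have "iexp (\<theta> * \<xi> k \<omega>) = r + (1 + \<i> * (\<theta> * \<xi> k \<omega>) - (\<theta> * \<xi> k \<omega>)\<^sup>2 / 2)"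
      by (simp add: r_def)
    finally have D: "D \<omega> = iexp (\<theta> * S k \<omega>) * r
        - \<theta>\<^sup>2 / 2 * ((\<xi> k \<omega>)\<^sup>2 - v) * (iexp (\<theta> * S k \<omega>) - iexp (\<theta> * S j \<omega>))"
      unfolding D_def by (simp add: algebra_simps power2_eq_square)
    have "S k \<omega> - S j \<omega> = (\<Sum>i\<in>{j..<k}. \<xi> i \<omega>)"
      unfolding S_def j_def
      by (simp add: sum_diff_nat_ivl lessThan_atLeast0)
    then have dS: "\<bar>S k \<omega> - S j \<omega>\<bar> \<le> (\<Sum>i\<in>{j..<k}. \<bar>\<xi> i \<omega>\<bar>)"
      by (simp add: sum_abs)
    have "cmod (iexp (\<theta> * S k \<omega>) - iexp (\<theta> * S j \<omega>)) \<le> \<bar>\<theta> * S k \<omega> - \<theta> * S j \<omega>\<bar>"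
      by (rule iexp_diff_le)
    also have "\<dots> = \<theta> * \<bar>S k \<omega> - S j \<omega>\<bar>" using \<theta> by (simp add: abs_mult flip: right_diff_distrib)
    also have "\<dots> \<le> \<theta> * (\<Sum>i\<in>{j..<k}. \<bar>\<xi> i \<omega>\<bar>)" using dS \<theta> by (rule mult_left_mono)
    finally have dI: "cmod (iexp (\<theta> * S k \<omega>) - iexp (\<theta> * S j \<omega>)) \<le> \<theta> * (\<Sum>i\<in>{j..<k}. \<bar>\<xi> i \<omega>\<bar>)" .
    have vq: "\<bar>(\<xi> k \<omega>)\<^sup>2 - v\<bar> \<le> (\<xi> k \<omega>)\<^sup>2 + \<bar>v\<bar>"
      using abs_triangle_ineq4[of "(\<xi> k \<omega>)\<^sup>2" v] by simp
    have n2: "cmod (complex_of_real (\<theta>\<^sup>2) / 2 * complex_of_real ((\<xi> k \<omega>)\<^sup>2 - v)) = \<theta>\<^sup>2 / 2 * \<bar>(\<xi> k \<omega>)\<^sup>2 - v\<bar>"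
      unfolding norm_mult norm_of_real norm_divide by simp
    have "cmod (D \<omega>) \<le> cmod (iexp (\<theta> * S k \<omega>) * r)
        + cmod (\<theta>\<^sup>2 / 2 * ((\<xi> k \<omega>)\<^sup>2 - v) * (iexp (\<theta> * S k \<omega>) - iexp (\<theta> * S j \<omega>)))"
      unfolding D by (rule norm_triangle_ineq4)
    also have "\<dots> = cmod r + \<theta>\<^sup>2 / 2 * \<bar>(\<xi> k \<omega>)\<^sup>2 - v\<bar> * cmod (iexp (\<theta> * S k \<omega>) - iexp (\<theta> * S j \<omega>))"
      using n2 by (simp add: norm_mult)
    also have "\<dots> \<le> \<theta> ^ 3 * \<bar>\<xi> k \<omega>\<bar> ^ 3 / 6
        + \<theta>\<^sup>2 / 2 * ((\<xi> k \<omega>)\<^sup>2 + \<bar>v\<bar>) * (\<theta> * (\<Sum>i\<in>{j..<k}. \<bar>\<xi> i \<omega>\<bar>))"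
      using r dI vq \<theta> by (intro add_mono mult_mono) auto
    also have "\<dots> = R \<omega>"
      unfolding R_def sum.distrib
      by (simp add: algebra_simps power2_eq_square power3_eq_cube add_divide_distrib sum_distrib_left
          flip: sum_distrib_right sum_distrib_left)
    finally show ?thesis .
  qed
  have intR: "integrable M R" unfolding R_def
    by (intro integrable_mult_right Bochner_Integration.integrable_add integrable_divide
        Bochner_Integration.integrable_sum int3 int12 int1)
  have intD: "integrable M D" unfolding D_def
    by (intro Bochner_Integration.integrable_add Bochner_Integration.integrable_diff integrable_mult_right ie ie1 ie2)
  have "cmod (\<integral>\<omega>. D \<omega> \<partial>M) \<le> expectation R"
    using intD intR bound by (intro order_trans[OF integral_norm_bound] integral_mono) auto
  also have "\<dots> = \<theta> ^ 3 * (expectation (\<lambda>\<omega>. \<bar>\<xi> k \<omega>\<bar> ^ 3) / 6 +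
      (\<Sum>i\<in>{j..<k}. expectation (\<lambda>\<omega>. \<bar>\<xi> i \<omega>\<bar> * (\<xi> k \<omega>)\<^sup>2) + \<bar>v\<bar> * expectation (\<lambda>\<omega>. \<bar>\<xi> i \<omega>\<bar>)) / 2)"
    unfolding R_def using int3 int12 int1 by (simp add: Bochner_Integration.integral_sum)
  also have "\<dots> \<le> \<theta> ^ 3 * (C / 6 + (\<Sum>i\<in>{j..<k}. 2 * C + \<bar>v\<bar> * (1 + C)) / 2)"
    using \<theta> by (intro mult_left_mono add_mono divide_right_mono bound3 sum_mono E12 mult_left_mono E1) auto
  \<comment> \<open>The window has at most \<open>m\<close> elements; for \<open>k < m\<close> the
    subtraction \<open>k - m\<close> stops at 0 and the window is shorter.\<close>
  also have "(\<Sum>i\<in>{j..<k}. 2 * C + \<bar>v\<bar> * (1 + C)) \<le> m * (2 * C + \<bar>v\<bar> * (1 + C))"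
    unfolding sum_constant j_def using C0 by (intro mult_right_mono) auto
  finally show ?thesis unfolding ED using \<theta> by (simp add: mult_left_mono)
qed

text \<open>Iterating the one-step comparison \<open>n\<close> times at \<theta> = 1 / sqrt n
  accumulates an error of n * n^(-3/2) * K, while the product of the factors is (1 - v/(2n))^n. The
  constant \<open>K\<close> depends on \<open>m\<close> but not on \<open>n\<close>.\<close>

theorem (in prob_space) char_tendsto_m_dependent:
  fixes \<xi> :: "nat \<Rightarrow> 'a \<Rightarrow> real" and v C :: real
  defines "S \<equiv> \<lambda>n \<omega>. \<Sum>k<n. \<xi> k \<omega>"
  assumes meas[measurable]: "\<And>k. \<xi> k \<in> borel_measurable M"
    and int3: "\<And>k. integrable M (\<lambda>\<omega>. \<bar>\<xi> k \<omega>\<bar> ^ 3)"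
    and bound3: "\<And>k. expectation (\<lambda>\<omega>. \<bar>\<xi> k \<omega>\<bar> ^ 3) \<le> C"
    and mart: "\<And>\<theta> k. (\<integral>\<omega>. iexp (\<theta> * S k \<omega>) * \<xi> k \<omega> \<partial>M) = 0"
    and var: "\<And>\<theta> k. (\<integral>\<omega>. iexp (\<theta> * S (k - m) \<omega>) * (\<xi> k \<omega>)\<^sup>2 \<partial>M) =
                v * (\<integral>\<omega>. iexp (\<theta> * S (k - m) \<omega>) \<partial>M)"
    and v: "v \<ge> 0"
  shows "(\<lambda>n. \<integral>\<omega>. iexp (S n \<omega> / sqrt n) \<partial>M) \<longlonglongrightarrow> exp (- v / 2)"
proof -
  define K where "K = C / 6 + m * (2 * C + \<bar>v\<bar> * (1 + C)) / 2"
  define c where "c = (\<lambda>\<theta> :: real. 1 - \<theta>\<^sup>2 * v / 2)"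
  \<comment> \<open>The condition on \<theta> puts the factor \<open>c\<close> between 0 and 1, so
    the errors of successive steps add up without being amplified.\<close>
  have iter: "cmod ((\<integral>\<omega>. iexp (\<theta> * S k \<omega>) \<partial>M) - c \<theta> ^ k) \<le> k * (\<theta> ^ 3 * K)"
    if "\<theta> \<ge> 0" "\<theta>\<^sup>2 * v / 2 \<le> 1" for \<theta> k
  proof (induction k)
    case 0
    show ?case by (simp add: S_def prob_space)
  next
    case (Suc k)
    let ?a = "\<lambda>k. \<integral>\<omega>. iexp (\<theta> * S k \<omega>) \<partial>M"
    have 1: "cmod (?a (Suc k) - c \<theta> * ?a k) \<le> \<theta> ^ 3 * K"
      using char_step_m_dependent[OF meas int3 bound3 mart[unfolded S_def] var[unfolded S_def] \<open>\<theta> \<ge> 0\<close>, of k]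
      unfolding K_def S_def c_def by simp
    have "?a (Suc k) - c \<theta> ^ Suc k = (?a (Suc k) - c \<theta> * ?a k) + c \<theta> * (?a k - c \<theta> ^ k)"
      by (simp add: algebra_simps)
    then have "cmod (?a (Suc k) - c \<theta> ^ Suc k) \<le> cmod (?a (Suc k) - c \<theta> * ?a k) + cmod (c \<theta> * (?a k - c \<theta> ^ k))"
      by (metis norm_triangle_ineq)
    also have "cmod (c \<theta> * (?a k - c \<theta> ^ k)) \<le> 1 * cmod (?a k - c \<theta> ^ k)"
      unfolding norm_mult norm_of_real using that v by (intro mult_right_mono) (auto simp: c_def)
    finally show ?case using 1 Suc by (simp add: algebra_simps)
  qed
  have lim: "(\<lambda>n. complex_of_real (c (1 / sqrt n) ^ n)) \<longlonglongrightarrow> exp (- v / 2)"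
  proof (rule tendsto_of_real[where 'a=complex, THEN tendsto_eq_rhs])
    have "(\<lambda>n. (1 + (- v / 2) / real n) ^ n) \<longlonglongrightarrow> exp (- v / 2)" by (rule tendsto_exp_limit_sequentially)
    then show "(\<lambda>n. c (1 / sqrt n) ^ n) \<longlonglongrightarrow> exp (- v / 2)"
      by (simp add: c_def power_divide mult.commute)
  qed simp
  have "(\<lambda>n. (\<integral>\<omega>. iexp (S n \<omega> / sqrt n) \<partial>M) - complex_of_real (c (1 / sqrt n) ^ n)) \<longlonglongrightarrow> 0"
  proof (rule Lim_null_comparison)
    have "\<forall>\<^sub>F n in sequentially. v / 2 < real n \<and> n > 0"
      using spec[OF filterlim_real_sequentially[unfolded filterlim_at_top_dense], of "v / 2"]
      by (intro eventually_conj eventually_gt_at_top)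
    then show "\<forall>\<^sub>F n in sequentially.
        cmod ((\<integral>\<omega>. iexp (S n \<omega> / sqrt n) \<partial>M) - complex_of_real (c (1 / sqrt n) ^ n)) \<le> K / sqrt n"
    proof eventually_elim
      case (elim n)
      have "cmod ((\<integral>\<omega>. iexp (1 / sqrt n * S n \<omega>) \<partial>M) - c (1 / sqrt n) ^ n) \<le> n * ((1 / sqrt n) ^ 3 * K)"
        using elim by (intro iter) (auto simp: power_divide field_simps)
      also have "n * ((1 / sqrt n) ^ 3 * K) = K / sqrt n"
        using elim by (simp add: power_divide power3_eq_cube field_simps)
      finally show ?case by simp
    qed
    show "(\<lambda>n. K / sqrt n) \<longlonglongrightarrow> 0"
      by (rule real_tendsto_divide_at_top[OF tendsto_const])
         (rule filterlim_compose[OF sqrt_at_top filterlim_real_sequentially])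
  qed
  from tendsto_add[OF this lim] show ?thesis by simp
qed

section \<open>Convergence in distribution from characteristic functions\<close>

text \<open>The free phase \<open>b\<close> makes one constructor cover cosines, sines (phase
  -\<pi>/2) and constants (frequency 0). Sums of such terms already form an algebra, by the
  product-to-sum formula.\<close>

inductive_set trig_polys :: "nat \<Rightarrow> ((nat \<Rightarrow> real) \<Rightarrow> real) set" for n where
  cos: "(\<lambda>x. c * cos ((\<Sum>i<n. u i * x i) + b)) \<in> trig_polys n"
| add: "f \<in> trig_polys n \<Longrightarrow> g \<in> trig_polys n \<Longrightarrow> (\<lambda>x. f x + g x) \<in> trig_polys n"

lemma trig_polys_mult_cos:
  assumes "g \<in> trig_polys n"
  shows "(\<lambda>x. (c * cos ((\<Sum>i<n. u i * x i) + b)) * g x) \<in> trig_polys n"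
  using assms
proof induction
  case (cos c' u' b')
  have eq: "(c * cos ((\<Sum>i<n. u i * x i) + b)) * (c' * cos ((\<Sum>i<n. u' i * x i) + b')) =
     (c * c' / 2) * cos ((\<Sum>i<n. (u i - u' i) * x i) + (b - b'))
     + (c * c' / 2) * cos ((\<Sum>i<n. (u i + u' i) * x i) + (b + b'))" for x
  proof -
    have 1: "(\<Sum>i<n. (u i - u' i) * x i) + (b - b')
        = ((\<Sum>i<n. u i * x i) + b) - ((\<Sum>i<n. u' i * x i) + b')"
      by (simp add: left_diff_distrib sum_subtractf)
    have 2: "(\<Sum>i<n. (u i + u' i) * x i) + (b + b')
        = ((\<Sum>i<n. u i * x i) + b) + ((\<Sum>i<n. u' i * x i) + b')"
      by (simp add: distrib_right sum.distrib)
    have "c * cos p * (c' * cos r) = c * c' / 2 * cos (p - r) + c * c' / 2 * cos (p + r)" for p r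
      by (simp add: cos_add cos_diff field_simps)
    then show ?thesis unfolding 1 2 .
  qed
  show ?case unfolding eq by (intro trig_polys.intros)
next
  case (add f g)
  then show ?case by (simp add: distrib_left trig_polys.add)
qed

lemma trig_polys_mult:
  assumes "f \<in> trig_polys n" "g \<in> trig_polys n"
  shows "(\<lambda>x. f x * g x) \<in> trig_polys n"
  using assms
proof induction
  case (cos c u b)
  then show ?case by (rule trig_polys_mult_cos)
next
  case (add f1 f2)
  then show ?case by (simp add: distrib_right trig_polys.add)
qed

lemma trig_polys_continuous: "f \<in> trig_polys n \<Longrightarrow> continuous_on S f"
proof (induction rule: trig_polys.induct)
  case (cos c u b)
  have "continuous_on S (\<lambda>x :: nat \<Rightarrow> real. x i)" for i
    by (rule continuous_on_subset[OF continuous_on_product_coordinates]) auto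
  then show ?case by (intro continuous_intros)
qed (intro continuous_intros)

lemma trig_polys_bounded: "f \<in> trig_polys n \<Longrightarrow> \<exists>B. \<forall>x. \<bar>f x\<bar> \<le> B"
proof (induction rule: trig_polys.induct)
  case (cos c u b)
  have "\<bar>c * cos ((\<Sum>i<n. u i * x i) + b)\<bar> \<le> \<bar>c\<bar> * 1" for x
    unfolding abs_mult by (intro mult_left_mono) auto
  then show ?case by blast
next
  case (add f g)
  then obtain B C where "\<And>x. \<bar>f x\<bar> \<le> B" "\<And>x. \<bar>g x\<bar> \<le> C" by auto
  then have "\<bar>f x + g x\<bar> \<le> B + C" for x
    by (meson abs_triangle_ineq add_mono order_trans)
  then show ?case by blast
qed

text \<open>Coordinates from \<open>n\<close> on are pinned to \<open>undefined\<close>, as for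
  points of a product over \<open>{..<n}\<close>. This makes the box a compact subset of the full
  function space, where the test functions live.\<close>

definition std_box :: "nat \<Rightarrow> real \<Rightarrow> (nat \<Rightarrow> real) set" where
  "std_box n k = {x. (\<forall>i<n. \<bar>x i\<bar> \<le> k) \<and> (\<forall>i\<ge>n. x i = undefined)}"

text \<open>Tychonoff: in the product topology the box is a product of closed intervals and
  singletons.\<close>

lemma compact_std_box: "compact (std_box n k)"
proof -
  have iff: "x \<in> std_box n k \<longleftrightarrow> (\<forall>i. x i \<in> (if i < n then cball 0 k else {undefined}))" for x
  proof -
    have "(\<forall>i. x i \<in> (if i < n then cball 0 k else {undefined})) \<longleftrightarrow>
        (\<forall>i. (i < n \<longrightarrow> \<bar>x i\<bar> \<le> k) \<and> (i \<ge> n \<longrightarrow> x i = undefined))"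
      by (intro arg_cong[where f=All] ext) simp
    then show ?thesis unfolding std_box_def by blast
  qed
  have "std_box n k = (\<Pi>\<^sub>E i\<in>UNIV. if i < n then cball 0 k else {undefined})"
    by (simp only: Set.set_eq_iff iff PiE_UNIV_domain Pi_iff ball_UNIV simp_thms)
  moreover have "compactin (product_topology (\<lambda>i. euclidean) UNIV)
      (\<Pi>\<^sub>E i\<in>UNIV. if i < n then cball 0 k else {undefined :: real})"
    by (subst compactin_PiE) auto
  ultimately show ?thesis by (simp add: euclidean_product_topology)
qed

text \<open>
  Only the trigonometric polynomials in the functions \<open>sin (\<pi> x\<^sub>i / (2 k))\<close> are used. They separate the
  points of the box of radius \<open>k\<close>, and all their values are already attained on that box, so the
  approximation on the box comes with a global bound.
\<close>

lemma trig_poly_approx: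
  fixes f :: "(nat \<Rightarrow> real) \<Rightarrow> real"
  assumes cont: "continuous_on UNIV f" and B: "\<And>x. \<bar>f x\<bar> \<le> B" and k: "k > 0" and e: "e > 0"
  obtains g where "g \<in> trig_polys n" "\<And>x. x \<in> std_box n k \<Longrightarrow> \<bar>f x - g x\<bar> < e" "\<And>x. \<bar>g x\<bar> \<le> B + e"
proof -
  \<comment> \<open>This scaling maps [-k, k] onto [-\<pi>/2, \<pi>/2], the interval on which the
    sine is injective.\<close>
  define a where "a = pi / (2 * k)"
  have a: "a > 0" "a * k = pi / 2" using k by (auto simp: a_def)
  \<comment> \<open>A map into the box that preserves every sin(a x_i) with \<open>i < n\<close>.
    Functions built from these sines are invariant under \<open>r\<close>, so a bound on the box is
    a bound everywhere.\<close>
  define r where "r = (\<lambda>x :: nat \<Rightarrow> real. \<lambda>i. if i < n then arcsin (sin (a * x i)) / a else undefined)"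
  have r: "r x \<in> std_box n k" for x
  proof -
    have 1: "\<bar>arcsin (sin (a * x i))\<bar> \<le> pi / 2" for i
      using arcsin_bounded[of "sin (a * x i)"] by auto
    have "\<bar>arcsin (sin (a * x i))\<bar> \<le> k * a" for i
      using a 1[of i] by (simp add: mult.commute)
    then have "\<bar>arcsin (sin (a * x i)) / a\<bar> \<le> k" for i
      unfolding abs_divide using a by (simp add: pos_divide_le_eq)
    then show ?thesis by (simp add: std_box_def r_def)
  qed
  \<comment> \<open>The algebra to which Stone-Weierstrass is applied; invariance under
    \<open>r\<close> is stable under sums and products.\<close>
  define R where "R = {g \<in> trig_polys n. \<forall>x. g (r x) = g x}"
  have sinR: "(\<lambda>x. sin (a * x i)) \<in> R" if "i < n" for i
  proof -
    have "(\<lambda>x. 1 * cos ((\<Sum>j<n. (if j = i then a else 0) * x j) + (- pi / 2))) \<in> trig_polys n"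
      by (rule trig_polys.cos)
    moreover have "(\<lambda>x. 1 * cos ((\<Sum>j<n. (if j = i then a else 0) * x j) + (- pi / 2))) = (\<lambda>x. sin (a * x i))"
      using that by (simp add: if_distrib[of "\<lambda>c. c * _"] cong: if_cong)
        (simp add: cos_diff)
    moreover have "sin (a * r x i) = sin (a * x i)" for x
      using that a by (simp add: r_def)
    ultimately show ?thesis by (simp add: R_def)
  qed
  interpret function_ring_on R "std_box n k"
  proof
    show "compact (std_box n k)" by (rule compact_std_box)
    show "continuous_on (std_box n k) f" if "f \<in> R" for f
      using that trig_polys_continuous by (auto simp: R_def)
    show "(\<lambda>x. f x + g x) \<in> R" if "f \<in> R" "g \<in> R" for f g
      using that by (auto simp: R_def intro: trig_polys.add)
    show "(\<lambda>x. f x * g x) \<in> R" if "f \<in> R" "g \<in> R" for f g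
      using that by (auto simp: R_def intro: trig_polys_mult)
    show "(\<lambda>_. c) \<in> R" for c
      using trig_polys.cos[of c "\<lambda>_. 0" n 0] by (simp add: R_def)
    fix x y assume xy: "x \<in> std_box n k" "y \<in> std_box n k" "x \<noteq> y"
    have "\<exists>i<n. x i \<noteq> y i"
    proof (rule ccontr)
      assume *: "\<not> (\<exists>i<n. x i \<noteq> y i)"
      have "x i = y i" for i using * xy(1,2) by (cases "i < n") (auto simp: std_box_def)
      then show False using xy(3) by auto
    qed
    then obtain i where i: "i < n" "x i \<noteq> y i" by blast
    have "\<bar>a * z i\<bar> \<le> pi / 2" if "z \<in> std_box n k" for z
    proof -
      have "a * \<bar>z i\<bar> \<le> a * k" using that i a by (intro mult_left_mono) (auto simp: std_box_def)
      then show ?thesis unfolding a(2) abs_mult using a(1) by simp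
    qed
    from this[OF xy(1)] this[OF xy(2)]
    have "- (pi / 2) \<le> a * x i" "a * x i \<le> pi / 2" "- (pi / 2) \<le> a * y i" "a * y i \<le> pi / 2"
      by linarith+
    from sin_inj_pi[OF this] have "sin (a * x i) \<noteq> sin (a * y i)"
      using i a by auto
    then show "\<exists>f\<in>R. f x \<noteq> f y"
      using sinR[OF i(1)] by (intro bexI[of _ "\<lambda>x. sin (a * x i)"])
  qed
  have "continuous_on (std_box n k) f" using cont by (rule continuous_on_subset) auto
  from Stone_Weierstrass_basic[OF this e] obtain g
    where g: "g \<in> R" "\<And>x. x \<in> std_box n k \<Longrightarrow> \<bar>f x - g x\<bar> < e" by auto
  have "\<bar>g x\<bar> \<le> B + e" for x
  proof -
    have "\<bar>f (r x) - g (r x)\<bar> < e" using g(2) r by blast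
    moreover have "g (r x) = g x" using g(1) by (simp add: R_def)
    ultimately show ?thesis using B[of "r x"] by linarith
  qed
  with g that show thesis by (auto simp: R_def)
qed

section \<open>The continuity theorem in dimension n\<close>

lemma borel_measurable_coords:
  assumes "random_vec M n Z"
  shows "(\<lambda>\<omega>. coords n (Z \<omega>)) \<in> borel_measurable M"
proof (rule measurable_coordinatewise_then_product)
  fix i
  show "(\<lambda>\<omega>. coords n (Z \<omega>) i) \<in> borel_measurable M"
    using assms by (cases "i < n") (auto simp: coords_def random_vec_def)
qed

text \<open>The inclusion of the finite product space into all real sequences is Borel measurable,
  because the remaining coordinates are constant. Continuous test functions on sequences can
  therefore be integrated against a law on the finite product.\<close>

lemma borel_measurable_PiM_point:
  assumes "sets L = sets (\<Pi>\<^sub>M i\<in>{..<n :: nat}. (borel :: real measure))"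
  shows "(\<lambda>x. x) \<in> borel_measurable L"
proof (rule measurable_coordinatewise_then_product)
  fix i
  have sp: "space L = space (\<Pi>\<^sub>M i\<in>{..<n}. (borel :: real measure))"
    using assms by (rule sets_eq_imp_space_eq)
  show "(\<lambda>x. x i) \<in> borel_measurable L"
  proof (cases "i < n")
    case True
    then have "(\<lambda>x. x i) \<in> borel_measurable (\<Pi>\<^sub>M i\<in>{..<n}. (borel :: real measure))" by simp
    then show ?thesis using measurable_cong_sets[OF assms refl] by blast
  next
    case False
    have "(\<lambda>x. x i) \<in> borel_measurable L \<longleftrightarrow> (\<lambda>x. undefined :: real) \<in> borel_measurable L"
      using False by (intro measurable_cong) (auto simp: sp space_PiM PiE_def extensional_def)
    then show ?thesis by simp
  qed
qed

lemma (in prob_space)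
  fixes a b :: real
  assumes A: "A \<in> events"
  shows integrable_affine_indicator: "integrable M (\<lambda>\<omega>. a + b * indicator A \<omega>)"
    and expectation_affine_indicator: "expectation (\<lambda>\<omega>. a + b * indicator A \<omega>) = a + b * prob A"
proof -
  have i: "integrable M (\<lambda>\<omega>. indicator A \<omega> :: real)"
    using A by (simp add: less_top[symmetric])
  then show "integrable M (\<lambda>\<omega>. a + b * indicator A \<omega>)" by simp
  show "expectation (\<lambda>\<omega>. a + b * indicator A \<omega>) = a + b * prob A"
    using A i by (subst Bochner_Integration.integral_add) (auto simp: prob_space)
qed

text \<open>On a large box the test function is close to a trigonometric polynomial
  \<open>g\<close>, whose expectations converge by \<open>char\<close>. Off the box both functions
  are bounded and the mass is small, by tightness of \<open>Z\<close> and of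
  \<open>L\<close>.\<close>

lemma (in prob_space) tends_to_in_distI:
  assumes rv: "\<And>T. random_vec M n (Z T)"
    and L: "prob_space L" "sets L = sets (\<Pi>\<^sub>M i\<in>{..<n}. (borel :: real measure))"
    and char: "\<And>u. (\<lambda>T. \<integral>\<omega>. iexp (\<Sum>i<n. u i * Z T \<omega> $ i) \<partial>M) \<longlonglongrightarrow> (\<integral>x. iexp (\<Sum>i<n. u i * x i) \<partial>L)"
    and tight: "\<And>e. e > 0 \<Longrightarrow> \<exists>k>0. \<forall>\<^sub>F T in sequentially. prob {\<omega> \<in> space M. \<exists>i<n. \<bar>Z T \<omega> $ i\<bar> > k} < e"
  shows "tends_to_in_dist M n Z L"
  unfolding tends_to_in_dist_def
proof (intro conjI allI impI rv)
  fix f :: "(nat \<Rightarrow> real) \<Rightarrow> real"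
  assume "continuous_on UNIV f \<and> bounded (range f)"
  then obtain B where cont: "continuous_on UNIV f" and B: "\<And>x. \<bar>f x\<bar> \<le> B"
    by (auto simp: bounded_iff)
  have B0: "B \<ge> 0" using B[of "\<lambda>_. 0"] by linarith
  interpret L: prob_space L by fact
  have cm[measurable]: "(\<lambda>\<omega>. coords n (Z T \<omega>)) \<in> borel_measurable M" for T
    using rv by (rule borel_measurable_coords)
  have pm[measurable]: "(\<lambda>x. x) \<in> borel_measurable L"
    using L(2) by (rule borel_measurable_PiM_point)
  have Zm[measurable]: "(\<lambda>\<omega>. Z T \<omega> $ i) \<in> borel_measurable M" if "i < n" for i T
    using rv that by (auto simp: random_vec_def)
  have xm[measurable]: "(\<lambda>x. x i) \<in> borel_measurable L" for i
    using measurable_product_then_coordinatewise[OF pm] .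
  have fm[measurable]: "f \<in> borel_measurable borel"
    using cont by (rule borel_measurable_continuous_onI)
  have trig_lim: "(\<lambda>T. \<integral>\<omega>. g (coords n (Z T \<omega>)) \<partial>M) \<longlonglongrightarrow> (\<integral>x. g x \<partial>L)" if "g \<in> trig_polys n" for g
    using that
  proof induction
    case (cos c u b)
    \<comment> \<open>Each basic term is the real part of a constant times the exponential that
      defines the characteristic function.\<close>
    have re: "c * cos ((\<Sum>i<n. u i * x i) + b) = Re (c * iexp b * iexp (\<Sum>i<n. u i * x i))" for x
    proof -
      have "c * cos (y + b) = Re (c * iexp b * iexp y)" for y
        by (simp add: cos_add algebra_simps flip: cis_conv_exp)
      then show ?thesis .
    qed
    have iZ: "integrable M (\<lambda>\<omega>. iexp (\<Sum>i<n. u i * Z T \<omega> $ i))" for T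
      by (rule integrable_const_bound[where B=1]) auto
    have iL: "integrable L (\<lambda>x. iexp (\<Sum>i<n. u i * x i))"
      by (rule L.integrable_const_bound[where B=1]) auto
    have 1: "(\<integral>\<omega>. c * cos ((\<Sum>i<n. u i * coords n (Z T \<omega>) i) + b) \<partial>M)
        = Re (c * iexp b * (\<integral>\<omega>. iexp (\<Sum>i<n. u i * Z T \<omega> $ i) \<partial>M))" for T
    proof -
      have "(\<integral>\<omega>. c * cos ((\<Sum>i<n. u i * coords n (Z T \<omega>) i) + b) \<partial>M)
          = (\<integral>\<omega>. Re (c * iexp b * iexp (\<Sum>i<n. u i * Z T \<omega> $ i)) \<partial>M)"
        unfolding re by (simp add: coords_def)
      also have "\<dots> = Re (\<integral>\<omega>. c * iexp b * iexp (\<Sum>i<n. u i * Z T \<omega> $ i) \<partial>M)"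
        using iZ by (intro integral_Re integrable_mult_right)
      also have "\<dots> = Re (c * iexp b * (\<integral>\<omega>. iexp (\<Sum>i<n. u i * Z T \<omega> $ i) \<partial>M))"
        by (subst integral_mult_right_zero) simp
      finally show ?thesis .
    qed
    have 2: "(\<integral>x. c * cos ((\<Sum>i<n. u i * x i) + b) \<partial>L)
        = Re (c * iexp b * (\<integral>x. iexp (\<Sum>i<n. u i * x i) \<partial>L))"
    proof -
      have "(\<integral>x. c * cos ((\<Sum>i<n. u i * x i) + b) \<partial>L) = Re (\<integral>x. c * iexp b * iexp (\<Sum>i<n. u i * x i) \<partial>L)"
        unfolding re using iL by (intro integral_Re integrable_mult_right)
      also have "\<dots> = Re (c * iexp b * (\<integral>x. iexp (\<Sum>i<n. u i * x i) \<partial>L))"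
        by (subst integral_mult_right_zero) simp
      finally show ?thesis .
    qed
    show ?case unfolding 1 2 by (intro tendsto_intros char)
  next
    case (add f g)
    have i: "integrable M (\<lambda>\<omega>. h (coords n (Z T \<omega>)))" "integrable L h" if h: "h \<in> trig_polys n" for h T
    proof -
      obtain C where C: "\<And>x. \<bar>h x\<bar> \<le> C" using trig_polys_bounded[OF h] by blast
      have [measurable]: "h \<in> borel_measurable borel"
        using trig_polys_continuous[OF h] by (rule borel_measurable_continuous_onI)
      show "integrable M (\<lambda>\<omega>. h (coords n (Z T \<omega>)))"
        by (rule integrable_const_bound[where B=C]) (use C in auto)
      show "integrable L h"
        by (rule L.integrable_const_bound[where B=C]) (use C in \<open>auto intro: measurable_compose[OF pm]\<close>)
    qed
    show ?case using add by (simp add: i) (intro tendsto_intros)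
  qed
  show "(\<lambda>T. \<integral>\<omega>. f (coords n (Z T \<omega>)) \<partial>M) \<longlonglongrightarrow> (\<integral>x. f x \<partial>L)"
  proof (rule tendstoI)
    fix e' :: real assume "e' > 0"
    \<comment> \<open>Error budget: replacing \<open>f\<close> by \<open>g\<close> costs e + (2B +
      1)e under each of the two laws, and convergence of the expectations of \<open>g\<close> costs
      e, in total (5 + 4B)e.\<close>
    define e where "e = e' / (6 + 4 * B)"
    have e: "e > 0" and ee': "e * (6 + 4 * B) \<le> e'" using \<open>e' > 0\<close> B0 by (auto simp: e_def)
    \<comment> \<open>The cap at 1 gives |g| \<le> B + 1, hence |f - g| \<le> 2B + 1 off the
      box.\<close>
    define e1 where "e1 = min e 1"
    have e1: "e1 > 0" "e1 \<le> e" "e1 \<le> 1" using e by (auto simp: e1_def)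
    define out where "out = (\<lambda>k (x :: nat \<Rightarrow> real). \<exists>i<n. \<bar>x i\<bar> > k)"
    obtain k1 where k1: "k1 > 0" "\<forall>\<^sub>F T in sequentially. prob {\<omega> \<in> space M. \<exists>i<n. \<bar>Z T \<omega> $ i\<bar> > k1} < e"
      using tight[OF e] by auto
    \<comment> \<open>Tightness of the single law \<open>L\<close>, by continuity from above along
      decreasing events with empty intersection.\<close>
    have "(\<lambda>k. measure L {x \<in> space L. out (real k) x}) \<longlonglongrightarrow> measure L (\<Inter>k. {x \<in> space L. out (real k) x})"
    proof (rule L.finite_Lim_measure_decseq)
      show "range (\<lambda>k. {x \<in> space L. out (real k) x}) \<subseteq> sets L"
        unfolding out_def by auto
      show "decseq (\<lambda>k. {x \<in> space L. out (real k) x})"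
        unfolding out_def decseq_def by (auto intro: order_le_less_trans[rotated])
    qed
    moreover have "(\<Inter>k. {x \<in> space L. out (real k) x}) = {}"
    proof -
      have "\<exists>k. \<not> out (real k) x" for x
      proof -
        obtain k where "(\<Sum>i<n. \<bar>x i\<bar>) \<le> real k" using real_arch_simple by blast
        moreover have "\<bar>x i\<bar> \<le> (\<Sum>i<n. \<bar>x i\<bar>)" if "i < n" for i
          using that by (intro member_le_sum) auto
        ultimately show ?thesis unfolding out_def by (metis not_le order_trans)
      qed
      then show ?thesis by auto
    qed
    ultimately have "(\<lambda>k. measure L {x \<in> space L. out (real k) x}) \<longlonglongrightarrow> 0" by simp
    \<comment> \<open>One radius must serve both laws: small mass under \<open>L\<close>, and at
      least \<open>k1\<close> so that the tightness bound for \<open>Z\<close> carries over.\<close>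
    then have "\<forall>\<^sub>F k in sequentially. measure L {x \<in> space L. out (real k) x} < e \<and> k1 \<le> real k"
      using e eventually_compose_filterlim[OF eventually_ge_at_top filterlim_real_sequentially]
      by (intro eventually_conj order_tendstoD(2)) auto
    then obtain kn where kn: "measure L {x \<in> space L. out (real kn) x} < e" "k1 \<le> real kn"
      using eventually_happens'[OF sequentially_bot] by blast
    define k where "k = real kn"
    have k: "k > 0" "k1 \<le> k" "measure L {x \<in> space L. out k x} < e" using k1 kn by (auto simp: k_def)
    obtain g where g: "g \<in> trig_polys n" "\<And>x. x \<in> std_box n k \<Longrightarrow> \<bar>f x - g x\<bar> < e1" "\<And>x. \<bar>g x\<bar> \<le> B + e1"
      using trig_poly_approx[OF cont B k(1) e1(1)] by blast
    have gm[measurable]: "g \<in> borel_measurable borel"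
      using trig_polys_continuous[OF g(1)] by (rule borel_measurable_continuous_onI)
    have fg: "\<bar>f x - g x\<bar> \<le> e + (2 * B + 1) * indicator {x. out k x} x" if "\<And>i. i \<ge> n \<Longrightarrow> x i = undefined" for x
    proof (cases "out k x")
      case True
      then show ?thesis using B[of x] g(3)[of x] e1 e by (simp add: abs_if split: if_splits)
    next
      case False
      have "\<bar>x i\<bar> \<le> k" if "i < n" for i
        using False that unfolding out_def by (meson linorder_not_less)
      then have "x \<in> std_box n k" using that by (simp add: std_box_def)
      from g(2)[OF this] False show ?thesis using e1 by simp
    qed
    have gM: "integrable M (\<lambda>\<omega>. g (coords n (Z T \<omega>)))" "integrable M (\<lambda>\<omega>. f (coords n (Z T \<omega>)))" for T
      using g(3) B by (auto intro!: integrable_const_bound AE_I2)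
    have gL: "integrable L g" "integrable L f"
      using g(3) B measurable_compose[OF pm gm] measurable_compose[OF pm fm]
      by (auto intro!: L.integrable_const_bound AE_I2)
    have oM[measurable]: "{\<omega> \<in> space M. out k (coords n (Z T \<omega>))} \<in> sets M" for T
      unfolding out_def by (auto simp: coords_def)
    have oL[measurable]: "{x \<in> space L. out k x} \<in> sets L"
      unfolding out_def by auto
    have dM: "\<bar>(\<integral>\<omega>. f (coords n (Z T \<omega>)) \<partial>M) - (\<integral>\<omega>. g (coords n (Z T \<omega>)) \<partial>M)\<bar>
        \<le> e + (2 * B + 1) * prob {\<omega> \<in> space M. out k (coords n (Z T \<omega>))}" for T
    proof -
      have "\<bar>(\<integral>\<omega>. f (coords n (Z T \<omega>)) \<partial>M) - (\<integral>\<omega>. g (coords n (Z T \<omega>)) \<partial>M)\<bar>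
          = \<bar>\<integral>\<omega>. f (coords n (Z T \<omega>)) - g (coords n (Z T \<omega>)) \<partial>M\<bar>"
        using gM by simp
      also have "\<dots> \<le> (\<integral>\<omega>. \<bar>f (coords n (Z T \<omega>)) - g (coords n (Z T \<omega>))\<bar> \<partial>M)"
        by (rule integral_abs_bound)
      also have "\<dots> \<le> (\<integral>\<omega>. e + (2 * B + 1) * indicator {\<omega> \<in> space M. out k (coords n (Z T \<omega>))} \<omega> \<partial>M)"
      proof (rule integral_mono)
        show "integrable M (\<lambda>\<omega>. e + (2 * B + 1) * indicator {\<omega> \<in> space M. out k (coords n (Z T \<omega>))} \<omega>)"
          using oM by (rule integrable_affine_indicator)
        show "integrable M (\<lambda>\<omega>. \<bar>f (coords n (Z T \<omega>)) - g (coords n (Z T \<omega>))\<bar>)"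
          using gM by simp
        show "\<bar>f (coords n (Z T \<omega>)) - g (coords n (Z T \<omega>))\<bar>
            \<le> e + (2 * B + 1) * indicator {\<omega> \<in> space M. out k (coords n (Z T \<omega>))} \<omega>" if "\<omega> \<in> space M" for \<omega>
          using fg[of "coords n (Z T \<omega>)"] that by (simp add: indicator_def coords_def)
      qed
      also have "\<dots> = e + (2 * B + 1) * prob {\<omega> \<in> space M. out k (coords n (Z T \<omega>))}"
        using oM by (rule expectation_affine_indicator)
      finally show ?thesis .
    qed
    have sp: "space L = extensional {..<n}"
      using sets_eq_imp_space_eq[OF L(2)] by (auto simp: space_PiM PiE_def)
    have dL: "\<bar>(\<integral>x. f x \<partial>L) - (\<integral>x. g x \<partial>L)\<bar> \<le> e + (2 * B + 1) * measure L {x \<in> space L. out k x}"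
    proof -
      have "\<bar>(\<integral>x. f x \<partial>L) - (\<integral>x. g x \<partial>L)\<bar> = \<bar>\<integral>x. f x - g x \<partial>L\<bar>"
        using gL by simp
      also have "\<dots> \<le> (\<integral>x. \<bar>f x - g x\<bar> \<partial>L)"
        by (rule integral_abs_bound)
      also have "\<dots> \<le> (\<integral>x. e + (2 * B + 1) * indicator {x \<in> space L. out k x} x \<partial>L)"
      proof (rule integral_mono)
        show "integrable L (\<lambda>x. e + (2 * B + 1) * indicator {x \<in> space L. out k x} x)"
          using oL by (rule L.integrable_affine_indicator)
        show "integrable L (\<lambda>x. \<bar>f x - g x\<bar>)"
          using gL by simp
        show "\<bar>f x - g x\<bar> \<le> e + (2 * B + 1) * indicator {x \<in> space L. out k x} x" if "x \<in> space L" for x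
          using fg[of x] that by (simp add: indicator_def sp extensional_def)
      qed
      also have "\<dots> = e + (2 * B + 1) * measure L {x \<in> space L. out k x}"
        using oL by (rule L.expectation_affine_indicator)
      finally show ?thesis .
    qed
    have "\<forall>\<^sub>F T in sequentially. dist (\<integral>\<omega>. g (coords n (Z T \<omega>)) \<partial>M) (\<integral>x. g x \<partial>L) < e"
      using trig_lim[OF g(1)] e by (rule tendstoD)
    with k1(2) show "\<forall>\<^sub>F T in sequentially. dist (\<integral>\<omega>. f (coords n (Z T \<omega>)) \<partial>M) (\<integral>x. f x \<partial>L) < e'"
    proof eventually_elim
      case (elim T)
      have "prob {\<omega> \<in> space M. out k (coords n (Z T \<omega>))} \<le> prob {\<omega> \<in> space M. \<exists>i<n. \<bar>Z T \<omega> $ i\<bar> > k1}"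
        using k by (intro finite_measure_mono) (auto simp: out_def coords_def intro: order_le_less_trans)
      then have p: "prob {\<omega> \<in> space M. out k (coords n (Z T \<omega>))} \<le> e" using elim by simp
      have m1: "(2 * B + 1) * prob {\<omega> \<in> space M. out k (coords n (Z T \<omega>))} \<le> (2 * B + 1) * e"
        using p B0 by (intro mult_left_mono) auto
      have m2: "(2 * B + 1) * measure L {x \<in> space L. out k x} \<le> (2 * B + 1) * e"
        using k B0 by (intro mult_left_mono) auto
      have "\<bar>(\<integral>\<omega>. f (coords n (Z T \<omega>)) \<partial>M) - (\<integral>x. f x \<partial>L)\<bar> < e * (6 + 4 * B)"
        using dM[of T] dL m1 m2 elim(2) e unfolding dist_real_def
        by (simp add: algebra_simps)
      then show ?case using ee' by (simp add: dist_real_def)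
    qed
  qed
qed

section \<open>Gaussian integrals\<close>

text \<open>Forms and vectors are plain functions of indices, so that the inductions can drop the
  last variable without changing a carrier.\<close>

definition bil :: "nat \<Rightarrow> (nat \<Rightarrow> nat \<Rightarrow> real) \<Rightarrow> (nat \<Rightarrow> real) \<Rightarrow> (nat \<Rightarrow> real) \<Rightarrow> real" where
  "bil n p x y = (\<Sum>i<n. \<Sum>j<n. p i j * x i * y j)"

definition pos_def :: "nat \<Rightarrow> (nat \<Rightarrow> nat \<Rightarrow> real) \<Rightarrow> bool" where
  "pos_def n p \<longleftrightarrow> (\<forall>i<n. \<forall>j<n. p i j = p j i) \<and> (\<forall>x. (\<exists>i<n. x i \<noteq> 0) \<longrightarrow> bil n p x x > 0)"

text \<open>The Schur complement of the last diagonal entry, that is, the form left over once the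
  square in the last variable has been completed.\<close>

definition schur :: "nat \<Rightarrow> (nat \<Rightarrow> nat \<Rightarrow> real) \<Rightarrow> nat \<Rightarrow> nat \<Rightarrow> real" where
  "schur n p i j = p i j - p i n * p j n / p n n"

lemma bil_cong: "(\<And>i. i < n \<Longrightarrow> x i = x' i) \<Longrightarrow> (\<And>i. i < n \<Longrightarrow> y i = y' i) \<Longrightarrow> bil n p x y = bil n p x' y'"
  unfolding bil_def by (intro sum.cong) auto

text \<open>Completing the square, in polarised form: the same identity then splits the exponent
  (\<open>x\<close> against \<open>x\<close>) and the phase (\<open>x\<close> against
  \<open>y\<close>) of the Gaussian integral.\<close>

lemma bil_Suc:
  assumes sym: "\<And>i. i < n \<Longrightarrow> p n i = p i n" and a: "p n n \<noteq> 0"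
  shows "bil (Suc n) p x y =
    p n n * (x n + (\<Sum>i<n. p i n * x i) / p n n) * (y n + (\<Sum>i<n. p i n * y i) / p n n) + bil n (schur n p) x y"
proof -
  define X where "X = (\<Sum>i<n. p i n * x i)"
  define Y where "Y = (\<Sum>i<n. p i n * y i)"
  have "bil (Suc n) p x y = (\<Sum>i<n. \<Sum>j<n. p i j * x i * y j) + (\<Sum>i<n. p i n * x i * y n)
      + ((\<Sum>j<n. p n j * x n * y j) + p n n * x n * y n)"
    unfolding bil_def by (simp add: sum.distrib)
  also have "(\<Sum>i<n. p i n * x i * y n) = X * y n"
    by (simp add: X_def sum_distrib_right)
  also have "(\<Sum>j<n. p n j * x n * y j) = x n * Y"
    using sym by (simp add: Y_def sum_distrib_left mult_ac)
  also have "(\<Sum>i<n. \<Sum>j<n. p i j * x i * y j) = bil n (schur n p) x y + X * Y / p n n"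
  proof -
    have "X * Y / p n n = (\<Sum>i<n. \<Sum>j<n. p i n * p j n / p n n * x i * y j)"
      unfolding X_def Y_def sum_product sum_divide_distrib by (simp add: mult_ac)
    then show ?thesis
      unfolding bil_def schur_def by (simp add: left_diff_distrib sum_subtractf)
  qed
  finally show ?thesis
    unfolding X_def[symmetric] Y_def[symmetric] using a by (simp add: field_simps)
qed

lemma pos_defD: "pos_def n p \<Longrightarrow> \<exists>i<n. x i \<noteq> 0 \<Longrightarrow> bil n p x x > 0"
  by (simp add: pos_def_def)

lemma pos_def_Suc:
  assumes "pos_def (Suc n) p"
  shows "p n n > 0" "pos_def n (schur n p)"
proof -
  have sym: "\<And>i j. i < Suc n \<Longrightarrow> j < Suc n \<Longrightarrow> p i j = p j i" and
    pos: "\<And>x. (\<exists>i<Suc n. x i \<noteq> 0) \<Longrightarrow> bil (Suc n) p x x > 0"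
    using assms by (auto simp: pos_def_def)
  have "bil (Suc n) p (\<lambda>i. if i = n then 1 else 0) (\<lambda>i. if i = n then 1 else 0) = p n n"
    unfolding bil_def by (simp add: if_distrib[of "\<lambda>c. _ * c"] cong: if_cong)
  with pos[of "\<lambda>i. if i = n then 1 else 0"] show a: "p n n > 0" by auto
  have "bil n (schur n p) x x > 0" if "\<exists>i<n. x i \<noteq> 0" for x
  proof -
    \<comment> \<open>The last coordinate is chosen to make the completed square vanish, so that the
      form at \<open>z\<close> is the Schur form at \<open>x\<close>.\<close>
    define z where "z = x(n := - (\<Sum>i<n. p i n * x i) / p n n)"
    have "\<exists>i<Suc n. z i \<noteq> 0" using that by (auto simp: z_def)
    from pos[OF this] have "0 < bil (Suc n) p z z" .
    also have "bil (Suc n) p z z = bil n (schur n p) z z"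
    proof -
      have "(\<Sum>i<n. p i n * z i) = (\<Sum>i<n. p i n * x i)"
        by (intro sum.cong) (auto simp: z_def)
      then have "z n + (\<Sum>i<n. p i n * z i) / p n n = 0" by (simp add: z_def)
      moreover have "p n i = p i n" if "i < n" for i using sym[of n i] that by simp
      ultimately show ?thesis using a bil_Suc[of n p z z] by simp
    qed
    also have "\<dots> = bil n (schur n p) x x"
      by (intro bil_cong) (auto simp: z_def)
    finally show ?thesis .
  qed
  then show "pos_def n (schur n p)"
    using sym by (auto simp: pos_def_def schur_def)
qed

text \<open>The matrix factors as a block upper triangular matrix with diagonal blocks Schur
  complement and pivot, times a unit lower triangular one.\<close>

lemma det_Suc:
  assumes sym: "\<And>i. i < n \<Longrightarrow> p n i = p i n" and a: "p n n \<noteq> (0 :: real)"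
  shows "det (mat (Suc n) (Suc n) (\<lambda>(i, j). p i j)) = p n n * det (mat n n (\<lambda>(i, j). schur n p i j))"
proof -
  define U where "U = four_block_mat (mat n n (\<lambda>(i, j). schur n p i j)) (mat n 1 (\<lambda>(i, j). p i n))
      (0\<^sub>m 1 n) (mat 1 1 (\<lambda>(i, j). p n n))"
  define L where "L = four_block_mat (1\<^sub>m n) (0\<^sub>m n 1) (mat 1 n (\<lambda>(i, j). p j n / p n n)) (1\<^sub>m 1 :: real mat)"
  have "U * L = four_block_mat
      (mat n n (\<lambda>(i, j). schur n p i j) * 1\<^sub>m n + mat n 1 (\<lambda>(i, j). p i n) * mat 1 n (\<lambda>(i, j). p j n / p n n))
      (mat n n (\<lambda>(i, j). schur n p i j) * 0\<^sub>m n 1 + mat n 1 (\<lambda>(i, j). p i n) * 1\<^sub>m 1)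
      (0\<^sub>m 1 n * 1\<^sub>m n + mat 1 1 (\<lambda>(i, j). p n n) * mat 1 n (\<lambda>(i, j). p j n / p n n))
      (0\<^sub>m 1 n * 0\<^sub>m n 1 + mat 1 1 (\<lambda>(i, j). p n n) * 1\<^sub>m 1)"
    unfolding U_def L_def by (rule mult_four_block_mat) auto
  also have "\<dots> = mat (Suc n) (Suc n) (\<lambda>(i, j). p i j)"
    using sym a
    by (intro eq_matI) (auto simp: four_block_mat_def Let_def schur_def scalar_prod_def less_Suc_eq)
  finally have "det (mat (Suc n) (Suc n) (\<lambda>(i, j). p i j)) = det (U * L)" by simp
  also have "\<dots> = det U * det L"
    by (rule det_mult[of _ "Suc n"]) (auto simp: U_def L_def)
  also have "det U = det (mat n n (\<lambda>(i, j). schur n p i j)) * p n n"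
    unfolding U_def by (subst det_four_block_mat_lower_left_zero[of _ n _ 1]) (auto simp: det_single)
  also have "det L = 1"
    unfolding L_def by (subst det_four_block_mat_upper_right_zero[of _ n _ 1]) auto
  finally show ?thesis by simp
qed

lemma det_pos_def: "pos_def n p \<Longrightarrow> det (mat n n (\<lambda>(i, j). p i j)) > 0"
proof (induction n arbitrary: p)
  case (Suc n)
  note pd = pos_def_Suc[OF Suc.prems]
  have "p n i = p i n" if "i < n" for i using Suc.prems that by (auto simp: pos_def_def)
  then show ?case using pd Suc.IH[OF pd(2)] by (subst det_Suc) auto
qed simp

text \<open>The substitution s = -m + t / sqrt a reduces both integrals to the standard normal law.
  The phase has the shape a (s + m) h because that is the cross term produced by completing the
  square.\<close>

lemma gaussian_integral_shift:
  fixes a m h :: real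
  assumes a: "a > 0"
  shows "(\<integral>\<^sup>+s. ennreal (exp (- a * (s + m)\<^sup>2 / 2)) \<partial>lborel) = ennreal (sqrt (2 * pi / a))"
    and "(\<integral>s. complex_of_real (exp (- a * (s + m)\<^sup>2 / 2)) * iexp (a * (s + m) * h) \<partial>lborel)
        = complex_of_real (sqrt (2 * pi / a) * exp (- a * h\<^sup>2 / 2))"
proof -
  have sq: "a * (1 / sqrt a * t)\<^sup>2 = t\<^sup>2" for t
    using a by (simp add: power_mult_distrib power_divide)
  have "(\<integral>\<^sup>+s. ennreal (exp (- a * (s + m)\<^sup>2 / 2)) \<partial>lborel)
      = \<bar>1 / sqrt a\<bar> * (\<integral>\<^sup>+t. ennreal (exp (- a * ((- m + 1 / sqrt a * t) + m)\<^sup>2 / 2)) \<partial>lborel)"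
    using a by (intro nn_integral_real_affine) auto
  also have "(\<lambda>t. ennreal (exp (- a * ((- m + 1 / sqrt a * t) + m)\<^sup>2 / 2)))
      = (\<lambda>t. ennreal (sqrt (2 * pi)) * ennreal (std_normal_density t))"
    using sq by (simp add: std_normal_density_def flip: ennreal_mult)
  also have "(\<integral>\<^sup>+t. ennreal (sqrt (2 * pi)) * ennreal (std_normal_density t) \<partial>lborel) = ennreal (sqrt (2 * pi))"
    using prob_space.emeasure_space_1[OF prob_space_normal_density[of 1 0]]
    by (simp add: nn_integral_cmult emeasure_density)
  finally show "(\<integral>\<^sup>+s. ennreal (exp (- a * (s + m)\<^sup>2 / 2)) \<partial>lborel) = ennreal (sqrt (2 * pi / a))"
    using a by (simp add: real_sqrt_divide flip: ennreal_mult)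
  have std: "(\<integral>t. complex_of_real (exp (- t\<^sup>2 / 2)) * iexp (u * t) \<partial>lborel) = complex_of_real (sqrt (2 * pi) * exp (- u\<^sup>2 / 2))" for u
  proof -
    have "(\<integral>t. complex_of_real (exp (- t\<^sup>2 / 2)) * iexp (u * t) \<partial>lborel)
        = (\<integral>t. complex_of_real (sqrt (2 * pi)) * (std_normal_density t *\<^sub>R iexp (u * t)) \<partial>lborel)"
      by (intro Bochner_Integration.integral_cong) (auto simp: std_normal_density_def scaleR_conv_of_real)
    also have "\<dots> = complex_of_real (sqrt (2 * pi)) * (\<integral>t. std_normal_density t *\<^sub>R iexp (u * t) \<partial>lborel)"
      by (rule integral_mult_right_zero)
    also have "(\<integral>t. std_normal_density t *\<^sub>R iexp (u * t) \<partial>lborel) = char std_normal_distribution u"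
      unfolding char_def by (subst integral_density) auto
    finally show ?thesis by (simp add: char_std_normal_distribution)
  qed
  have "(\<integral>s. complex_of_real (exp (- a * (s + m)\<^sup>2 / 2)) * iexp (a * (s + m) * h) \<partial>lborel)
      = \<bar>1 / sqrt a\<bar> *\<^sub>R (\<integral>t. complex_of_real (exp (- a * ((- m + 1 / sqrt a * t) + m)\<^sup>2 / 2))
          * iexp (a * ((- m + 1 / sqrt a * t) + m) * h) \<partial>lborel)"
    using a by (intro lborel_integral_real_affine) auto
  also have "(\<lambda>t. complex_of_real (exp (- a * ((- m + 1 / sqrt a * t) + m)\<^sup>2 / 2)) * iexp (a * ((- m + 1 / sqrt a * t) + m) * h))
      = (\<lambda>t. complex_of_real (exp (- t\<^sup>2 / 2)) * iexp ((sqrt a * h) * t))"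
  proof
    fix t
    have "a * ((- m + 1 / sqrt a * t) + m) * h = (a / sqrt a) * h * t" by simp
    then have "a * ((- m + 1 / sqrt a * t) + m) * h = (sqrt a * h) * t"
      using real_div_sqrt[of a] a by simp
    moreover have "a * ((- m + 1 / sqrt a * t) + m)\<^sup>2 = t\<^sup>2" using sq by simp
    ultimately show "complex_of_real (exp (- a * ((- m + 1 / sqrt a * t) + m)\<^sup>2 / 2))
        * iexp (a * ((- m + 1 / sqrt a * t) + m) * h) = complex_of_real (exp (- t\<^sup>2 / 2)) * iexp ((sqrt a * h) * t)"
      by simp
  qed
  also have "(\<integral>t. complex_of_real (exp (- t\<^sup>2 / 2)) * iexp ((sqrt a * h) * t) \<partial>lborel)
      = complex_of_real (sqrt (2 * pi) * exp (- (sqrt a * h)\<^sup>2 / 2))"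
    by (rule std)
  finally show "(\<integral>s. complex_of_real (exp (- a * (s + m)\<^sup>2 / 2)) * iexp (a * (s + m) * h) \<partial>lborel)
      = complex_of_real (sqrt (2 * pi / a) * exp (- a * h\<^sup>2 / 2))"
    using a by (simp add: real_sqrt_divide power_mult_distrib scaleR_conv_of_real)
qed

lemma borel_measurable_bil[measurable]:
  "(\<lambda>x. bil n p x x) \<in> borel_measurable (\<Pi>\<^sub>M i\<in>{..<n}. lborel)"
  "(\<lambda>x. bil n p x y) \<in> borel_measurable (\<Pi>\<^sub>M i\<in>{..<n}. lborel)"
proof -
  have [measurable]: "(\<lambda>x. x i) \<in> borel_measurable (\<Pi>\<^sub>M i\<in>{..<n}. lborel)" if "i < n" for i
    using measurable_component_singleton[of i "{..<n}" "\<lambda>_. lborel"] that by simp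
  show "(\<lambda>x. bil n p x x) \<in> borel_measurable (\<Pi>\<^sub>M i\<in>{..<n}. lborel)"
    "(\<lambda>x. bil n p x y) \<in> borel_measurable (\<Pi>\<^sub>M i\<in>{..<n}. lborel)"
    unfolding bil_def by measurable
qed

text \<open>The phase is the form paired with \<open>y\<close>, not an arbitrary linear functional:
  exponent and phase then split along the same square, and integrating out the last variable leaves
  an integral of the same kind with the Schur form. Finiteness belongs to the same induction since
  it yields the integrability that Fubini requires.\<close>

lemma gaussian_integral:
  assumes "pos_def n p"
  shows "(\<integral>\<^sup>+x. ennreal (exp (- bil n p x x / 2)) \<partial>(\<Pi>\<^sub>M i\<in>{..<n}. lborel)) < \<infinity> \<and>
    (\<forall>y. (\<integral>x. complex_of_real (exp (- bil n p x x / 2)) * iexp (bil n p x y) \<partial>(\<Pi>\<^sub>M i\<in>{..<n}. lborel))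
      = complex_of_real (sqrt ((2 * pi) ^ n / det (mat n n (\<lambda>(i, j). p i j))) * exp (- bil n p y y / 2)))"
  using assms
proof (induction n arbitrary: p)
  case 0
  show ?case
    by (simp add: bil_def PiM_empty nn_integral_count_space_finite lebesgue_integral_count_space_finite)
next
  case (Suc n)
  interpret product_sigma_finite "\<lambda>_ :: nat. lborel :: real measure" by standard
  define a where "a = p n n"
  define h where "h = (\<lambda>x. (\<Sum>i<n. p i n * x i) / p n n)"
  note pd = Suc.prems
  show ?case
  proof (intro conjI allI)
    have sym: "p n i = p i n" if "i < n" for i using pd that by (auto simp: pos_def_def)
    have a0: "a > 0" and pd': "pos_def n (schur n p)" using pos_def_Suc[OF pd] by (auto simp: a_def)
    have bilS: "bil (Suc n) p x z = a * (x n + h x) * (z n + h z) + bil n (schur n p) x z" for x z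
      unfolding a_def h_def using sym a0 by (intro bil_Suc) (auto simp: a_def)
    have h_upd: "h (x(n := s)) = h x" for x s unfolding h_def by simp
    have b_upd: "bil n (schur n p) (x(n := s)) (x(n := s)) = bil n (schur n p) x x"
      "bil n (schur n p) (x(n := s)) z = bil n (schur n p) x z"
      "bil n (schur n p) z (x(n := s)) = bil n (schur n p) z x" for x z s
      by (rule bil_cong; simp)+
    have exp_split: "exp (- (a * u * u + b) / 2) = exp (- a * u\<^sup>2 / 2) * exp (- b / 2)" for u b :: real
      by (simp add: power2_eq_square diff_divide_distrib add_divide_distrib flip: exp_add)
    have ins: "{..<Suc n} = insert n {..<n}" by auto
    have "(\<integral>\<^sup>+x. ennreal (exp (- bil (Suc n) p x x / 2)) \<partial>(\<Pi>\<^sub>M i\<in>{..<Suc n}. lborel))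
      = (\<integral>\<^sup>+x. \<integral>\<^sup>+s. ennreal (exp (- bil (Suc n) p (x(n := s)) (x(n := s)) / 2)) \<partial>lborel \<partial>(\<Pi>\<^sub>M i\<in>{..<n}. lborel))"
      unfolding ins by (rule product_nn_integral_insert) (auto simp flip: ins)
    also have "\<dots> = (\<integral>\<^sup>+x. ennreal (sqrt (2 * pi / a)) * ennreal (exp (- bil n (schur n p) x x / 2)) \<partial>(\<Pi>\<^sub>M i\<in>{..<n}. lborel))"
    proof (intro nn_integral_cong)
      fix x
      have "(\<integral>\<^sup>+s. ennreal (exp (- bil (Suc n) p (x(n := s)) (x(n := s)) / 2)) \<partial>lborel)
        = (\<integral>\<^sup>+s. ennreal (exp (- a * (s + h x)\<^sup>2 / 2)) * ennreal (exp (- bil n (schur n p) x x / 2)) \<partial>lborel)"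
        unfolding bilS h_upd b_upd fun_upd_same exp_split by (simp add: ennreal_mult)
      also have "\<dots> = ennreal (sqrt (2 * pi / a)) * ennreal (exp (- bil n (schur n p) x x / 2))"
        using gaussian_integral_shift(1)[OF a0, of "h x"] by (subst nn_integral_multc) auto
      finally show "(\<integral>\<^sup>+s. ennreal (exp (- bil (Suc n) p (x(n := s)) (x(n := s)) / 2)) \<partial>lborel)
        = ennreal (sqrt (2 * pi / a)) * ennreal (exp (- bil n (schur n p) x x / 2))" .
    qed
    also have "\<dots> = ennreal (sqrt (2 * pi / a)) * (\<integral>\<^sup>+x. ennreal (exp (- bil n (schur n p) x x / 2)) \<partial>(\<Pi>\<^sub>M i\<in>{..<n}. lborel))"
      by (rule nn_integral_cmult) measurable
    also have "\<dots> < \<infinity>" using Suc.IH[OF pd'] by (simp add: ennreal_mult_less_top)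
    finally show fin: "(\<integral>\<^sup>+x. ennreal (exp (- bil (Suc n) p x x / 2)) \<partial>(\<Pi>\<^sub>M i\<in>{..<Suc n}. lborel)) < \<infinity>" .
    fix y
    have int: "integrable (\<Pi>\<^sub>M i\<in>{..<Suc n}. lborel) (\<lambda>x. complex_of_real (exp (- bil (Suc n) p x x / 2)) * iexp (bil (Suc n) p x y))"
      unfolding integrable_iff_bounded using fin by (auto simp: norm_mult)
    have "(\<integral>x. complex_of_real (exp (- bil (Suc n) p x x / 2)) * iexp (bil (Suc n) p x y) \<partial>(\<Pi>\<^sub>M i\<in>{..<Suc n}. lborel))
      = (\<integral>x. \<integral>s. complex_of_real (exp (- bil (Suc n) p (x(n := s)) (x(n := s)) / 2)) * iexp (bil (Suc n) p (x(n := s)) y) \<partial>lborel \<partial>(\<Pi>\<^sub>M i\<in>{..<n}. lborel))"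
      unfolding ins by (rule product_integral_insert) (use int in \<open>auto simp flip: ins\<close>)
    also have "\<dots> = (\<integral>x. complex_of_real (sqrt (2 * pi / a) * exp (- a * (y n + h y)\<^sup>2 / 2))
        * (complex_of_real (exp (- bil n (schur n p) x x / 2)) * iexp (bil n (schur n p) x y)) \<partial>(\<Pi>\<^sub>M i\<in>{..<n}. lborel))"
    proof (intro Bochner_Integration.integral_cong refl)
      fix x
      have "(\<integral>s. complex_of_real (exp (- bil (Suc n) p (x(n := s)) (x(n := s)) / 2)) * iexp (bil (Suc n) p (x(n := s)) y) \<partial>lborel)
        = (\<integral>s. complex_of_real (exp (- a * (s + h x)\<^sup>2 / 2)) * iexp (a * (s + h x) * (y n + h y))
            * (complex_of_real (exp (- bil n (schur n p) x x / 2)) * iexp (bil n (schur n p) x y)) \<partial>lborel)"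
      proof (intro Bochner_Integration.integral_cong refl)
        fix s
        have 1: "exp (- bil (Suc n) p (x(n := s)) (x(n := s)) / 2)
            = exp (- a * (s + h x)\<^sup>2 / 2) * exp (- bil n (schur n p) x x / 2)"
          unfolding bilS h_upd b_upd fun_upd_same exp_split ..
        have 2: "iexp (bil (Suc n) p (x(n := s)) y)
            = iexp (a * (s + h x) * (y n + h y)) * iexp (bil n (schur n p) x y)"
          unfolding bilS h_upd b_upd fun_upd_same of_real_add distrib_left exp_add ..
        show "complex_of_real (exp (- bil (Suc n) p (x(n := s)) (x(n := s)) / 2)) * iexp (bil (Suc n) p (x(n := s)) y)
          = complex_of_real (exp (- a * (s + h x)\<^sup>2 / 2)) * iexp (a * (s + h x) * (y n + h y))
            * (complex_of_real (exp (- bil n (schur n p) x x / 2)) * iexp (bil n (schur n p) x y))"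
          unfolding 1 2 of_real_mult by (simp only: mult_ac)
      qed
      also have "\<dots> = complex_of_real (sqrt (2 * pi / a) * exp (- a * (y n + h y)\<^sup>2 / 2))
          * (complex_of_real (exp (- bil n (schur n p) x x / 2)) * iexp (bil n (schur n p) x y))"
        unfolding gaussian_integral_shift(2)[OF a0, of "h x" "y n + h y", symmetric]
        by (rule integral_mult_left_zero)
      finally show "(\<integral>s. complex_of_real (exp (- bil (Suc n) p (x(n := s)) (x(n := s)) / 2)) * iexp (bil (Suc n) p (x(n := s)) y) \<partial>lborel)
        = complex_of_real (sqrt (2 * pi / a) * exp (- a * (y n + h y)\<^sup>2 / 2))
          * (complex_of_real (exp (- bil n (schur n p) x x / 2)) * iexp (bil n (schur n p) x y))" .
    qed
    also have "\<dots> = complex_of_real (sqrt (2 * pi / a) * exp (- a * (y n + h y)\<^sup>2 / 2))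
        * complex_of_real (sqrt ((2 * pi) ^ n / det (mat n n (\<lambda>(i, j). schur n p i j))) * exp (- bil n (schur n p) y y / 2))"
      by (subst integral_mult_right_zero) (simp only: conjunct2[OF Suc.IH[OF pd'], rule_format])
    also have "\<dots> = complex_of_real ((sqrt (2 * pi / a) * sqrt ((2 * pi) ^ n / det (mat n n (\<lambda>(i, j). schur n p i j))))
        * (exp (- a * (y n + h y)\<^sup>2 / 2) * exp (- bil n (schur n p) y y / 2)))"
      unfolding of_real_mult by (simp only: mult_ac)
    also have "sqrt (2 * pi / a) * sqrt ((2 * pi) ^ n / det (mat n n (\<lambda>(i, j). schur n p i j)))
        = sqrt ((2 * pi) ^ Suc n / det (mat (Suc n) (Suc n) (\<lambda>(i, j). p i j)))"
      using sym a0 by (subst det_Suc) (auto simp: a_def simp flip: real_sqrt_mult)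
    also have "exp (- a * (y n + h y)\<^sup>2 / 2) * exp (- bil n (schur n p) y y / 2) = exp (- bil (Suc n) p y y / 2)"
      unfolding bilS exp_split ..
    finally show "(\<integral>x. complex_of_real (exp (- bil (Suc n) p x x / 2)) * iexp (bil (Suc n) p x y) \<partial>(\<Pi>\<^sub>M i\<in>{..<Suc n}. lborel))
      = complex_of_real (sqrt ((2 * pi) ^ Suc n / det (mat (Suc n) (Suc n) (\<lambda>(i, j). p i j))) * exp (- bil (Suc n) p y y / 2))" .
  qed
qed

text \<open>The law enters through its precision matrix \<open>H\<close>; the assumptions on
  \<open>V\<close> are the two features of the covariance that the density uses, its inverse and its
  determinant. Frequencies are written as \<open>H\<close> applied to \<open>y\<close> to match the
  Gaussian integral.\<close>

lemma
  assumes H: "H \<in> carrier_mat n n" and pd: "pos_def n (\<lambda>i j. H $$ (i, j))"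
    and V: "inv_mat V = H" "det V = 1 / det H"
  shows prob_space_multivariate_normal: "prob_space (multivariate_normal n (0\<^sub>v n) V)"
    and sets_multivariate_normal: "sets (multivariate_normal n (0\<^sub>v n) V) = sets (\<Pi>\<^sub>M i\<in>{..<n}. (borel :: real measure))"
    and char_multivariate_normal:
      "(\<integral>x. iexp (\<Sum>i<n. (\<Sum>j<n. H $$ (i, j) * y j) * x i) \<partial>multivariate_normal n (0\<^sub>v n) V)
        = complex_of_real (exp (- bil n (\<lambda>i j. H $$ (i, j)) y y / 2))"
proof -
  define p where "p = (\<lambda>i j. H $$ (i, j))"
  define L where "L = (\<Pi>\<^sub>M i\<in>{..<n}. lborel :: real measure)"
  define c where "c = sqrt ((2 * pi) ^ n * det V)"
  have matp: "mat n n (\<lambda>(i, j). p i j) = H" using H by (intro eq_matI) (auto simp: p_def)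
  have det: "det H > 0" using det_pos_def[OF pd] matp by (simp add: p_def)
  have c: "c > 0" "sqrt ((2 * pi) ^ n / det H) = c" using det V by (auto simp: c_def)
  have quad: "scalar_prod (vec n x - 0\<^sub>v n) (inv_mat V *\<^sub>v (vec n x - 0\<^sub>v n)) = bil n p x x" for x
    using H unfolding V(1)
    by (simp add: scalar_prod_def bil_def p_def sum_distrib_left lessThan_atLeast0 mult_ac minus_vec_def)
  have mn: "multivariate_normal n (0\<^sub>v n) V = density L (\<lambda>x. ennreal (exp (- bil n p x x / 2) / c))"
    unfolding multivariate_normal_def quad L_def c_def ..
  show "sets (multivariate_normal n (0\<^sub>v n) V) = sets (\<Pi>\<^sub>M i\<in>{..<n}. (borel :: real measure))"
    unfolding mn sets_density L_def by (intro sets_PiM_cong) auto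
  have [measurable]: "(\<lambda>x. bil n p x x) \<in> borel_measurable L" "(\<lambda>x. bil n p x y) \<in> borel_measurable L" for y
    unfolding L_def by measurable
  have fin: "(\<integral>\<^sup>+x. ennreal (exp (- bil n p x x / 2)) \<partial>L) < \<infinity>"
    using gaussian_integral[OF pd] by (simp add: p_def L_def)
  have int: "(\<integral>x. complex_of_real (exp (- bil n p x x / 2)) * iexp (bil n p x y) \<partial>L) = complex_of_real (c * exp (- bil n p y y / 2))" for y
    using conjunct2[OF gaussian_integral[OF pd], rule_format, of y] matp c unfolding p_def L_def by simp
  have char: "(\<integral>x. iexp (bil n p x y) \<partial>multivariate_normal n (0\<^sub>v n) V) = complex_of_real (exp (- bil n p y y / 2))" for y
  proof -
    have "(\<integral>x. iexp (bil n p x y) \<partial>multivariate_normal n (0\<^sub>v n) V)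
        = (\<integral>x. (exp (- bil n p x x / 2) / c) *\<^sub>R iexp (bil n p x y) \<partial>L)"
      unfolding mn using c by (intro integral_density) auto
    also have "\<dots> = (\<integral>x. complex_of_real (1 / c) * (complex_of_real (exp (- bil n p x x / 2)) * iexp (bil n p x y)) \<partial>L)"
      by (simp add: scaleR_conv_of_real)
    also have "\<dots> = complex_of_real (1 / c) * complex_of_real (c * exp (- bil n p y y / 2))"
      by (subst integral_mult_right_zero) (simp only: int)
    finally show ?thesis using c by simp
  qed
  have "bil n p x y = (\<Sum>i<n. (\<Sum>j<n. H $$ (i, j) * y j) * x i)" for x y
    by (simp add: bil_def p_def sum_distrib_left sum_distrib_right mult_ac)
  then show "(\<integral>x. iexp (\<Sum>i<n. (\<Sum>j<n. H $$ (i, j) * y j) * x i) \<partial>multivariate_normal n (0\<^sub>v n) V)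
      = complex_of_real (exp (- bil n (\<lambda>i j. H $$ (i, j)) y y / 2))"
    using char[of y] by (simp add: p_def)
  have intr: "integrable L (\<lambda>x. exp (- bil n p x x / 2))"
    unfolding integrable_iff_bounded using fin by auto
  \<comment> \<open>The case \<open>y = 0\<close> of the integral with phase is the total mass,
    which identifies the normalising constant.\<close>
  have "complex_of_real (\<integral>x. exp (- bil n p x x / 2) \<partial>L) = (\<integral>x. complex_of_real (exp (- bil n p x x / 2)) * iexp (bil n p x (\<lambda>_. 0)) \<partial>L)"
    unfolding bil_def by (simp flip: integral_complex_of_real)
  also have "\<dots> = complex_of_real c" unfolding int by (simp add: bil_def)
  finally have "(\<integral>x. exp (- bil n p x x / 2) \<partial>L) = c" by (simp only: of_real_eq_iff)
  then have "(\<integral>\<^sup>+x. ennreal (exp (- bil n p x x / 2)) \<partial>L) = ennreal c"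
    using nn_integral_eq_integral[OF intr] by simp
  moreover have "(\<integral>\<^sup>+x. ennreal (exp (- bil n p x x / 2) / c) \<partial>L)
      = (\<integral>\<^sup>+x. ennreal (1 / c) * ennreal (exp (- bil n p x x / 2)) \<partial>L)"
    using c by (simp flip: ennreal_mult)
  ultimately have "(\<integral>\<^sup>+x. ennreal (exp (- bil n p x x / 2) / c) \<partial>L) = ennreal (1 / c) * ennreal c"
    by (simp add: nn_integral_cmult)
  also have "\<dots> = 1" using c by (simp flip: ennreal_mult)
  finally show "prob_space (multivariate_normal n (0\<^sub>v n) V)"
    unfolding mn by (intro prob_spaceI) (simp add: emeasure_density)
qed

section \<open>Moment bounds\<close>

context prob_space
begin

definition L2 :: "('a \<Rightarrow> real) \<Rightarrow> bool" where
  "L2 f \<longleftrightarrow> f \<in> borel_measurable M \<and> integrable M (\<lambda>\<omega>. (f \<omega>)\<^sup>2)"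

lemma L2_measurable: "L2 f \<Longrightarrow> f \<in> borel_measurable M"
  by (simp add: L2_def)

lemma L2_mult_integrable:
  assumes "L2 f" "L2 g"
  shows "integrable M (\<lambda>\<omega>. f \<omega> * g \<omega>)"
proof (rule Bochner_Integration.integrable_bound)
  show "integrable M (\<lambda>\<omega>. (f \<omega>)\<^sup>2 + (g \<omega>)\<^sup>2)" using assms by (simp add: L2_def)
  show "(\<lambda>\<omega>. f \<omega> * g \<omega>) \<in> borel_measurable M" using assms by (auto simp: L2_def)
  have "\<bar>a * b\<bar> \<le> a\<^sup>2 + b\<^sup>2" for a b :: real
  proof -
    have "2 * (\<bar>a\<bar> * \<bar>b\<bar>) \<le> a\<^sup>2 + b\<^sup>2" using sum_squares_bound[of "\<bar>a\<bar>" "\<bar>b\<bar>"] by simp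
    moreover have "0 \<le> \<bar>a\<bar> * \<bar>b\<bar>" by simp
    ultimately show ?thesis unfolding abs_mult by linarith
  qed
  then show "AE \<omega> in M. norm (f \<omega> * g \<omega>) \<le> norm ((f \<omega>)\<^sup>2 + (g \<omega>)\<^sup>2)" by simp
qed

lemma L2_const: "L2 (\<lambda>_. c)"
  by (simp add: L2_def)

lemma L2_integrable: "L2 f \<Longrightarrow> integrable M f"
  using L2_mult_integrable[of f "\<lambda>_. 1"] L2_const by simp

lemma L2_add:
  assumes "L2 f" "L2 g"
  shows "L2 (\<lambda>\<omega>. f \<omega> + g \<omega>)"
proof -
  have "(\<lambda>\<omega>. (f \<omega> + g \<omega>)\<^sup>2) = (\<lambda>\<omega>. (f \<omega>)\<^sup>2 + 2 * (f \<omega> * g \<omega>) + (g \<omega>)\<^sup>2)"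
    by (simp add: power2_sum algebra_simps)
  then show ?thesis using assms L2_mult_integrable[OF assms] by (auto simp: L2_def)
qed

lemma L2_cmult: "L2 f \<Longrightarrow> L2 (\<lambda>\<omega>. c * f \<omega>)"
  by (auto simp: L2_def power_mult_distrib)

lemma L2_diff: "L2 f \<Longrightarrow> L2 g \<Longrightarrow> L2 (\<lambda>\<omega>. f \<omega> - g \<omega>)"
  using L2_add[of f "\<lambda>\<omega>. - 1 * g \<omega>"] L2_cmult[of g "-1"] by simp

lemma L2_sum: "(\<And>i. i \<in> I \<Longrightarrow> L2 (f i)) \<Longrightarrow> L2 (\<lambda>\<omega>. \<Sum>i\<in>I. f i \<omega>)"
  by (induction I rule: infinite_finite_induct) (auto intro: L2_add L2_const)

lemma L2_cauchy_schwarz: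
  assumes "L2 f" "L2 g"
  shows "expectation (\<lambda>\<omega>. \<bar>f \<omega> * g \<omega>\<bar>) \<le> sqrt (expectation (\<lambda>\<omega>. (f \<omega>)\<^sup>2)) * sqrt (expectation (\<lambda>\<omega>. (g \<omega>)\<^sup>2))"
proof -
  have [measurable]: "f \<in> borel_measurable M" "g \<in> borel_measurable M"
    using assms by (auto simp: L2_def)
  have nn: "(\<integral>\<^sup>+\<omega>. ennreal \<bar>f \<omega>\<bar> * ennreal \<bar>g \<omega>\<bar> \<partial>M) = ennreal (expectation (\<lambda>\<omega>. \<bar>f \<omega> * g \<omega>\<bar>))"
    using integrable_abs[OF L2_mult_integrable[OF assms]]
    by (subst nn_integral_eq_integral[symmetric]) (auto simp: abs_mult ennreal_mult)
  have sq: "(\<integral>\<^sup>+\<omega>. (ennreal \<bar>h \<omega>\<bar>)\<^sup>2 \<partial>M) = ennreal (expectation (\<lambda>\<omega>. (h \<omega>)\<^sup>2))" if "L2 h" for h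
    using that by (subst nn_integral_eq_integral[symmetric]) (auto simp: L2_def ennreal_power)
  have "(ennreal (expectation (\<lambda>\<omega>. \<bar>f \<omega> * g \<omega>\<bar>)))\<^sup>2
      \<le> ennreal (expectation (\<lambda>\<omega>. (f \<omega>)\<^sup>2)) * ennreal (expectation (\<lambda>\<omega>. (g \<omega>)\<^sup>2))"
    unfolding nn[symmetric] sq[OF assms(1), symmetric] sq[OF assms(2), symmetric]
    by (rule Cauchy_Schwarz_nn_integral) auto
  then have "(expectation (\<lambda>\<omega>. \<bar>f \<omega> * g \<omega>\<bar>))\<^sup>2 \<le> expectation (\<lambda>\<omega>. (f \<omega>)\<^sup>2) * expectation (\<lambda>\<omega>. (g \<omega>)\<^sup>2)"
    by (simp add: ennreal_power integral_nonneg_AE flip: ennreal_mult)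
  then show ?thesis
    unfolding real_sqrt_mult[symmetric] by (rule real_le_rsqrt)
qed

lemma L2_expectation_abs_le: "L2 f \<Longrightarrow> expectation (\<lambda>\<omega>. \<bar>f \<omega>\<bar>) \<le> sqrt (expectation (\<lambda>\<omega>. (f \<omega>)\<^sup>2))"
  using L2_cauchy_schwarz[of f "\<lambda>_. 1"] L2_const by (simp add: prob_space)

lemma L2_expectation_square_diff_le:
  assumes "L2 f" "L2 g"
  shows "expectation (\<lambda>\<omega>. (f \<omega> - g \<omega>)\<^sup>2) \<le> 2 * expectation (\<lambda>\<omega>. (f \<omega>)\<^sup>2) + 2 * expectation (\<lambda>\<omega>. (g \<omega>)\<^sup>2)"
proof -
  have "expectation (\<lambda>\<omega>. (f \<omega> - g \<omega>)\<^sup>2) \<le> expectation (\<lambda>\<omega>. 2 * (f \<omega>)\<^sup>2 + 2 * (g \<omega>)\<^sup>2)"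
  proof (rule integral_mono)
    show "integrable M (\<lambda>\<omega>. (f \<omega> - g \<omega>)\<^sup>2)" using L2_diff[OF assms] by (simp add: L2_def)
    show "integrable M (\<lambda>\<omega>. 2 * (f \<omega>)\<^sup>2 + 2 * (g \<omega>)\<^sup>2)" using assms by (simp add: L2_def)
    have "(a - b)\<^sup>2 \<le> 2 * a\<^sup>2 + 2 * b\<^sup>2" for a b :: real
      using zero_le_power2[of "a + b"] by (simp add: power2_eq_square algebra_simps)
    then show "(f \<omega> - g \<omega>)\<^sup>2 \<le> 2 * (f \<omega>)\<^sup>2 + 2 * (g \<omega>)\<^sup>2" for \<omega> .
  qed
  then show ?thesis using assms by (simp add: L2_def)
qed

text \<open>A bound on fourth moments that is uniform in time stands in for identical distribution.
  The class is closed under finite linear combinations and time changes, hence contains the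
  truncated moving averages.\<close>

definition bdd4 :: "(int \<Rightarrow> 'a \<Rightarrow> real) \<Rightarrow> bool" where
  "bdd4 f \<longleftrightarrow> (\<forall>t. f t \<in> borel_measurable M) \<and>
     (\<exists>C. \<forall>t. integrable M (\<lambda>\<omega>. f t \<omega> ^ 4) \<and> expectation (\<lambda>\<omega>. f t \<omega> ^ 4) \<le> C)"

lemma bdd4I:
  assumes "\<And>t. f t \<in> borel_measurable M"
    and "\<And>t. integrable M (g t)" "\<And>t. expectation (g t) \<le> C" "\<And>t \<omega>. f t \<omega> ^ 4 \<le> g t \<omega>"
  shows "bdd4 f"
proof -
  have i: "integrable M (\<lambda>\<omega>. f t \<omega> ^ 4)" for t
    by (rule Bochner_Integration.integrable_bound[OF assms(2)[of t]])
      (use assms(1,4) in \<open>auto intro!: order_trans[OF _ abs_ge_self]\<close>)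
  have "expectation (\<lambda>\<omega>. f t \<omega> ^ 4) \<le> C" for t
    using integral_mono[OF i assms(2)] assms(3,4) by (meson order_trans)
  with i assms(1) show ?thesis unfolding bdd4_def by blast
qed

lemma bdd4_add:
  assumes "bdd4 f" "bdd4 g"
  shows "bdd4 (\<lambda>t \<omega>. f t \<omega> + g t \<omega>)"
proof -
  obtain C where C: "\<And>t. integrable M (\<lambda>\<omega>. f t \<omega> ^ 4)" "\<And>t. expectation (\<lambda>\<omega>. f t \<omega> ^ 4) \<le> C"
    using assms(1) by (auto simp: bdd4_def)
  obtain D where D: "\<And>t. integrable M (\<lambda>\<omega>. g t \<omega> ^ 4)" "\<And>t. expectation (\<lambda>\<omega>. g t \<omega> ^ 4) \<le> D"
    using assms(2) by (auto simp: bdd4_def)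
  have [measurable]: "f t \<in> borel_measurable M" "g t \<in> borel_measurable M" for t
    using assms by (auto simp: bdd4_def)
  have sq: "(u + v)\<^sup>2 \<le> 2 * u\<^sup>2 + 2 * v\<^sup>2" for u v :: real
    using zero_le_power2[of "u - v"] by (simp add: power2_eq_square algebra_simps)
  \<comment> \<open>The factor 8 comes from applying (u + v)^2 \<le> 2u^2 + 2v^2 twice.\<close>
  have le: "(a + b) ^ 4 \<le> 8 * a ^ 4 + 8 * b ^ 4" for a b :: real
  proof -
    have "((a + b)\<^sup>2)\<^sup>2 \<le> (2 * a\<^sup>2 + 2 * b\<^sup>2)\<^sup>2" by (intro power_mono sq) auto
    also have "\<dots> \<le> 2 * (2 * a\<^sup>2)\<^sup>2 + 2 * (2 * b\<^sup>2)\<^sup>2" by (rule sq)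
    finally show ?thesis by (simp add: power_mult_distrib flip: power_mult)
  qed
  show ?thesis
  proof (rule bdd4I)
    show "integrable M (\<lambda>\<omega>. 8 * f t \<omega> ^ 4 + 8 * g t \<omega> ^ 4)" for t using C D by simp
    show "expectation (\<lambda>\<omega>. 8 * f t \<omega> ^ 4 + 8 * g t \<omega> ^ 4) \<le> 8 * C + 8 * D" for t
      using C D[of t] by (simp add: add_mono)
  qed (use le in auto)
qed

lemma bdd4_cmult:
  assumes "bdd4 f"
  shows "bdd4 (\<lambda>t \<omega>. c * f t \<omega>)"
proof -
  obtain C where C: "\<And>t. integrable M (\<lambda>\<omega>. f t \<omega> ^ 4)" "\<And>t. expectation (\<lambda>\<omega>. f t \<omega> ^ 4) \<le> C"
    using assms by (auto simp: bdd4_def)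
  show ?thesis
  proof (rule bdd4I)
    show "integrable M (\<lambda>\<omega>. c ^ 4 * f t \<omega> ^ 4)" for t using C by simp
    show "expectation (\<lambda>\<omega>. c ^ 4 * f t \<omega> ^ 4) \<le> c ^ 4 * C" for t
      using C by (simp add: mult_left_mono)
    have [measurable]: "f t \<in> borel_measurable M" for t using assms by (simp add: bdd4_def)
    show "(\<lambda>\<omega>. c * f t \<omega>) \<in> borel_measurable M" for t by measurable
  qed (use assms in \<open>auto simp: bdd4_def power_mult_distrib\<close>)
qed

lemma bdd4_const: "bdd4 (\<lambda>_ _. c)"
  by (auto simp: bdd4_def)

lemma bdd4_sum: "(\<And>i. i \<in> I \<Longrightarrow> bdd4 (f i)) \<Longrightarrow> bdd4 (\<lambda>t \<omega>. \<Sum>i\<in>I. f i t \<omega>)"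
  by (induction I rule: infinite_finite_induct) (auto intro: bdd4_add bdd4_const)

lemma bdd4_shift: "bdd4 f \<Longrightarrow> bdd4 (\<lambda>t. f (h t))"
  unfolding bdd4_def by blast

lemma bdd4_diff: "bdd4 f \<Longrightarrow> bdd4 g \<Longrightarrow> bdd4 (\<lambda>t \<omega>. f t \<omega> - g t \<omega>)"
  using bdd4_add[of f "\<lambda>t \<omega>. - 1 * g t \<omega>"] bdd4_cmult[of g "-1"] by simp

lemma bdd4_L2:
  assumes "bdd4 f"
  shows "L2 (f t)"
proof -
  have [measurable]: "f t \<in> borel_measurable M" and i: "integrable M (\<lambda>\<omega>. f t \<omega> ^ 4)"
    using assms by (auto simp: bdd4_def)
  have le: "a\<^sup>2 \<le> 1 + a ^ 4" for a :: real
  proof -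
    have "2 * a\<^sup>2 \<le> a ^ 4 + 1"
      using zero_le_power2[of "a\<^sup>2 - 1"] by (simp add: power2_diff flip: power_mult)
    moreover have "0 \<le> a\<^sup>2" by simp
    ultimately show ?thesis by linarith
  qed
  have "integrable M (\<lambda>\<omega>. (f t \<omega>)\<^sup>2)"
    by (rule Bochner_Integration.integrable_bound[of _ "\<lambda>\<omega>. 1 + f t \<omega> ^ 4"])
      (use i le in \<open>auto intro!: order_trans[OF _ abs_ge_self]\<close>)
  then show ?thesis by (simp add: L2_def)
qed

text \<open>Products of two such variables have variances bounded uniformly in both times, which is
  the input to the variance bound behind the law of large numbers.\<close>

lemma bdd4_mult:
  assumes "bdd4 f" "bdd4 g"
  shows "L2 (\<lambda>\<omega>. f t \<omega> * g s \<omega>)"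
    and "\<exists>C. \<forall>t s. expectation (\<lambda>\<omega>. (f t \<omega> * g s \<omega>)\<^sup>2) \<le> C"
proof -
  obtain C where C: "\<And>t. integrable M (\<lambda>\<omega>. f t \<omega> ^ 4)" "\<And>t. expectation (\<lambda>\<omega>. f t \<omega> ^ 4) \<le> C"
    using assms(1) by (auto simp: bdd4_def)
  obtain D where D: "\<And>t. integrable M (\<lambda>\<omega>. g t \<omega> ^ 4)" "\<And>t. expectation (\<lambda>\<omega>. g t \<omega> ^ 4) \<le> D"
    using assms(2) by (auto simp: bdd4_def)
  have [measurable]: "f t \<in> borel_measurable M" "g t \<in> borel_measurable M" for t
    using assms by (auto simp: bdd4_def)
  have le: "(a * b)\<^sup>2 \<le> a ^ 4 + b ^ 4" for a b :: real
  proof -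
    have "2 * (a * b)\<^sup>2 \<le> a ^ 4 + b ^ 4"
      using sum_squares_bound[of "a\<^sup>2" "b\<^sup>2"] by (simp add: power_mult_distrib flip: power_mult)
    moreover have "0 \<le> (a * b)\<^sup>2" by simp
    ultimately show ?thesis by linarith
  qed
  have i: "integrable M (\<lambda>\<omega>. (f t \<omega> * g s \<omega>)\<^sup>2)" for t s
    by (rule Bochner_Integration.integrable_bound[of _ "\<lambda>\<omega>. f t \<omega> ^ 4 + g s \<omega> ^ 4"])
      (use C D le in \<open>auto intro!: order_trans[OF _ abs_ge_self]\<close>)
  then show "L2 (\<lambda>\<omega>. f t \<omega> * g s \<omega>)" by (simp add: L2_def)
  have "expectation (\<lambda>\<omega>. (f t \<omega> * g s \<omega>)\<^sup>2) \<le> C + D" for t s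
  proof -
    have "expectation (\<lambda>\<omega>. (f t \<omega> * g s \<omega>)\<^sup>2) \<le> expectation (\<lambda>\<omega>. f t \<omega> ^ 4 + g s \<omega> ^ 4)"
      using i C D le by (intro integral_mono) auto
    also have "\<dots> \<le> C + D" using C D by (simp add: add_mono)
    finally show ?thesis .
  qed
  then show "\<exists>C. \<forall>t s. expectation (\<lambda>\<omega>. (f t \<omega> * g s \<omega>)\<^sup>2) \<le> C" by blast
qed

end

section \<open>Moving average approximation of stable autoregressions\<close>

lemma sum_swap_pairs:
  "(\<Sum>k\<in>A. \<Sum>l\<in>B. \<Sum>a\<in>C. \<Sum>b\<in>D. f k l a b) = (\<Sum>a\<in>C. \<Sum>b\<in>D. \<Sum>k\<in>A. \<Sum>l\<in>B. f k l a b)"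
proof -
  have "(\<Sum>k\<in>A. \<Sum>l\<in>B. \<Sum>a\<in>C. \<Sum>b\<in>D. f k l a b) = (\<Sum>k\<in>A. \<Sum>a\<in>C. \<Sum>l\<in>B. \<Sum>b\<in>D. f k l a b)"
    by (rule sum.cong[OF refl], rule sum.swap)
  also have "\<dots> = (\<Sum>a\<in>C. \<Sum>k\<in>A. \<Sum>l\<in>B. \<Sum>b\<in>D. f k l a b)"
    by (rule sum.swap)
  also have "\<dots> = (\<Sum>a\<in>C. \<Sum>k\<in>A. \<Sum>b\<in>D. \<Sum>l\<in>B. f k l a b)"
    by (rule sum.cong[OF refl], rule sum.cong[OF refl], rule sum.swap)
  also have "\<dots> = (\<Sum>a\<in>C. \<Sum>b\<in>D. \<Sum>k\<in>A. \<Sum>l\<in>B. f k l a b)"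
    by (rule sum.cong[OF refl], rule sum.swap)
  finally show ?thesis .
qed

text \<open>A first-order vector autoregression in coordinates. \<open>P m\<close> stands for the
  m-th power of \<open>F\<close>, but enters only through its recursion and its decay, so that the
  limit theory is free of matrix theory. The process is tied to the noise only by the one-step
  equation and by constant second moments.\<close>

locale stable_var = prob_space M for M :: "'a measure" +
  fixes d :: nat
    and F :: "nat \<Rightarrow> nat \<Rightarrow> real"
    and P :: "nat \<Rightarrow> nat \<Rightarrow> nat \<Rightarrow> real"
    and x e :: "int \<Rightarrow> nat \<Rightarrow> 'a \<Rightarrow> real"
    and Gam Om :: "nat \<Rightarrow> nat \<Rightarrow> real"
  assumes x_L2: "\<And>t l. l < d \<Longrightarrow> L2 (x t l)"
    and x_cov: "\<And>t k l. k < d \<Longrightarrow> l < d \<Longrightarrow> expectation (\<lambda>\<omega>. x t k \<omega> * x t l \<omega>) = Gam k l"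
    and x_step: "\<And>t l. l < d \<Longrightarrow> AE \<omega> in M. x t l \<omega> = (\<Sum>k<d. F l k * x (t - 1) k \<omega>) + e t l \<omega>"
    and e_indep: "indep_vars (\<lambda>_. \<Pi>\<^sub>M l\<in>{..<d}. borel) (\<lambda>t \<omega>. \<lambda>l\<in>{..<d}. e t l \<omega>) UNIV"
    and e_bdd4: "\<And>l. l < d \<Longrightarrow> bdd4 (\<lambda>t. e t l)"
    and e_mean: "\<And>t l. l < d \<Longrightarrow> expectation (e t l) = 0"
    and e_cov: "\<And>t k l. k < d \<Longrightarrow> l < d \<Longrightarrow> expectation (\<lambda>\<omega>. e t k \<omega> * e t l \<omega>) = Om k l"
    and P_0: "\<And>l k. l < d \<Longrightarrow> k < d \<Longrightarrow> P 0 l k = (if l = k then 1 else 0)"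
    and P_Suc: "\<And>m l k. l < d \<Longrightarrow> k < d \<Longrightarrow> P (Suc m) l k = (\<Sum>j<d. P m l j * F j k)"
    and P_lim: "\<And>l k. l < d \<Longrightarrow> k < d \<Longrightarrow> (\<lambda>m. P m l k) \<longlonglongrightarrow> 0"
begin

section \<open>Sigma-algebras generated by the noise at given times\<close>

definition hist :: "int set \<Rightarrow> 'a measure" where
  "hist A = vimage_algebra (space M) (\<lambda>\<omega>. \<lambda>t\<in>A. \<lambda>l\<in>{..<d}. e t l \<omega>) (\<Pi>\<^sub>M t\<in>A. \<Pi>\<^sub>M l\<in>{..<d}. borel)"

lemma space_hist[simp]: "space (hist A) = space M"
  by (simp add: hist_def)

lemma noise_path_funcset:
  "(\<lambda>\<omega>. \<lambda>t\<in>A. \<lambda>l\<in>{..<d}. e t l \<omega>) \<in> space M \<rightarrow> space (\<Pi>\<^sub>M t\<in>A. \<Pi>\<^sub>M l\<in>{..<d}. (borel :: real measure))"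
  by (auto simp: space_PiM)

lemma sets_hist:
  "sets (hist A) = {(\<lambda>\<omega>. \<lambda>t\<in>A. \<lambda>l\<in>{..<d}. e t l \<omega>) -` S \<inter> space M | S. S \<in> sets (\<Pi>\<^sub>M t\<in>A. \<Pi>\<^sub>M l\<in>{..<d}. borel)}"
  unfolding hist_def by (rule sets_vimage_algebra2[OF noise_path_funcset])

lemma e_hist:
  assumes "t \<in> A" "l < d"
  shows "e t l \<in> borel_measurable (hist A)"
proof -
  have 1: "(\<lambda>z. z t) \<in> measurable (\<Pi>\<^sub>M t\<in>A. \<Pi>\<^sub>M l\<in>{..<d}. (borel :: real measure)) (\<Pi>\<^sub>M l\<in>{..<d}. borel)"
    using assms by (intro measurable_component_singleton)
  have 2: "(\<lambda>y. y l) \<in> borel_measurable (\<Pi>\<^sub>M l\<in>{..<d}. (borel :: real measure))"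
    using assms by (intro measurable_component_singleton) auto
  from measurable_compose[OF measurable_vimage_algebra1[OF noise_path_funcset] measurable_compose[OF 1 2]]
  show ?thesis using assms by (simp add: hist_def)
qed

lemma e_measurable[measurable]: "l < d \<Longrightarrow> e t l \<in> borel_measurable M"
  using e_bdd4 by (auto simp: bdd4_def)

lemma noise_path_measurable:
  assumes "A \<subseteq> B"
  shows "(\<lambda>\<omega>. \<lambda>t\<in>A. \<lambda>l\<in>{..<d}. e t l \<omega>) \<in> measurable (hist B) (\<Pi>\<^sub>M t\<in>A. \<Pi>\<^sub>M l\<in>{..<d}. borel)"
  using assms by (intro measurable_restrict e_hist) auto

lemma hist_mono_sets: "A \<subseteq> B \<Longrightarrow> sets (hist A) \<subseteq> sets (hist B)"
  using measurable_sets[OF noise_path_measurable, of A B] by (auto simp: sets_hist[of A])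

lemma hist_mono: "f \<in> measurable (hist A) N \<Longrightarrow> A \<subseteq> B \<Longrightarrow> f \<in> measurable (hist B) N"
  using hist_mono_sets[of A B] by (auto simp: measurable_def)

lemma hist_measurable:
  assumes "f \<in> measurable (hist A) N"
  shows "f \<in> measurable M N"
proof -
  have "(\<lambda>\<omega>. \<lambda>t\<in>A. \<lambda>l\<in>{..<d}. e t l \<omega>) \<in> measurable M (\<Pi>\<^sub>M t\<in>A. \<Pi>\<^sub>M l\<in>{..<d}. borel)"
    by (intro measurable_restrict e_measurable) auto
  from measurable_sets[OF this] have "sets (hist A) \<subseteq> sets M" by (auto simp: sets_hist)
  then show ?thesis using assms by (auto simp: measurable_def)
qed

text \<open>Grouping an independent family along disjoint index sets gives independent groups, and
  each of the two functions generates a sub-sigma-algebra of its group. All later independence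
  claims reduce to disjointness of sets of times.\<close>

lemma hist_indep:
  assumes f: "f \<in> measurable (hist A) N1" and g: "g \<in> measurable (hist B) N2" and AB: "A \<inter> B = {}"
  shows "indep_var N1 f N2 g"
proof -
  have ind: "indep_set (sets (hist A)) (sets (hist B))"
  proof -
    have "indep_var (\<Pi>\<^sub>M t\<in>A. \<Pi>\<^sub>M l\<in>{..<d}. borel) (\<lambda>\<omega>. \<lambda>t\<in>A. \<lambda>l\<in>{..<d}. e t l \<omega>)
        (\<Pi>\<^sub>M t\<in>B. \<Pi>\<^sub>M l\<in>{..<d}. borel) (\<lambda>\<omega>. \<lambda>t\<in>B. \<lambda>l\<in>{..<d}. e t l \<omega>)"
      by (rule indep_var_restrict[OF e_indep AB]) auto
    then have "indep_set (sigma_sets (space M) (sets (hist A))) (sigma_sets (space M) (sets (hist B)))"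
      unfolding indep_var_eq sets_hist by blast
    moreover have "sigma_sets (space M) (sets (hist C)) = sets (hist C)" for C
      using sets.sigma_sets_eq[of "hist C"] by simp
    ultimately show ?thesis by simp
  qed
  have sub: "sigma_sets (space M) {h -` S \<inter> space M |S. S \<in> sets N} \<subseteq> sets (hist C)"
    if "h \<in> measurable (hist C) N" for h N C
  proof -
    have "{h -` S \<inter> space M |S. S \<in> sets N} \<subseteq> sets (hist C)"
      using measurable_sets[OF that] by auto
    then show ?thesis using sets.sigma_sets_subset[of _ "hist C"] by simp
  qed
  have "indep_set (sigma_sets (space M) {f -` S \<inter> space M |S. S \<in> sets N1})
      (sigma_sets (space M) {g -` S \<inter> space M |S. S \<in> sets N2})"
    using ind sub[OF f] sub[OF g] unfolding indep_sets2_eq by blast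
  then show ?thesis
    unfolding indep_var_eq using hist_measurable[OF f] hist_measurable[OF g] by blast
qed

text \<open>The value type is left general because the rule serves real moments as well as complex
  exponentials of past sums.\<close>

lemma
  fixes f g :: "'a \<Rightarrow> 'b :: {real_normed_field, banach, second_countable_topology}"
  assumes "f \<in> borel_measurable (hist A)" "g \<in> borel_measurable (hist B)" "A \<inter> B = {}"
    and "integrable M f" "integrable M g"
  shows hist_expectation_mult: "(\<integral>\<omega>. f \<omega> * g \<omega> \<partial>M) = (\<integral>\<omega>. f \<omega> \<partial>M) * (\<integral>\<omega>. g \<omega> \<partial>M)"
    and hist_integrable_mult: "integrable M (\<lambda>\<omega>. f \<omega> * g \<omega>)"
  using indep_var_lebesgue_integral[OF hist_indep[OF assms(1-3)] assms(4,5)]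
    indep_var_integrable[OF hist_indep[OF assms(1-3)] assms(4,5)] by auto

lemma e_L2: "l < d \<Longrightarrow> L2 (e t l)"
  using bdd4_L2[OF e_bdd4] .

lemma e_cross_cov:
  assumes "k < d" "l < d"
  shows "expectation (\<lambda>\<omega>. e s k \<omega> * e t l \<omega>) = (if s = t then Om k l else 0)"
proof (cases "s = t")
  case False
  then have "expectation (\<lambda>\<omega>. e s k \<omega> * e t l \<omega>) = expectation (e s k) * expectation (e t l)"
    using assms by (intro hist_expectation_mult[OF e_hist[of s "{s}"] e_hist[of t "{t}"]])
      (auto intro: L2_integrable e_L2)
  then show ?thesis using False assms e_mean by simp
qed (use assms e_cov in simp)

text \<open>The first \<open>m\<close> terms of the solution \<open>x t = \<Sum>\<^sub>j P j (e (t - j))\<close>.\<close>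

definition xm :: "nat \<Rightarrow> int \<Rightarrow> nat \<Rightarrow> 'a \<Rightarrow> real" where
  "xm m t l \<omega> = (\<Sum>j<m. \<Sum>k<d. P j l k * e (t - int j) k \<omega>)"

text \<open>The sum of P_j Om P_j' over j < m, which is the second moment matrix of
  \<open>xm m t\<close> at every time \<open>t\<close>.\<close>

definition Gm :: "nat \<Rightarrow> nat \<Rightarrow> nat \<Rightarrow> real" where
  "Gm m k l = (\<Sum>j<m. \<Sum>a<d. \<Sum>b<d. P j k a * P j l b * Om a b)"

text \<open>The diagonal of P_m Gam P_m', which is the mean square of the remainder P_m x_(t-m) left
  by the truncation.\<close>

definition rho :: "nat \<Rightarrow> nat \<Rightarrow> real" where
  "rho m l = (\<Sum>k<d. \<Sum>k'<d. P m l k * P m l k' * Gam k k')"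

text \<open>The half-open window holds exactly \<open>m\<close> times; the windows of two
  truncations at times at least \<open>m\<close> apart are disjoint.\<close>

lemma xm_hist:
  assumes "{t - int m<..t} \<subseteq> A"
  shows "xm m t l \<in> borel_measurable (hist A)"
proof -
  have "xm m t l = (\<lambda>\<omega>. \<Sum>j<m. \<Sum>k<d. P j l k * e (t - int j) k \<omega>)"
    by (simp add: xm_def fun_eq_iff)
  moreover have "e (t - int j) k \<in> borel_measurable (hist A)" if "j < m" "k < d" for j k
    using assms that by (intro e_hist) auto
  ultimately show ?thesis
    by (auto intro!: borel_measurable_sum borel_measurable_times)
qed

lemma xm_bdd4: "bdd4 (\<lambda>t. xm m t l)"
proof -
  have "(\<lambda>t. xm m t l) = (\<lambda>t \<omega>. \<Sum>j<m. \<Sum>k<d. P j l k * e (t - int j) k \<omega>)"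
    by (simp add: xm_def fun_eq_iff)
  then show ?thesis
    by (auto intro!: bdd4_sum bdd4_cmult bdd4_shift[OF e_bdd4, of _ "\<lambda>t. t - int _"])
qed

lemma xm_L2: "L2 (xm m t l)"
  using bdd4_L2[OF xm_bdd4] .

lemma xm_cov: "expectation (\<lambda>\<omega>. xm m t k \<omega> * xm m t l \<omega>) = Gm m k l"
proof -
  have base: "has_bochner_integral M (\<lambda>\<omega>. e s a \<omega> * e s' b \<omega>) (if s = s' then Om a b else 0)"
    if "a < d" "b < d" for s s' a b
    using that by (simp add: has_bochner_integral_iff e_cross_cov L2_mult_integrable e_L2)
  have i: "has_bochner_integral M (\<lambda>\<omega>. \<Sum>j<m. \<Sum>j'<m. \<Sum>a<d. \<Sum>b<d.
      P j k a * P j' l b * (e (t - int j) a \<omega> * e (t - int j') b \<omega>))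
      (\<Sum>j<m. \<Sum>j'<m. \<Sum>a<d. \<Sum>b<d. P j k a * P j' l b * (if t - int j = t - int j' then Om a b else 0))"
    by (intro has_bochner_integral_sum has_bochner_integral_mult_right base) auto
  have "expectation (\<lambda>\<omega>. xm m t k \<omega> * xm m t l \<omega>) = expectation (\<lambda>\<omega>. \<Sum>j<m. \<Sum>j'<m. \<Sum>a<d. \<Sum>b<d.
      P j k a * P j' l b * (e (t - int j) a \<omega> * e (t - int j') b \<omega>))"
    unfolding xm_def sum_product by (simp add: mult_ac)
  also have "\<dots> = (\<Sum>j<m. \<Sum>j'<m. \<Sum>a<d. \<Sum>b<d. P j k a * P j' l b * (if j = j' then Om a b else 0))"
    using has_bochner_integral_integral_eq[OF i] by simp
  also have "\<dots> = (\<Sum>j<m. \<Sum>j'<m. if j = j' then \<Sum>a<d. \<Sum>b<d. P j k a * P j' l b * Om a b else 0)"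
    by (intro sum.cong refl) auto
  also have "\<dots> = Gm m k l" unfolding Gm_def by simp
  finally show ?thesis .
qed

text \<open>The recursion is substituted into itself pointwise. This is legitimate because there are
  countably many times, so a single null set works for all of them.\<close>

lemma x_decomp:
  "AE \<omega> in M. \<forall>l<d. \<forall>t. x t l \<omega> = xm m t l \<omega> + (\<Sum>k<d. P m l k * x (t - int m) k \<omega>)"
proof -
  have "AE \<omega> in M. \<forall>t. \<forall>l\<in>{..<d}. x t l \<omega> = (\<Sum>k<d. F l k * x (t - 1) k \<omega>) + e t l \<omega>"
    unfolding AE_all_countable by (intro allI AE_finite_allI x_step) auto
  then show ?thesis
  proof eventually_elim
    case (elim \<omega>)
    have step: "x t l \<omega> = (\<Sum>k<d. F l k * x (t - 1) k \<omega>) + e t l \<omega>" if "l < d" for t l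
      using bspec[OF spec[OF elim, of t], of l] that by simp
    have "x t l \<omega> = xm m t l \<omega> + (\<Sum>k<d. P m l k * x (t - int m) k \<omega>)" if l: "l < d" for l t
    proof (induction m)
      case 0
      have "(\<Sum>k<d. P 0 l k * x t k \<omega>) = (\<Sum>k<d. if l = k then x t k \<omega> else 0)"
        using l by (intro sum.cong) (auto simp: P_0)
      then show ?case using l by (simp add: xm_def)
    next
      case (Suc m)
      have "(\<Sum>j<d. P m l j * x (t - int m) j \<omega>)
          = (\<Sum>j<d. P m l j * ((\<Sum>k<d. F j k * x (t - int m - 1) k \<omega>) + e (t - int m) j \<omega>))"
        by (rule sum.cong[OF refl], subst step) auto
      also have "\<dots>
          = (\<Sum>j<d. \<Sum>k<d. P m l j * F j k * x (t - int m - 1) k \<omega>) + (\<Sum>j<d. P m l j * e (t - int m) j \<omega>)"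
        by (simp add: distrib_left sum.distrib sum_distrib_left mult.assoc)
      also have "(\<Sum>j<d. \<Sum>k<d. P m l j * F j k * x (t - int m - 1) k \<omega>)
          = (\<Sum>k<d. P (Suc m) l k * x (t - int (Suc m)) k \<omega>)"
        by (subst sum.swap) (simp add: P_Suc l sum_distrib_right diff_diff_eq add.commute)
      finally show ?case using Suc by (simp add: xm_def)
    qed
    then show ?case by blast
  qed
qed

lemma x_measurable[measurable]: "l < d \<Longrightarrow> x t l \<in> borel_measurable M"
  using x_L2 by (simp add: L2_def)

text \<open>The error is the remainder P_m x_(t-m); as the second moments of the process are
  constant in time, its mean square does not depend on \<open>t\<close>.\<close>

lemma x_minus_xm:
  assumes l: "l < d"
  shows "L2 (\<lambda>\<omega>. x t l \<omega> - xm m t l \<omega>)"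
    and "expectation (\<lambda>\<omega>. (x t l \<omega> - xm m t l \<omega>)\<^sup>2) = rho m l"
proof -
  show "L2 (\<lambda>\<omega>. x t l \<omega> - xm m t l \<omega>)"
    using l by (intro L2_diff x_L2 xm_L2)
  have [measurable]: "xm m t l \<in> borel_measurable M" for m t l using xm_L2 by (simp add: L2_def)
  have "expectation (\<lambda>\<omega>. (x t l \<omega> - xm m t l \<omega>)\<^sup>2)
      = expectation (\<lambda>\<omega>. (\<Sum>k<d. P m l k * x (t - int m) k \<omega>)\<^sup>2)"
  proof (rule integral_cong_AE)
    show "AE \<omega> in M. (x t l \<omega> - xm m t l \<omega>)\<^sup>2 = (\<Sum>k<d. P m l k * x (t - int m) k \<omega>)\<^sup>2"
      using x_decomp[of m]
    proof eventually_elim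
      case (elim \<omega>)
      then have "x t l \<omega> = xm m t l \<omega> + (\<Sum>k<d. P m l k * x (t - int m) k \<omega>)" using l by blast
      then show ?case by (metis add_diff_cancel_left')
    qed
  qed (use l in measurable)
  also have "\<dots> = expectation (\<lambda>\<omega>. \<Sum>k<d. \<Sum>k'<d. P m l k * P m l k' * (x (t - int m) k \<omega> * x (t - int m) k' \<omega>))"
    unfolding power2_eq_square sum_product by (simp add: mult_ac)
  also have "\<dots> = rho m l"
    unfolding rho_def
    by (intro has_bochner_integral_integral_eq has_bochner_integral_sum has_bochner_integral_mult_right)
      (simp add: has_bochner_integral_iff x_cov L2_mult_integrable x_L2)
  finally show "expectation (\<lambda>\<omega>. (x t l \<omega> - xm m t l \<omega>)\<^sup>2) = rho m l" .
qed

lemma rho_nonneg: "l < d \<Longrightarrow> rho m l \<ge> 0"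
  using x_minus_xm(2)[of l 0 m, symmetric] by (simp add: integral_nonneg_AE)

lemma rho_lim:
  assumes "l < d"
  shows "(\<lambda>m. rho m l) \<longlonglongrightarrow> 0"
proof -
  have "(\<lambda>m. rho m l) \<longlonglongrightarrow> (\<Sum>k<d. \<Sum>k'<d. 0 * 0 * Gam k k')"
    unfolding rho_def by (intro tendsto_sum tendsto_mult tendsto_const P_lim assms) auto
  then show ?thesis by simp
qed

text \<open>The bound obtained from ab - a'b' = (a - a')b + a'(b - b') by Cauchy-Schwarz, with the
  mean square of the truncation estimated by 2 \<open>Gam\<close> + 2 \<open>rho\<close>.\<close>

definition tau :: "nat \<Rightarrow> nat \<Rightarrow> nat \<Rightarrow> real" where
  "tau m k l = sqrt (rho m k) * sqrt (Gam l l) + sqrt (2 * Gam k k + 2 * rho m k) * sqrt (rho m l)"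

lemma tau_lim:
  assumes "k < d" "l < d"
  shows "(\<lambda>m. tau m k l) \<longlonglongrightarrow> 0"
proof -
  have "(\<lambda>m. tau m k l) \<longlonglongrightarrow> sqrt 0 * sqrt (Gam l l) + sqrt (2 * Gam k k + 2 * 0) * sqrt 0"
    unfolding tau_def by (intro tendsto_intros rho_lim assms)
  then show ?thesis by simp
qed

lemma x_product_approx:
  assumes kl: "k < d" "l < d"
  shows "integrable M (\<lambda>\<omega>. x t k \<omega> * x t l \<omega> - xm m t k \<omega> * xm m t l \<omega>)"
    and "expectation (\<lambda>\<omega>. \<bar>x t k \<omega> * x t l \<omega> - xm m t k \<omega> * xm m t l \<omega>\<bar>) \<le> tau m k l"
proof -
  note L = x_L2[OF kl(1), of t] x_L2[OF kl(2), of t] xm_L2[of m t k] xm_L2[of m t l]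
    x_minus_xm(1)[OF kl(1), of t m] x_minus_xm(1)[OF kl(2), of t m]
  show i: "integrable M (\<lambda>\<omega>. x t k \<omega> * x t l \<omega> - xm m t k \<omega> * xm m t l \<omega>)"
    using L by (intro Bochner_Integration.integrable_diff L2_mult_integrable)
  note i1 = L2_mult_integrable[OF L(5) L(2)] and i2 = L2_mult_integrable[OF L(3) L(6)]
  have "expectation (\<lambda>\<omega>. \<bar>x t k \<omega> * x t l \<omega> - xm m t k \<omega> * xm m t l \<omega>\<bar>)
      \<le> expectation (\<lambda>\<omega>. \<bar>(x t k \<omega> - xm m t k \<omega>) * x t l \<omega>\<bar> + \<bar>xm m t k \<omega> * (x t l \<omega> - xm m t l \<omega>)\<bar>)"
  proof (rule integral_mono)
    show "integrable M (\<lambda>\<omega>. \<bar>x t k \<omega> * x t l \<omega> - xm m t k \<omega> * xm m t l \<omega>\<bar>)"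
      using i by (rule integrable_abs)
    show "integrable M (\<lambda>\<omega>. \<bar>(x t k \<omega> - xm m t k \<omega>) * x t l \<omega>\<bar> + \<bar>xm m t k \<omega> * (x t l \<omega> - xm m t l \<omega>)\<bar>)"
      by (rule Bochner_Integration.integrable_add[OF integrable_abs[OF i1] integrable_abs[OF i2]])
    have "\<bar>a * b - a' * b'\<bar> \<le> \<bar>(a - a') * b\<bar> + \<bar>a' * (b - b')\<bar>" for a b a' b' :: real
      using abs_triangle_ineq[of "(a - a') * b" "a' * (b - b')"] by (simp add: algebra_simps)
    then show "\<bar>x t k \<omega> * x t l \<omega> - xm m t k \<omega> * xm m t l \<omega>\<bar>
        \<le> \<bar>(x t k \<omega> - xm m t k \<omega>) * x t l \<omega>\<bar> + \<bar>xm m t k \<omega> * (x t l \<omega> - xm m t l \<omega>)\<bar>" for \<omega> .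
  qed
  also have "\<dots> = expectation (\<lambda>\<omega>. \<bar>(x t k \<omega> - xm m t k \<omega>) * x t l \<omega>\<bar>)
      + expectation (\<lambda>\<omega>. \<bar>xm m t k \<omega> * (x t l \<omega> - xm m t l \<omega>)\<bar>)"
    by (rule Bochner_Integration.integral_add[OF integrable_abs[OF i1] integrable_abs[OF i2]])
  also have "expectation (\<lambda>\<omega>. \<bar>(x t k \<omega> - xm m t k \<omega>) * x t l \<omega>\<bar>) \<le> sqrt (rho m k) * sqrt (Gam l l)"
    using L2_cauchy_schwarz[OF L(5) L(2)] x_cov[OF kl(2) kl(2), of t]
    unfolding x_minus_xm(2)[OF kl(1)] by (simp add: power2_eq_square)
  also have "expectation (\<lambda>\<omega>. \<bar>xm m t k \<omega> * (x t l \<omega> - xm m t l \<omega>)\<bar>)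
      \<le> sqrt (expectation (\<lambda>\<omega>. (xm m t k \<omega>)\<^sup>2)) * sqrt (rho m l)"
    using L2_cauchy_schwarz[OF L(3) L(6)] unfolding x_minus_xm(2)[OF kl(2)] .
  also have "expectation (\<lambda>\<omega>. (xm m t k \<omega>)\<^sup>2) \<le> 2 * Gam k k + 2 * rho m k"
    using L2_expectation_square_diff_le[OF L(1) L(5)] x_cov[OF kl(1) kl(1), of t]
    unfolding x_minus_xm(2)[OF kl(1)] by (simp add: power2_eq_square)
  finally show "expectation (\<lambda>\<omega>. \<bar>x t k \<omega> * x t l \<omega> - xm m t k \<omega> * xm m t l \<omega>\<bar>) \<le> tau m k l"
    unfolding tau_def by (simp add: mult_right_mono rho_nonneg kl)
qed

text \<open>Both second moments are constant in time, so mean closeness of the products at time 0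
  suffices.\<close>

lemma Gm_lim:
  assumes kl: "k < d" "l < d"
  shows "(\<lambda>m. Gm m k l) \<longlonglongrightarrow> Gam k l"
proof -
  have "\<bar>Gm m k l - Gam k l\<bar> \<le> tau m k l" for m
  proof -
    have eq: "Gam k l - Gm m k l = expectation (\<lambda>\<omega>. x 0 k \<omega> * x 0 l \<omega> - xm m 0 k \<omega> * xm m 0 l \<omega>)"
      using x_L2 xm_L2 kl
      by (simp add: Bochner_Integration.integral_diff L2_mult_integrable x_cov xm_cov)
    have "\<bar>Gam k l - Gm m k l\<bar> \<le> expectation (\<lambda>\<omega>. \<bar>x 0 k \<omega> * x 0 l \<omega> - xm m 0 k \<omega> * xm m 0 l \<omega>\<bar>)"
      unfolding eq by (rule integral_abs_bound)
    also have "\<dots> \<le> tau m k l" by (rule x_product_approx(2)[OF kl])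
    finally show ?thesis by (simp add: abs_minus_commute)
  qed
  then have "(\<lambda>m. Gm m k l - Gam k l) \<longlonglongrightarrow> 0"
    by (intro Lim_null_comparison[OF _ tau_lim[OF kl]]) auto
  then show ?thesis by (simp add: LIM_zero_iff)
qed

text \<open>Every term P_j Om P_j' of \<open>Gm\<close> is positive semidefinite and the term j = 0
  is \<open>Om\<close>; the inequality survives the limit in \<open>m\<close>. It transfers
  definiteness from the noise covariance to the process.\<close>

lemma Gam_ge_Om:
  "(\<Sum>k<d. \<Sum>l<d. Om k l * w k * w l) \<le> (\<Sum>k<d. \<Sum>l<d. Gam k l * w k * w l)"
proof (rule LIMSEQ_le_const)
  show "(\<lambda>m. \<Sum>k<d. \<Sum>l<d. Gm m k l * w k * w l) \<longlonglongrightarrow> (\<Sum>k<d. \<Sum>l<d. Gam k l * w k * w l)"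
    by (intro tendsto_sum tendsto_mult tendsto_const Gm_lim) auto
  have quad: "(\<Sum>a<d. \<Sum>b<d. Om a b * v a * v b) \<ge> 0" for v
  proof -
    have "has_bochner_integral M (\<lambda>\<omega>. \<Sum>a<d. \<Sum>b<d. (v a * v b) * (e 0 a \<omega> * e 0 b \<omega>))
        (\<Sum>a<d. \<Sum>b<d. (v a * v b) * Om a b)"
      by (intro has_bochner_integral_sum has_bochner_integral_mult_right)
        (simp add: has_bochner_integral_iff e_cov L2_mult_integrable e_L2)
    then have "(\<Sum>a<d. \<Sum>b<d. (v a * v b) * Om a b)
        = expectation (\<lambda>\<omega>. \<Sum>a<d. \<Sum>b<d. (v a * v b) * (e 0 a \<omega> * e 0 b \<omega>))"
      by (simp add: has_bochner_integral_iff)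
    also have "\<dots> = expectation (\<lambda>\<omega>. (\<Sum>a<d. v a * e 0 a \<omega>)\<^sup>2)"
      unfolding power2_eq_square sum_product by (simp add: mult_ac)
    finally have "(\<Sum>a<d. \<Sum>b<d. Om a b * v a * v b) = expectation (\<lambda>\<omega>. (\<Sum>a<d. v a * e 0 a \<omega>)\<^sup>2)"
      by (simp add: mult_ac)
    then show ?thesis by (simp add: integral_nonneg_AE)
  qed
  have "(\<Sum>k<d. \<Sum>l<d. Om k l * w k * w l) \<le> (\<Sum>k<d. \<Sum>l<d. Gm m k l * w k * w l)" if "m \<ge> 1" for m
  proof -
    \<comment> \<open>With v_j = P_j' w, the j-th term of \<open>Gm\<close> becomes the form of
      \<open>Om\<close> at v_j.\<close>
    define v where "v = (\<lambda>j a. \<Sum>k<d. P j k a * w k)"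
    have "(\<Sum>k<d. \<Sum>l<d. Gm m k l * w k * w l) = (\<Sum>j<m. \<Sum>a<d. \<Sum>b<d. Om a b * v j a * v j b)"
    proof -
      have "(\<Sum>k<d. \<Sum>l<d. Gm m k l * w k * w l)
          = (\<Sum>k<d. \<Sum>l<d. \<Sum>j<m. \<Sum>a<d. \<Sum>b<d. Om a b * (P j k a * w k) * (P j l b * w l))"
        unfolding Gm_def sum_distrib_right by (simp add: mult_ac)
      also have "\<dots> = (\<Sum>k<d. \<Sum>j<m. \<Sum>l<d. \<Sum>a<d. \<Sum>b<d. Om a b * (P j k a * w k) * (P j l b * w l))"
        by (rule sum.cong[OF refl], rule sum.swap)
      also have "\<dots> = (\<Sum>j<m. \<Sum>k<d. \<Sum>l<d. \<Sum>a<d. \<Sum>b<d. Om a b * (P j k a * w k) * (P j l b * w l))"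
        by (rule sum.swap)
      also have "\<dots> = (\<Sum>j<m. \<Sum>a<d. \<Sum>b<d. \<Sum>k<d. \<Sum>l<d. Om a b * (P j k a * w k) * (P j l b * w l))"
        by (rule sum.cong[OF refl], rule sum_swap_pairs)
      also have "\<dots> = (\<Sum>j<m. \<Sum>a<d. \<Sum>b<d. Om a b * v j a * v j b)"
        unfolding v_def by (simp add: sum_distrib_left sum_distrib_right mult_ac)
      finally show ?thesis .
    qed
    also have "\<dots> \<ge> (\<Sum>j\<in>{0}. \<Sum>a<d. \<Sum>b<d. Om a b * v j a * v j b)"
      using that by (intro sum_mono2 quad) auto
    also have "(\<Sum>j\<in>{0}. \<Sum>a<d. \<Sum>b<d. Om a b * v j a * v j b) = (\<Sum>k<d. \<Sum>l<d. Om k l * w k * w l)"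
    proof -
      have "v 0 a = w a" if "a < d" for a
      proof -
        have "v 0 a = (\<Sum>k<d. if k = a then w k else 0)"
          unfolding v_def using that by (intro sum.cong) (auto simp: P_0)
        then show ?thesis using that by simp
      qed
      then show ?thesis by simp
    qed
    finally show ?thesis .
  qed
  then show "\<exists>N. \<forall>m\<ge>N. (\<Sum>k<d. \<Sum>l<d. Om k l * w k * w l) \<le> (\<Sum>k<d. \<Sum>l<d. Gm m k l * w k * w l)"
    by blast
qed

end

section \<open>Limit theorems for stable autoregressions\<close>

text \<open>An interchange of limits: the error of the m-th approximant is uniform in
  \<open>n\<close>. The index 0 is exempt because the sums are later normalised by sqrt n.\<close>

lemma LIMSEQ_approximants:
  fixes a :: "nat \<Rightarrow> nat \<Rightarrow> 'b :: real_normed_vector"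
  assumes a: "\<And>m. a m \<longlonglongrightarrow> b m" and b: "b \<longlonglongrightarrow> B"
    and c: "\<And>m n. n > 0 \<Longrightarrow> norm (c n - a m n) \<le> \<eta> m" and \<eta>: "\<eta> \<longlonglongrightarrow> 0"
  shows "c \<longlonglongrightarrow> B"
proof (rule tendstoI)
  fix r :: real assume r: "r > 0"
  have "\<forall>\<^sub>F m in sequentially. dist (b m) B < r / 3 \<and> \<eta> m < r / 3"
    using r by (intro eventually_conj tendstoD[OF b] order_tendstoD(2)[OF \<eta>]) auto
  then obtain m where m: "dist (b m) B < r / 3" "\<eta> m < r / 3"
    using eventually_happens'[OF sequentially_bot] by blast
  have "\<forall>\<^sub>F n in sequentially. dist (a m n) (b m) < r / 3"
    using r by (intro tendstoD[OF a]) auto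
  then show "\<forall>\<^sub>F n in sequentially. dist (c n) B < r"
    using eventually_gt_at_top[of "0::nat"]
  proof eventually_elim
    case (elim n)
    have "dist (c n) (a m n) < r / 3" using c[OF elim(2), of m] m by (simp add: dist_norm)
    then show ?case
      using elim(1) m(1) dist_triangle[of "c n" B "a m n"] dist_triangle[of "a m n" B "b m"] by linarith
  qed
qed

context prob_space
begin

lemma orthogonal_sum_square:
  fixes \<xi> :: "nat \<Rightarrow> 'a \<Rightarrow> real"
  assumes L2: "\<And>k. L2 (\<xi> k)" and orth: "\<And>j k. j < k \<Longrightarrow> expectation (\<lambda>\<omega>. \<xi> j \<omega> * \<xi> k \<omega>) = 0"
  shows "expectation (\<lambda>\<omega>. (\<Sum>k<n. \<xi> k \<omega>)\<^sup>2) = (\<Sum>k<n. expectation (\<lambda>\<omega>. (\<xi> k \<omega>)\<^sup>2))"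
proof (induction n)
  case (Suc n)
  let ?S = "\<lambda>\<omega>. \<Sum>k<n. \<xi> k \<omega>"
  have S: "L2 ?S" using L2 by (intro L2_sum)
  have cross: "expectation (\<lambda>\<omega>. ?S \<omega> * \<xi> n \<omega>) = 0"
  proof -
    have "expectation (\<lambda>\<omega>. ?S \<omega> * \<xi> n \<omega>) = (\<Sum>k<n. expectation (\<lambda>\<omega>. \<xi> k \<omega> * \<xi> n \<omega>))"
      unfolding sum_distrib_right
      by (intro Bochner_Integration.integral_sum L2_mult_integrable L2)
    then show ?thesis using orth by simp
  qed
  have "(\<lambda>\<omega>. (\<Sum>k<Suc n. \<xi> k \<omega>)\<^sup>2) = (\<lambda>\<omega>. ((?S \<omega>)\<^sup>2 + 2 * (?S \<omega> * \<xi> n \<omega>)) + (\<xi> n \<omega>)\<^sup>2)"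
    by (simp add: power2_sum algebra_simps)
  moreover have "integrable M (\<lambda>\<omega>. (?S \<omega>)\<^sup>2)" "integrable M (\<lambda>\<omega>. (\<xi> n \<omega>)\<^sup>2)"
    using S L2[of n] by (auto simp: L2_def)
  moreover have "integrable M (\<lambda>\<omega>. ?S \<omega> * \<xi> n \<omega>)"
    using S L2 by (rule L2_mult_integrable)
  ultimately show ?case using Suc cross by simp
qed (simp add: prob_space)

text \<open>Only pairs of indices at distance at most \<open>m\<close> contribute to the expanded
  square, at most 2m + 1 for each index, and each contributes at most \<open>C\<close> by
  Cauchy-Schwarz. The growth is linear in \<open>n\<close>.\<close>

lemma m_dependent_sum_square_le:
  fixes \<zeta> :: "nat \<Rightarrow> 'a \<Rightarrow> real" and m n :: nat and C :: real
  assumes L2: "\<And>k. L2 (\<zeta> k)" and bound: "\<And>k. expectation (\<lambda>\<omega>. (\<zeta> k \<omega>)\<^sup>2) \<le> C"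
    and dep: "\<And>j k. j + m \<le> k \<Longrightarrow> expectation (\<lambda>\<omega>. \<zeta> j \<omega> * \<zeta> k \<omega>) = 0"
  shows "expectation (\<lambda>\<omega>. (\<Sum>k<n. \<zeta> k \<omega>)\<^sup>2) \<le> n * (2 * m + 1) * C"
proof -
  have C: "C \<ge> 0" using bound[of 0] by (rule order_trans[rotated]) (auto intro: integral_nonneg_AE)
  have cov: "expectation (\<lambda>\<omega>. \<zeta> j \<omega> * \<zeta> k \<omega>) \<le> (if k \<in> {j - m..j + m} then C else 0)" for j k
  proof (cases "k \<in> {j - m..j + m}")
    case True
    have "expectation (\<lambda>\<omega>. \<zeta> j \<omega> * \<zeta> k \<omega>) \<le> expectation (\<lambda>\<omega>. \<bar>\<zeta> j \<omega> * \<zeta> k \<omega>\<bar>)"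
      using L2_mult_integrable[OF L2 L2, of j k] by (intro integral_mono) auto
    also have "\<dots> \<le> sqrt (expectation (\<lambda>\<omega>. (\<zeta> j \<omega>)\<^sup>2)) * sqrt (expectation (\<lambda>\<omega>. (\<zeta> k \<omega>)\<^sup>2))"
      by (rule L2_cauchy_schwarz[OF L2 L2])
    also have "\<dots> \<le> sqrt C * sqrt C"
      using bound C by (intro mult_mono) (auto intro: integral_nonneg_AE)
    finally show ?thesis using True C by simp
  next
    case False
    then have "j + m \<le> k \<or> k + m \<le> j" by auto
    then have "expectation (\<lambda>\<omega>. \<zeta> j \<omega> * \<zeta> k \<omega>) = 0"
      using dep[of j k] dep[of k j] by (auto simp: mult.commute)
    then show ?thesis unfolding if_not_P[OF False] by simp
  qed
  have "expectation (\<lambda>\<omega>. (\<Sum>k<n. \<zeta> k \<omega>)\<^sup>2) = expectation (\<lambda>\<omega>. \<Sum>j<n. \<Sum>k<n. \<zeta> j \<omega> * \<zeta> k \<omega>)"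
    by (simp add: power2_eq_square sum_product)
  also have "\<dots> = (\<Sum>j<n. \<Sum>k<n. expectation (\<lambda>\<omega>. \<zeta> j \<omega> * \<zeta> k \<omega>))"
    by (intro has_bochner_integral_integral_eq has_bochner_integral_sum)
      (simp add: has_bochner_integral_iff L2_mult_integrable L2)
  also have "\<dots> \<le> (\<Sum>j<n. \<Sum>k<n. if k \<in> {j - m..j + m} then C else 0)"
    by (intro sum_mono cov)
  also have "\<dots> \<le> (\<Sum>j<n. (2 * m + 1) * C)"
  proof (rule sum_mono)
    fix j
    have "(\<Sum>k<n. if k \<in> {j - m..j + m} then C else 0) = card ({..<n} \<inter> {j - m..j + m}) * C"
      by (subst sum.inter_restrict[symmetric]) auto
    also have "\<dots> \<le> (2 * m + 1) * C"
    proof -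
      have "card ({..<n} \<inter> {j - m..j + m}) \<le> card {j - m..j + m}" by (intro card_mono) auto
      also have "\<dots> \<le> 2 * m + 1" by simp
      finally show ?thesis using C by (intro mult_right_mono) linarith+
    qed
    finally show "(\<Sum>k<n. if k \<in> {j - m..j + m} then C else 0) \<le> (2 * m + 1) * C" .
  qed
  finally show ?thesis by (simp add: algebra_simps)
qed

end

context stable_var
begin

section \<open>Score sums as sums of martingale differences\<close>

definition adapted :: "(int \<Rightarrow> nat \<Rightarrow> 'a \<Rightarrow> real) \<Rightarrow> bool" where
  "adapted g \<longleftrightarrow> (\<forall>l<d. bdd4 (\<lambda>t. g t l) \<and> (\<forall>t. g t l \<in> borel_measurable (hist {..t})))"

text \<open>A linear combination of products of a regressor at time \<open>t\<close> with the noise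
  at time \<open>t + 1\<close>. Keeping \<open>K\<close> arbitrary covers all linear combinations of
  scores, and keeping \<open>g\<close> arbitrary covers the process, its truncations and their
  differences.\<close>

definition xi :: "(nat \<Rightarrow> nat \<Rightarrow> real) \<Rightarrow> (int \<Rightarrow> nat \<Rightarrow> 'a \<Rightarrow> real) \<Rightarrow> int \<Rightarrow> 'a \<Rightarrow> real" where
  "xi K g t \<omega> = (\<Sum>i<d. \<Sum>l<d. K i l * (g t l \<omega> * e (t + 1) i \<omega>))"

text \<open>The trace inner product of \<open>Om\<close> with K G K', i.e. the second moment of
  \<open>xi K g t\<close> for an adapted \<open>g\<close> whose second moments at time
  \<open>t\<close> are \<open>G\<close>.\<close>

definition qf :: "(nat \<Rightarrow> nat \<Rightarrow> real) \<Rightarrow> (nat \<Rightarrow> nat \<Rightarrow> real) \<Rightarrow> real" where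
  "qf K G = (\<Sum>i<d. \<Sum>i'<d. \<Sum>l<d. \<Sum>l'<d. K i l * K i' l' * (G l l' * Om i i'))"

definition kappa :: "(nat \<Rightarrow> nat \<Rightarrow> real) \<Rightarrow> real" where
  "kappa K = (\<Sum>i<d. \<Sum>i'<d. \<Sum>l<d. \<Sum>l'<d. \<bar>K i l\<bar> * \<bar>K i' l'\<bar> * \<bar>Om i i'\<bar>)"

definition Ssum :: "(nat \<Rightarrow> nat \<Rightarrow> real) \<Rightarrow> (int \<Rightarrow> nat \<Rightarrow> 'a \<Rightarrow> real) \<Rightarrow> nat \<Rightarrow> 'a \<Rightarrow> real" where
  "Ssum K g n \<omega> = (\<Sum>k<n. xi K g (int k) \<omega>)"

definition rho_sum :: "nat \<Rightarrow> real" where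
  "rho_sum m = (\<Sum>l<d. rho m l)"

lemma kappa_nonneg: "kappa K \<ge> 0"
  unfolding kappa_def by (intro sum_nonneg) auto

lemma qf_le_kappa:
  assumes "\<And>l l'. l < d \<Longrightarrow> l' < d \<Longrightarrow> \<bar>G l l'\<bar> \<le> R"
  shows "qf K G \<le> kappa K * R"
proof -
  have "qf K G \<le> (\<Sum>i<d. \<Sum>i'<d. \<Sum>l<d. \<Sum>l'<d. \<bar>K i l\<bar> * \<bar>K i' l'\<bar> * \<bar>Om i i'\<bar> * R)"
    unfolding qf_def
  proof (intro sum_mono)
    fix i i' l l' assume "l \<in> {..<d}" "l' \<in> {..<d}"
    have "K i l * K i' l' * (G l l' * Om i i') \<le> \<bar>K i l * K i' l' * (G l l' * Om i i')\<bar>"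
      by (rule abs_ge_self)
    also have "\<dots> = \<bar>K i l\<bar> * \<bar>K i' l'\<bar> * \<bar>Om i i'\<bar> * \<bar>G l l'\<bar>" by (simp add: abs_mult)
    also have "\<dots> \<le> \<bar>K i l\<bar> * \<bar>K i' l'\<bar> * \<bar>Om i i'\<bar> * R"
      using \<open>l \<in> {..<d}\<close> \<open>l' \<in> {..<d}\<close> assms by (intro mult_left_mono) auto
    finally show "K i l * K i' l' * (G l l' * Om i i') \<le> \<bar>K i l\<bar> * \<bar>K i' l'\<bar> * \<bar>Om i i'\<bar> * R" .
  qed
  then show ?thesis unfolding kappa_def by (simp add: sum_distrib_right)
qed

lemma qf_tendsto:
  assumes "\<And>l l'. l < d \<Longrightarrow> l' < d \<Longrightarrow> (\<lambda>m. G m l l') \<longlonglongrightarrow> G' l l'"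
  shows "(\<lambda>m. qf K (G m)) \<longlonglongrightarrow> qf K G'"
  unfolding qf_def by (intro tendsto_sum tendsto_mult tendsto_const assms) auto

lemma rho_sum_lim: "rho_sum \<longlonglongrightarrow> 0"
proof -
  have "(\<lambda>m. \<Sum>l<d. rho m l) \<longlonglongrightarrow> (\<Sum>l<d. 0)"
    by (intro tendsto_sum rho_lim) auto
  then show ?thesis by (simp add: rho_sum_def[abs_def])
qed

lemma rho_le_rho_sum: "l < d \<Longrightarrow> rho m l \<le> rho_sum m"
  unfolding rho_sum_def by (intro member_le_sum) (auto intro: rho_nonneg)

lemma xi_L2: "adapted g \<Longrightarrow> L2 (xi K g t)"
proof -
  assume "adapted g"
  then have "L2 (\<lambda>\<omega>. g t l \<omega> * e (t + 1) i \<omega>)" if "i < d" "l < d" for i l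
    using that bdd4_mult(1)[of "\<lambda>t. g t l" "\<lambda>t. e t i" t "t + 1"] e_bdd4 by (auto simp: adapted_def)
  then have "L2 (\<lambda>\<omega>. \<Sum>i<d. \<Sum>l<d. K i l * (g t l \<omega> * e (t + 1) i \<omega>))"
    by (intro L2_sum L2_cmult) auto
  then show ?thesis by (simp add: xi_def[abs_def])
qed

lemma xi_hist:
  assumes "\<And>l. l < d \<Longrightarrow> g t l \<in> borel_measurable (hist A)" "t + 1 \<in> A"
  shows "xi K g t \<in> borel_measurable (hist A)"
proof -
  have "(\<lambda>\<omega>. \<Sum>i<d. \<Sum>l<d. K i l * (g t l \<omega> * e (t + 1) i \<omega>)) \<in> borel_measurable (hist A)"
    using assms by (intro borel_measurable_sum borel_measurable_times borel_measurable_const e_hist) auto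
  then show ?thesis by (simp add: xi_def[abs_def])
qed

lemma adapted_hist: "adapted g \<Longrightarrow> l < d \<Longrightarrow> t \<le> s \<Longrightarrow> g t l \<in> borel_measurable (hist {..s})"
  unfolding adapted_def by (intro hist_mono[of _ "{..t}" _ "{..s}"]) auto

text \<open>Both \<open>h\<close> and the regressor depend on the noise up to time \<open>t\<close>,
  whereas the noise at \<open>t + 1\<close> is independent of them and centred. Complex
  \<open>h\<close> gives the martingale hypothesis for characteristic functions, real
  \<open>h\<close> gives orthogonality of increments.\<close>

lemma xi_mart:
  fixes h :: "'a \<Rightarrow> 'b :: {real_normed_field, banach, second_countable_topology}"
  assumes g: "adapted g" and h: "h \<in> borel_measurable (hist {..t})"
    and int: "\<And>l. l < d \<Longrightarrow> integrable M (\<lambda>\<omega>. h \<omega> * of_real (g t l \<omega>))"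
  shows "(\<integral>\<omega>. h \<omega> * of_real (xi K g t \<omega>) \<partial>M) = 0"
proof -
  have "has_bochner_integral M (\<lambda>\<omega>. (h \<omega> * of_real (g t l \<omega>)) * of_real (e (t + 1) i \<omega>)) 0" if "i < d" "l < d" for i l
  proof -
    have m1: "(\<lambda>\<omega>. h \<omega> * of_real (g t l \<omega>)) \<in> borel_measurable (hist {..t})"
      using h adapted_hist[OF g \<open>l < d\<close>, of t t] by auto
    have m2: "(\<lambda>\<omega>. of_real (e (t + 1) i \<omega>) :: 'b) \<in> borel_measurable (hist {t + 1})"
      using e_hist[of "t + 1" "{t + 1}" i] that by auto
    have i2: "integrable M (\<lambda>\<omega>. of_real (e (t + 1) i \<omega>) :: 'b)"
      using L2_integrable[OF e_L2[OF that(1)]] by (rule integrable_of_real)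
    have "(\<integral>\<omega>. (of_real (e (t + 1) i \<omega>) :: 'b) \<partial>M) = 0"
      using integral_bounded_linear[OF bounded_linear_of_real L2_integrable[OF e_L2[OF that(1)]], of "t + 1"]
        e_mean[OF that(1), of "t + 1"] by simp
    then show ?thesis
      using hist_expectation_mult[OF m1 m2 _ int[OF that(2)] i2] hist_integrable_mult[OF m1 m2 _ int[OF that(2)] i2]
      by (simp add: has_bochner_integral_iff)
  qed
  then have "has_bochner_integral M (\<lambda>\<omega>. \<Sum>i<d. \<Sum>l<d. of_real (K i l) * ((h \<omega> * of_real (g t l \<omega>)) * of_real (e (t + 1) i \<omega>)))
      (\<Sum>i<d. \<Sum>l<d. of_real (K i l) * 0)"
    by (intro has_bochner_integral_sum has_bochner_integral_mult_right) auto
  then show ?thesis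
    unfolding xi_def by (simp add: has_bochner_integral_iff sum_distrib_left mult_ac)
qed

lemma xi_square:
  assumes g: "adapted g"
  shows "expectation (\<lambda>\<omega>. (xi K g t \<omega>)\<^sup>2) = qf K (\<lambda>l l'. expectation (\<lambda>\<omega>. g t l \<omega> * g t l' \<omega>))"
proof -
  have "has_bochner_integral M (\<lambda>\<omega>. (g t l \<omega> * g t l' \<omega>) * (e (t + 1) i \<omega> * e (t + 1) i' \<omega>))
      (expectation (\<lambda>\<omega>. g t l \<omega> * g t l' \<omega>) * Om i i')" if "i < d" "i' < d" "l < d" "l' < d" for i i' l l'
  proof -
    have m1: "(\<lambda>\<omega>. g t l \<omega> * g t l' \<omega>) \<in> borel_measurable (hist {..t})"
      using that adapted_hist[OF g, of _ t t] by (intro borel_measurable_times) auto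
    have m2: "(\<lambda>\<omega>. e (t + 1) i \<omega> * e (t + 1) i' \<omega>) \<in> borel_measurable (hist {t + 1})"
      using that by (intro borel_measurable_times e_hist) auto
    have i1: "integrable M (\<lambda>\<omega>. g t l \<omega> * g t l' \<omega>)"
      using g that by (intro L2_mult_integrable bdd4_L2[of "\<lambda>t. g t l"] bdd4_L2[of "\<lambda>t. g t l'"]) (auto simp: adapted_def)
    have i2: "integrable M (\<lambda>\<omega>. e (t + 1) i \<omega> * e (t + 1) i' \<omega>)"
      using that by (intro L2_mult_integrable e_L2)
    show ?thesis
      using hist_expectation_mult[OF m1 m2 _ i1 i2] hist_integrable_mult[OF m1 m2 _ i1 i2] that
      by (simp add: has_bochner_integral_iff e_cov)
  qed
  then have hb: "has_bochner_integral M (\<lambda>\<omega>. \<Sum>i<d. \<Sum>i'<d. \<Sum>l<d. \<Sum>l'<d. K i l * K i' l' *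
      ((g t l \<omega> * g t l' \<omega>) * (e (t + 1) i \<omega> * e (t + 1) i' \<omega>)))
      (\<Sum>i<d. \<Sum>i'<d. \<Sum>l<d. \<Sum>l'<d. K i l * K i' l' * (expectation (\<lambda>\<omega>. g t l \<omega> * g t l' \<omega>) * Om i i'))"
    by (intro has_bochner_integral_sum has_bochner_integral_mult_right) auto
  have "(xi K g t \<omega>)\<^sup>2 = (\<Sum>i<d. \<Sum>i'<d. \<Sum>l<d. \<Sum>l'<d. K i l * K i' l' *
      ((g t l \<omega> * g t l' \<omega>) * (e (t + 1) i \<omega> * e (t + 1) i' \<omega>)))" for \<omega>
    unfolding xi_def power2_eq_square sum_product by (simp add: mult_ac)
  then show ?thesis using hb by (simp add: has_bochner_integral_iff qf_def)
qed

lemma xi_orthogonal: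
  assumes g: "adapted g" and st: "s < t"
  shows "expectation (\<lambda>\<omega>. xi K g s \<omega> * xi K g t \<omega>) = 0"
proof -
  have h: "xi K g s \<in> borel_measurable (hist {..t})"
    using st by (intro xi_hist adapted_hist[OF g]) auto
  have "expectation (\<lambda>\<omega>. xi K g s \<omega> * of_real (xi K g t \<omega>)) = 0"
  proof (rule xi_mart[OF g h])
    show "integrable M (\<lambda>\<omega>. xi K g s \<omega> * of_real (g t l \<omega>))" if "l < d" for l
      using g that unfolding of_real_eq_id id_def
      by (intro L2_mult_integrable xi_L2 bdd4_L2[of "\<lambda>t. g t l"]) (auto simp: adapted_def)
  qed
  then show ?thesis by simp
qed

lemma Ssum_square:
  assumes g: "adapted g"
  shows "expectation (\<lambda>\<omega>. (Ssum K g n \<omega>)\<^sup>2)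
    = (\<Sum>k<n. qf K (\<lambda>l l'. expectation (\<lambda>\<omega>. g (int k) l \<omega> * g (int k) l' \<omega>)))"
  unfolding Ssum_def using orthogonal_sum_square[of "\<lambda>k. xi K g (int k)" n, OF xi_L2[OF g] xi_orthogonal[OF g]]
  by (simp add: xi_square[OF g])

lemma Ssum_L2: "adapted g \<Longrightarrow> L2 (Ssum K g n)"
  using L2_sum[of "{..<n}" "\<lambda>k. xi K g (int k)"] xi_L2 by (simp add: Ssum_def[abs_def])

lemma xi_diff: "xi K g t \<omega> - xi K g' t \<omega> = xi K (\<lambda>t l \<omega>. g t l \<omega> - g' t l \<omega>) t \<omega>"
  unfolding xi_def by (simp add: sum_subtractf algebra_simps)

text \<open>Linearity in the regressor: a truncation error is itself a score sum, so it inherits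
  orthogonality whenever the difference of the regressors is adapted.\<close>

lemma Ssum_diff: "Ssum K g n \<omega> - Ssum K g' n \<omega> = Ssum K (\<lambda>t l \<omega>. g t l \<omega> - g' t l \<omega>) n \<omega>"
  unfolding Ssum_def xi_diff[symmetric] by (simp add: sum_subtractf)

lemma xm_adapted: "adapted (xm m)"
  unfolding adapted_def by (auto intro: xm_bdd4 xm_hist)

lemma xm_diff_adapted: "adapted (\<lambda>t l \<omega>. xm m t l \<omega> - xm m' t l \<omega>)"
  unfolding adapted_def by (auto intro!: bdd4_diff xm_bdd4 borel_measurable_diff xm_hist)

text \<open>The difference of two truncations is adapted, so its squared score sum has expectation
  of order \<open>n\<close> rather than n^2, which is what division by sqrt n can absorb.\<close>

lemma Ssum_xm_diff:
  "expectation (\<lambda>\<omega>. \<bar>Ssum K (xm m') n \<omega> - Ssum K (xm m) n \<omega>\<bar>)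
    \<le> sqrt (n * (kappa K * (2 * (rho_sum m' + rho_sum m))))"
proof -
  let ?g = "\<lambda>t l \<omega>. xm m' t l \<omega> - xm m t l \<omega>"
  let ?R = "2 * (rho_sum m' + rho_sum m)"
  have L: "L2 (?g t l)" if "l < d" for t l by (intro L2_diff xm_L2)
  have sq: "expectation (\<lambda>\<omega>. (?g t l \<omega>)\<^sup>2) \<le> ?R" if l: "l < d" for t l
  proof -
    \<comment> \<open>The two truncations are compared through \<open>x\<close>, because the errors
      relative to \<open>x\<close> are known exactly.\<close>
    have "expectation (\<lambda>\<omega>. (?g t l \<omega>)\<^sup>2)
        = expectation (\<lambda>\<omega>. ((x t l \<omega> - xm m t l \<omega>) - (x t l \<omega> - xm m' t l \<omega>))\<^sup>2)" by simp
    also have "\<dots> \<le> 2 * rho m l + 2 * rho m' l"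
      using L2_expectation_square_diff_le[OF x_minus_xm(1)[OF l] x_minus_xm(1)[OF l]]
      by (simp only: x_minus_xm(2)[OF l])
    also have "\<dots> \<le> ?R"
      using add_mono[OF rho_le_rho_sum[OF l, of m'] rho_le_rho_sum[OF l, of m]] by simp
    finally show ?thesis .
  qed
  have G: "\<bar>expectation (\<lambda>\<omega>. ?g t l \<omega> * ?g t l' \<omega>)\<bar> \<le> ?R" if l: "l < d" "l' < d" for t l l'
  proof -
    have R: "?R \<ge> 0" using rho_nonneg unfolding rho_sum_def by (auto intro!: add_nonneg_nonneg sum_nonneg)
    have "\<bar>expectation (\<lambda>\<omega>. ?g t l \<omega> * ?g t l' \<omega>)\<bar> \<le> expectation (\<lambda>\<omega>. \<bar>?g t l \<omega> * ?g t l' \<omega>\<bar>)"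
      by (rule integral_abs_bound)
    also have "\<dots> \<le> sqrt (expectation (\<lambda>\<omega>. (?g t l \<omega>)\<^sup>2)) * sqrt (expectation (\<lambda>\<omega>. (?g t l' \<omega>)\<^sup>2))"
      by (rule L2_cauchy_schwarz[OF L[OF l(1)] L[OF l(2)]])
    also have "\<dots> \<le> sqrt ?R * sqrt ?R"
      using sq[OF l(1)] sq[OF l(2)] R by (intro mult_mono real_sqrt_le_mono) (auto intro: integral_nonneg_AE)
    finally show ?thesis using R by simp
  qed
  have "expectation (\<lambda>\<omega>. \<bar>Ssum K (xm m') n \<omega> - Ssum K (xm m) n \<omega>\<bar>) = expectation (\<lambda>\<omega>. \<bar>Ssum K ?g n \<omega>\<bar>)"
    unfolding Ssum_diff ..
  also have "\<dots> \<le> sqrt (expectation (\<lambda>\<omega>. (Ssum K ?g n \<omega>)\<^sup>2))"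
    by (rule L2_expectation_abs_le[OF Ssum_L2[OF xm_diff_adapted]])
  also have "expectation (\<lambda>\<omega>. (Ssum K ?g n \<omega>)\<^sup>2) \<le> (\<Sum>k<n. kappa K * ?R)"
    unfolding Ssum_square[OF xm_diff_adapted] by (intro sum_mono qf_le_kappa G)
  finally show ?thesis by simp
qed

lemma Ssum_x_integrable: "integrable M (Ssum K x n)"
  unfolding Ssum_def[abs_def] xi_def
  by (intro Bochner_Integration.integrable_sum integrable_mult_right L2_mult_integrable x_L2 e_L2) auto

text \<open>Plain triangle inequality and Cauchy-Schwarz, with no appeal to orthogonality. Growth of
  order \<open>n\<close> is too fast for the limit theorem, but for fixed \<open>n\<close> the bound
  vanishes as \<open>m\<close> grows.\<close>

lemma Ssum_x_crude:
  "expectation (\<lambda>\<omega>. \<bar>Ssum K x n \<omega> - Ssum K (xm m) n \<omega>\<bar>)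
    \<le> n * (\<Sum>i<d. \<Sum>l<d. \<bar>K i l\<bar> * (sqrt (rho m l) * sqrt (Om i i)))"
proof -
  let ?g = "\<lambda>t l \<omega>. x t l \<omega> - xm m t l \<omega>"
  have i: "integrable M (\<lambda>\<omega>. \<bar>?g t l \<omega> * e s i \<omega>\<bar>)" if "l < d" "i < d" for t l i s
    using L2_mult_integrable[OF x_minus_xm(1) e_L2] that by (intro integrable_abs)
  have "expectation (\<lambda>\<omega>. \<bar>Ssum K x n \<omega> - Ssum K (xm m) n \<omega>\<bar>) = expectation (\<lambda>\<omega>. \<bar>Ssum K ?g n \<omega>\<bar>)"
    unfolding Ssum_diff ..
  also have "\<dots> \<le> expectation (\<lambda>\<omega>. \<Sum>k<n. \<Sum>i<d. \<Sum>l<d. \<bar>K i l\<bar> * \<bar>?g (int k) l \<omega> * e (int k + 1) i \<omega>\<bar>)"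
  proof (rule integral_mono)
    show "integrable M (\<lambda>\<omega>. \<bar>Ssum K ?g n \<omega>\<bar>)"
      unfolding Ssum_diff[symmetric]
      by (intro integrable_abs Bochner_Integration.integrable_diff Ssum_x_integrable L2_integrable[OF Ssum_L2[OF xm_adapted]])
    show "integrable M (\<lambda>\<omega>. \<Sum>k<n. \<Sum>i<d. \<Sum>l<d. \<bar>K i l\<bar> * \<bar>?g (int k) l \<omega> * e (int k + 1) i \<omega>\<bar>)"
      by (intro Bochner_Integration.integrable_sum integrable_mult_right i) auto
    show "\<bar>Ssum K ?g n \<omega>\<bar> \<le> (\<Sum>k<n. \<Sum>i<d. \<Sum>l<d. \<bar>K i l\<bar> * \<bar>?g (int k) l \<omega> * e (int k + 1) i \<omega>\<bar>)" for \<omega>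
      unfolding Ssum_def xi_def
      by (intro order_trans[OF sum_abs] sum_mono) (simp add: abs_mult)
  qed
  also have "\<dots> = (\<Sum>k<n. \<Sum>i<d. \<Sum>l<d. \<bar>K i l\<bar> * expectation (\<lambda>\<omega>. \<bar>?g (int k) l \<omega> * e (int k + 1) i \<omega>\<bar>))"
    using i by (intro has_bochner_integral_integral_eq has_bochner_integral_sum has_bochner_integral_mult_right)
      (simp add: has_bochner_integral_iff)
  also have "\<dots> \<le> (\<Sum>k<n. \<Sum>i<d. \<Sum>l<d. \<bar>K i l\<bar> * (sqrt (rho m l) * sqrt (Om i i)))"
  proof (intro sum_mono mult_left_mono)
    fix k i l assume "i \<in> {..<d}" "l \<in> {..<d}"
    then show "expectation (\<lambda>\<omega>. \<bar>?g (int k) l \<omega> * e (int k + 1) i \<omega>\<bar>) \<le> sqrt (rho m l) * sqrt (Om i i)"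
      using L2_cauchy_schwarz[OF x_minus_xm(1) e_L2, of l i "int k" m "int k + 1"] x_minus_xm(2)[of l "int k" m]
        e_cov[of i i "int k + 1"]
      by (simp add: power2_eq_square)
  qed auto
  finally show ?thesis by simp
qed

text \<open>
  The process \<open>x\<close> itself is not assumed to be adapted to the noise. Orthogonality is used only for
  the approximants \<open>xm m'\<close>, and then \<open>m'\<close> tends to infinity for fixed \<open>n\<close>.
\<close>

lemma Ssum_x_approx:
  "expectation (\<lambda>\<omega>. \<bar>Ssum K x n \<omega> - Ssum K (xm m) n \<omega>\<bar>) \<le> sqrt (n * (kappa K * (2 * rho_sum m)))"
proof (rule LIMSEQ_le_const)
  let ?B = "\<lambda>m. n * (\<Sum>i<d. \<Sum>l<d. \<bar>K i l\<bar> * (sqrt (rho m l) * sqrt (Om i i)))"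
  have "(\<lambda>m'. ?B m' + sqrt (n * (kappa K * (2 * (rho_sum m' + rho_sum m)))))
      \<longlonglongrightarrow> n * (\<Sum>i<d. \<Sum>l<d. \<bar>K i l\<bar> * (sqrt 0 * sqrt (Om i i))) + sqrt (n * (kappa K * (2 * (0 + rho_sum m))))"
    by (intro tendsto_intros rho_sum_lim rho_lim) auto
  then show "(\<lambda>m'. ?B m' + sqrt (n * (kappa K * (2 * (rho_sum m' + rho_sum m))))) \<longlonglongrightarrow> sqrt (n * (kappa K * (2 * rho_sum m)))"
    by simp
  have "expectation (\<lambda>\<omega>. \<bar>Ssum K x n \<omega> - Ssum K (xm m) n \<omega>\<bar>)
      \<le> ?B m' + sqrt (n * (kappa K * (2 * (rho_sum m' + rho_sum m))))" for m'
  proof -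
    note iS = Ssum_x_integrable[of K n] and im = L2_integrable[OF Ssum_L2[OF xm_adapted, of K _ n]]
    have i1: "integrable M (\<lambda>\<omega>. \<bar>Ssum K x n \<omega> - Ssum K (xm m') n \<omega>\<bar>)"
      by (intro integrable_abs Bochner_Integration.integrable_diff iS im)
    have i2: "integrable M (\<lambda>\<omega>. \<bar>Ssum K (xm m') n \<omega> - Ssum K (xm m) n \<omega>\<bar>)"
      by (intro integrable_abs Bochner_Integration.integrable_diff im)
    have "expectation (\<lambda>\<omega>. \<bar>Ssum K x n \<omega> - Ssum K (xm m) n \<omega>\<bar>)
      \<le> expectation (\<lambda>\<omega>. \<bar>Ssum K x n \<omega> - Ssum K (xm m') n \<omega>\<bar> + \<bar>Ssum K (xm m') n \<omega> - Ssum K (xm m) n \<omega>\<bar>)"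
      by (intro integral_mono integrable_abs Bochner_Integration.integrable_add Bochner_Integration.integrable_diff iS im)
        auto
    also have "\<dots> = expectation (\<lambda>\<omega>. \<bar>Ssum K x n \<omega> - Ssum K (xm m') n \<omega>\<bar>)
        + expectation (\<lambda>\<omega>. \<bar>Ssum K (xm m') n \<omega> - Ssum K (xm m) n \<omega>\<bar>)"
      by (rule Bochner_Integration.integral_add[OF i1 i2])
    also have "\<dots> \<le> ?B m' + sqrt (n * (kappa K * (2 * (rho_sum m' + rho_sum m))))"
      by (intro add_mono Ssum_x_crude Ssum_xm_diff)
    finally show ?thesis .
  qed
  then show "\<exists>N. \<forall>m'\<ge>N. expectation (\<lambda>\<omega>. \<bar>Ssum K x n \<omega> - Ssum K (xm m) n \<omega>\<bar>)
      \<le> ?B m' + sqrt (n * (kappa K * (2 * (rho_sum m' + rho_sum m))))" by blast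
qed

text \<open>The truncated regressor and the next noise vector are independent, so the fourth moment
  of their product is a product of fourth moments; Cauchy-Schwarz would have required eighth
  moments.\<close>

lemma xi_xm_bdd4: "bdd4 (xi K (xm m))"
proof -
  obtain Cx where Cx: "\<And>l t. l < d \<Longrightarrow> integrable M (\<lambda>\<omega>. xm m t l \<omega> ^ 4) \<and> expectation (\<lambda>\<omega>. xm m t l \<omega> ^ 4) \<le> Cx l"
    using xm_bdd4[of m] unfolding bdd4_def by metis
  obtain Ce where Ce: "\<And>i t. i < d \<Longrightarrow> integrable M (\<lambda>\<omega>. e t i \<omega> ^ 4) \<and> expectation (\<lambda>\<omega>. e t i \<omega> ^ 4) \<le> Ce i"
    using e_bdd4 unfolding bdd4_def by metis
  have "bdd4 (\<lambda>t \<omega>. xm m t l \<omega> * e (t + 1) i \<omega>)" if li: "l < d" "i < d" for l i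
  proof (rule bdd4I[where g = "\<lambda>t \<omega>. xm m t l \<omega> ^ 4 * e (t + 1) i \<omega> ^ 4" and C = "Cx l * Ce i"])
    have m1: "(\<lambda>\<omega>. xm m t l \<omega> ^ 4) \<in> borel_measurable (hist {..t})" for t
      using adapted_hist[OF xm_adapted li(1), of t t m] by auto
    have m2: "(\<lambda>\<omega>. e (t + 1) i \<omega> ^ 4) \<in> borel_measurable (hist {t + 1})" for t
      using e_hist[of "t + 1" "{t + 1}" i] li by auto
    have disj: "{..t} \<inter> {t + 1} = {}" for t :: int by auto
    show "integrable M (\<lambda>\<omega>. xm m t l \<omega> ^ 4 * e (t + 1) i \<omega> ^ 4)" for t
      using Cx[OF li(1)] Ce[OF li(2)] by (intro hist_integrable_mult[OF m1 m2 disj]) auto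
    show "expectation (\<lambda>\<omega>. xm m t l \<omega> ^ 4 * e (t + 1) i \<omega> ^ 4) \<le> Cx l * Ce i" for t
    proof -
      have nn: "0 \<le> expectation (\<lambda>\<omega>. e s i \<omega> ^ 4)" "0 \<le> expectation (\<lambda>\<omega>. xm m s l \<omega> ^ 4)" for s
        by (auto intro!: integral_nonneg_AE)
      have "expectation (\<lambda>\<omega>. xm m t l \<omega> ^ 4 * e (t + 1) i \<omega> ^ 4)
          = expectation (\<lambda>\<omega>. xm m t l \<omega> ^ 4) * expectation (\<lambda>\<omega>. e (t + 1) i \<omega> ^ 4)"
        using Cx[OF li(1)] Ce[OF li(2)] by (intro hist_expectation_mult[OF m1 m2 disj]) auto
      also have "\<dots> \<le> Cx l * Ce i"
        using Cx[OF li(1), of t] Ce[OF li(2), of "t + 1"] nn(2)[of t] nn(1)[of "t + 1"]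
        by (intro mult_mono) linarith+
      finally show ?thesis .
    qed
    show "(\<lambda>\<omega>. xm m t l \<omega> * e (t + 1) i \<omega>) \<in> borel_measurable M" for t
      using li by (intro borel_measurable_times L2_measurable[OF xm_L2] e_measurable)
  qed (simp add: power_mult_distrib)
  then show ?thesis
    unfolding xi_def[abs_def] by (intro bdd4_sum bdd4_cmult) auto
qed

lemma clt_xm: "(\<lambda>n. \<integral>\<omega>. iexp (Ssum K (xm m) n \<omega> / sqrt n) \<partial>M) \<longlonglongrightarrow> exp (- qf K (Gm m) / 2)"
proof -
  let ?\<xi> = "\<lambda>k. xi K (xm m) (int k)"
  obtain C where C: "\<And>t. integrable M (\<lambda>\<omega>. xi K (xm m) t \<omega> ^ 4)" "\<And>t. expectation (\<lambda>\<omega>. xi K (xm m) t \<omega> ^ 4) \<le> C"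
    using xi_xm_bdd4 unfolding bdd4_def by metis
  have [measurable]: "xi K (xm m) t \<in> borel_measurable M" for t
    using L2_measurable[OF xi_L2[OF xm_adapted]] .
  have cube_le: "\<bar>a\<bar> ^ 3 \<le> 1 + a ^ 4" for a :: real
  proof (cases "\<bar>a\<bar> \<le> 1")
    case True
    then have "\<bar>a\<bar> ^ 3 \<le> 1" by (simp add: power_le_one)
    then show ?thesis by (simp add: add_increasing2)
  next
    case False
    then have "\<bar>a\<bar> ^ 3 \<le> \<bar>a\<bar> ^ 4" by (intro power_increasing) auto
    then show ?thesis by simp
  qed
  have int3: "integrable M (\<lambda>\<omega>. \<bar>?\<xi> k \<omega>\<bar> ^ 3)" for k
    by (rule Bochner_Integration.integrable_bound[of _ "\<lambda>\<omega>. 1 + ?\<xi> k \<omega> ^ 4"])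
      (use C(1)[of "int k"] cube_le in \<open>auto intro!: order_trans[OF _ abs_ge_self]\<close>)
  have bound3: "expectation (\<lambda>\<omega>. \<bar>?\<xi> k \<omega>\<bar> ^ 3) \<le> 1 + C" for k
  proof -
    have "expectation (\<lambda>\<omega>. \<bar>?\<xi> k \<omega>\<bar> ^ 3) \<le> expectation (\<lambda>\<omega>. 1 + ?\<xi> k \<omega> ^ 4)"
      using int3 C(1)[of "int k"] cube_le by (intro integral_mono) auto
    then show ?thesis using C[of "int k"] by (simp add: prob_space)
  qed
  \<comment> \<open>The empty sum gets the empty set of times. This matters when
    \<open>k \<le> m\<close>: then \<open>k - m\<close> is 0 while the window of the k-th increment
    may reach back to time 0 and below, so \<open>{..0}\<close> could fail to be disjoint from
    it.\<close>
  have S_hist: "(\<lambda>\<omega>. \<Sum>j<k. ?\<xi> j \<omega>) \<in> borel_measurable (hist (if k = 0 then {} else {..int k}))" for k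
  proof (cases "k = 0")
    case False
    have "?\<xi> j \<in> borel_measurable (hist {..int k})" if "j < k" for j
      using that by (intro xi_hist adapted_hist[OF xm_adapted]) auto
    then show ?thesis using False by (auto intro!: borel_measurable_sum)
  qed simp
  have I_hist: "(\<lambda>\<omega>. iexp (\<theta> * (\<Sum>j<k. ?\<xi> j \<omega>))) \<in> borel_measurable (hist (if k = 0 then {} else {..int k}))" for \<theta> k
    using S_hist[of k] by measurable
  have v: "expectation (\<lambda>\<omega>. (?\<xi> k \<omega>)\<^sup>2) = qf K (Gm m)" for k
    unfolding xi_square[OF xm_adapted] xm_cov ..
  have "qf K (Gm m) \<ge> 0" unfolding v[of 0, symmetric] by (auto intro: integral_nonneg_AE)
  moreover have mart: "(\<integral>\<omega>. iexp (\<theta> * (\<Sum>j<k. ?\<xi> j \<omega>)) * ?\<xi> k \<omega> \<partial>M) = 0" for \<theta> k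
  proof (rule xi_mart[OF xm_adapted])
    show h: "(\<lambda>\<omega>. iexp (\<theta> * (\<Sum>j<k. ?\<xi> j \<omega>))) \<in> borel_measurable (hist {..int k})"
      using I_hist[of \<theta> k] by (rule hist_mono) auto
    show "complex_integrable M (\<lambda>\<omega>. iexp (\<theta> * (\<Sum>j<k. ?\<xi> j \<omega>)) * xm m (int k) l \<omega>)" for l
      using hist_measurable[OF h] L2_measurable[OF xm_L2]
      by (intro Bochner_Integration.integrable_bound[OF L2_integrable[OF xm_L2[of m "int k" l]]])
        (auto simp: norm_mult)
  qed
  moreover have var: "(\<integral>\<omega>. iexp (\<theta> * (\<Sum>j<k - m. ?\<xi> j \<omega>)) * (?\<xi> k \<omega>)\<^sup>2 \<partial>M)
      = qf K (Gm m) * (\<integral>\<omega>. iexp (\<theta> * (\<Sum>j<k - m. ?\<xi> j \<omega>)) \<partial>M)" for \<theta> k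
  proof -
    \<comment> \<open>The k-th increment uses the truncation window ending at \<open>k\<close> and
      the noise at \<open>k + 1\<close>; earlier increments with index below \<open>k - m\<close>
      use the noise up to \<open>k - m\<close> only.\<close>
    have m1: "?\<xi> k \<in> borel_measurable (hist {int k - int m<..int k + 1})"
      by (intro xi_hist xm_hist) auto
    have m2: "(\<lambda>\<omega>. complex_of_real ((?\<xi> k \<omega>)\<^sup>2)) \<in> borel_measurable (hist {int k - int m<..int k + 1})"
      using m1 by measurable
    have i1: "integrable M (\<lambda>\<omega>. iexp (\<theta> * (\<Sum>j<k - m. ?\<xi> j \<omega>)))"
      by (rule integrable_const_bound[where B=1]) auto
    have i2: "integrable M (\<lambda>\<omega>. complex_of_real ((?\<xi> k \<omega>)\<^sup>2))"
      using xi_L2[OF xm_adapted, of K m "int k"] by (intro integrable_of_real) (simp add: L2_def)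
    have "(\<integral>\<omega>. iexp (\<theta> * (\<Sum>j<k - m. ?\<xi> j \<omega>)) * complex_of_real ((?\<xi> k \<omega>)\<^sup>2) \<partial>M)
       = (\<integral>\<omega>. iexp (\<theta> * (\<Sum>j<k - m. ?\<xi> j \<omega>)) \<partial>M) * (\<integral>\<omega>. complex_of_real ((?\<xi> k \<omega>)\<^sup>2) \<partial>M)"
      by (rule hist_expectation_mult[OF I_hist m2 _ i1 i2]) (auto simp: of_nat_diff)
    also have "(\<integral>\<omega>. complex_of_real ((?\<xi> k \<omega>)\<^sup>2) \<partial>M) = qf K (Gm m)"
      unfolding integral_complex_of_real v ..
    finally show ?thesis by (simp add: mult.commute)
  qed
  ultimately show ?thesis
    using char_tendsto_m_dependent[of ?\<xi> "1 + C" m "qf K (Gm m)", OF _ int3 bound3] unfolding Ssum_def by simp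
qed

lemma Ssum_x_char_approx:
  assumes "n > 0"
  shows "cmod ((\<integral>\<omega>. iexp (Ssum K x n \<omega> / sqrt n) \<partial>M) - (\<integral>\<omega>. iexp (Ssum K (xm m) n \<omega> / sqrt n) \<partial>M))
    \<le> sqrt (kappa K * (2 * rho_sum m))"
proof -
  note iS = Ssum_x_integrable[of K n] and im = L2_integrable[OF Ssum_L2[OF xm_adapted, of K m n]]
  have [measurable]: "Ssum K x n \<in> borel_measurable M" "Ssum K (xm m) n \<in> borel_measurable M"
    using iS im by auto
  have i: "integrable M (\<lambda>\<omega>. iexp (h \<omega> / sqrt n))" if [measurable]: "h \<in> borel_measurable M" for h
    by (rule integrable_const_bound[where B=1]) auto
  have "cmod ((\<integral>\<omega>. iexp (Ssum K x n \<omega> / sqrt n) \<partial>M) - (\<integral>\<omega>. iexp (Ssum K (xm m) n \<omega> / sqrt n) \<partial>M))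
      = cmod (\<integral>\<omega>. iexp (Ssum K x n \<omega> / sqrt n) - iexp (Ssum K (xm m) n \<omega> / sqrt n) \<partial>M)"
    by (subst Bochner_Integration.integral_diff[OF i i]) auto
  also have "\<dots> \<le> (\<integral>\<omega>. cmod (iexp (Ssum K x n \<omega> / sqrt n) - iexp (Ssum K (xm m) n \<omega> / sqrt n)) \<partial>M)"
    by (rule integral_norm_bound)
  also have "\<dots> \<le> (\<integral>\<omega>. \<bar>Ssum K x n \<omega> - Ssum K (xm m) n \<omega>\<bar> / sqrt n \<partial>M)"
  proof (rule integral_mono)
    show "integrable M (\<lambda>\<omega>. cmod (iexp (Ssum K x n \<omega> / sqrt n) - iexp (Ssum K (xm m) n \<omega> / sqrt n)))"
      by (intro integrable_norm Bochner_Integration.integrable_diff i) auto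
    show "integrable M (\<lambda>\<omega>. \<bar>Ssum K x n \<omega> - Ssum K (xm m) n \<omega>\<bar> / sqrt n)"
      by (intro integrable_divide integrable_abs Bochner_Integration.integrable_diff iS im)
    show "cmod (iexp (Ssum K x n \<omega> / sqrt n) - iexp (Ssum K (xm m) n \<omega> / sqrt n))
        \<le> \<bar>Ssum K x n \<omega> - Ssum K (xm m) n \<omega>\<bar> / sqrt n" for \<omega>
      using iexp_diff_le[of "Ssum K x n \<omega> / sqrt n" "Ssum K (xm m) n \<omega> / sqrt n"]
      by (simp flip: diff_divide_distrib)
  qed
  also have "\<dots> = expectation (\<lambda>\<omega>. \<bar>Ssum K x n \<omega> - Ssum K (xm m) n \<omega>\<bar>) / sqrt n"
    by simp
  also have "\<dots> \<le> sqrt (n * (kappa K * (2 * rho_sum m))) / sqrt n"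
    by (intro divide_right_mono Ssum_x_approx) auto
  also have "\<dots> = sqrt (kappa K * (2 * rho_sum m))"
    using assms by (simp add: real_sqrt_mult)
  finally show ?thesis .
qed

theorem clt_x: "(\<lambda>n. \<integral>\<omega>. iexp (Ssum K x n \<omega> / sqrt n) \<partial>M) \<longlonglongrightarrow> exp (- qf K Gam / 2)"
proof (rule LIMSEQ_approximants[OF clt_xm _ Ssum_x_char_approx])
  have "(\<lambda>m. exp (- qf K (Gm m) / 2)) \<longlonglongrightarrow> exp (- qf K Gam / 2)"
    by (intro tendsto_intros qf_tendsto Gm_lim) auto
  from tendsto_of_real[OF this]
  show "(\<lambda>m. complex_of_real (exp (- qf K (Gm m) / 2))) \<longlonglongrightarrow> complex_of_real (exp (- qf K Gam / 2))" .
  have "(\<lambda>m. sqrt (kappa K * (2 * rho_sum m))) \<longlonglongrightarrow> sqrt (kappa K * (2 * 0))"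
    by (intro tendsto_intros rho_sum_lim)
  then show "(\<lambda>m. sqrt (kappa K * (2 * rho_sum m))) \<longlonglongrightarrow> 0" by simp
qed

text \<open>The truncation with \<open>m = 0\<close> is the zero process, so the truncation error is
  the score sum itself.\<close>

lemma Ssum_x_L1_bound:
  "expectation (\<lambda>\<omega>. \<bar>Ssum K x n \<omega>\<bar>) \<le> sqrt n * sqrt (kappa K * (2 * rho_sum 0))"
proof -
  have "Ssum K (xm 0) n \<omega> = 0" for \<omega> by (simp add: Ssum_def xi_def xm_def)
  with Ssum_x_approx[of K n 0] show ?thesis by (simp add: real_sqrt_mult)
qed

text \<open>Three errors: truncating the products costs at most \<open>tau\<close> uniformly in
  \<open>n\<close>, the centred sum of m-dependent products is of order 1 / sqrt n, and
  \<open>Gm\<close> differs from \<open>Gam\<close>. The truncation \<open>m\<close> is fixed before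
  \<open>n\<close> tends to infinity.\<close>

theorem lln_x:
  assumes kl: "k < d" "l < d"
  shows "(\<lambda>n. expectation (\<lambda>\<omega>. \<bar>(\<Sum>t<n. x (int t) k \<omega> * x (int t) l \<omega>) / n - Gam k l\<bar>)) \<longlonglongrightarrow> 0"
proof (rule LIMSEQ_I)
  fix r :: real assume r: "r > 0"
  have "(\<lambda>m. tau m k l + \<bar>Gm m k l - Gam k l\<bar>) \<longlonglongrightarrow> 0 + \<bar>Gam k l - Gam k l\<bar>"
    by (intro tendsto_intros tau_lim Gm_lim kl)
  then have "\<forall>\<^sub>F m in sequentially. tau m k l + \<bar>Gm m k l - Gam k l\<bar> < r / 2"
    using r by (intro order_tendstoD(2)) auto
  then obtain m where m: "tau m k l + \<bar>Gm m k l - Gam k l\<bar> < r / 2"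
    using eventually_happens'[OF sequentially_bot] by blast
  define \<zeta> where "\<zeta> = (\<lambda>t :: nat. \<lambda>\<omega>. xm m (int t) k \<omega> * xm m (int t) l \<omega> - Gm m k l)"
  have pL: "L2 (\<lambda>\<omega>. xm m t k \<omega> * xm m t l \<omega>)" for t
    by (rule bdd4_mult(1)[OF xm_bdd4 xm_bdd4])
  have L2\<zeta>: "L2 (\<zeta> t)" for t
    unfolding \<zeta>_def by (intro L2_diff L2_const pL)
  have mean: "expectation (\<zeta> t) = 0" for t
    unfolding \<zeta>_def using L2_integrable[OF pL, of "int t"] by (simp add: xm_cov prob_space)
  \<comment> \<open>Here the bounded fourth moments enter: the truncated products need second
    moments bounded uniformly in time.\<close>
  obtain C where C: "\<And>t s. expectation (\<lambda>\<omega>. (xm m t k \<omega> * xm m s l \<omega>)\<^sup>2) \<le> C"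
    using bdd4_mult(2)[OF xm_bdd4[of m k] xm_bdd4[of m l]] by blast
  have bound\<zeta>: "expectation (\<lambda>\<omega>. (\<zeta> t \<omega>)\<^sup>2) \<le> 2 * C + 2 * (Gm m k l)\<^sup>2" for t
    unfolding \<zeta>_def using L2_expectation_square_diff_le[OF pL L2_const, of "int t" "Gm m k l"] C[of "int t" "int t"]
    by (simp add: prob_space)
  have \<zeta>_hist: "\<zeta> t \<in> borel_measurable (hist {int t - int m<..int t})" for t
    unfolding \<zeta>_def by (intro borel_measurable_diff borel_measurable_times borel_measurable_const xm_hist) auto
  have dep: "expectation (\<lambda>\<omega>. \<zeta> s \<omega> * \<zeta> t \<omega>) = 0" if "s + m \<le> t" for s t
  proof -
    have "{int s - int m<..int s} \<inter> {int t - int m<..int t} = {}" using that by auto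
    from hist_expectation_mult[OF \<zeta>_hist \<zeta>_hist this L2_integrable[OF L2\<zeta>] L2_integrable[OF L2\<zeta>]]
    show ?thesis by (simp add: mean)
  qed
  define D where "D = (2 * m + 1) * (2 * C + 2 * (Gm m k l)\<^sup>2)"
  have sumsq: "expectation (\<lambda>\<omega>. (\<Sum>t<n. \<zeta> t \<omega>)\<^sup>2) \<le> n * D" for n
    using m_dependent_sum_square_le[where \<zeta> = \<zeta> and m = m and n = n, OF L2\<zeta> bound\<zeta> dep] by (simp add: D_def algebra_simps)
  have bound: "expectation (\<lambda>\<omega>. \<bar>(\<Sum>t<n. x (int t) k \<omega> * x (int t) l \<omega>) / n - Gam k l\<bar>)
      \<le> tau m k l + \<bar>Gm m k l - Gam k l\<bar> + sqrt D / sqrt n" if n: "n > 0" for n :: nat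
  proof -
    let ?\<delta> = "\<lambda>t \<omega>. x (int t) k \<omega> * x (int t) l \<omega> - xm m (int t) k \<omega> * xm m (int t) l \<omega>"
    note i\<delta> = x_product_approx(1)[OF kl, of "int _" m]
    have eq: "(\<Sum>t<n. x (int t) k \<omega> * x (int t) l \<omega>) / n - Gam k l
        = (\<Sum>t<n. ?\<delta> t \<omega>) / n + (\<Sum>t<n. \<zeta> t \<omega>) / n + (Gm m k l - Gam k l)" for \<omega>
      using n by (simp add: \<zeta>_def sum_subtractf diff_divide_distrib)
    have iA: "integrable M (\<lambda>\<omega>. (\<Sum>t<n. \<bar>?\<delta> t \<omega>\<bar>) / n)"
      by (intro integrable_divide Bochner_Integration.integrable_sum integrable_abs i\<delta>)
    have iB: "integrable M (\<lambda>\<omega>. \<bar>\<Sum>t<n. \<zeta> t \<omega>\<bar> / n)"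
      by (intro integrable_divide Bochner_Integration.integrable_sum integrable_abs L2_integrable L2\<zeta>)
    have iC: "integrable M (\<lambda>\<omega>. \<bar>Gm m k l - Gam k l\<bar>)" by simp
    note iAB = Bochner_Integration.integrable_add[OF iA iB]
    have "expectation (\<lambda>\<omega>. \<bar>(\<Sum>t<n. x (int t) k \<omega> * x (int t) l \<omega>) / n - Gam k l\<bar>)
        \<le> expectation (\<lambda>\<omega>. (\<Sum>t<n. \<bar>?\<delta> t \<omega>\<bar>) / n + \<bar>\<Sum>t<n. \<zeta> t \<omega>\<bar> / n + \<bar>Gm m k l - Gam k l\<bar>)"
    proof (rule integral_mono)
      show "integrable M (\<lambda>\<omega>. \<bar>(\<Sum>t<n. x (int t) k \<omega> * x (int t) l \<omega>) / n - Gam k l\<bar>)"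
        using kl by (intro integrable_abs Bochner_Integration.integrable_diff integrable_divide
            Bochner_Integration.integrable_sum L2_mult_integrable x_L2) auto
      show "integrable M (\<lambda>\<omega>. (\<Sum>t<n. \<bar>?\<delta> t \<omega>\<bar>) / n + \<bar>\<Sum>t<n. \<zeta> t \<omega>\<bar> / n + \<bar>Gm m k l - Gam k l\<bar>)"
        by (rule Bochner_Integration.integrable_add[OF iAB iC])
      fix \<omega>
      have "\<bar>(\<Sum>t<n. ?\<delta> t \<omega>) / n\<bar> \<le> (\<Sum>t<n. \<bar>?\<delta> t \<omega>\<bar>) / n"
        by (simp add: divide_right_mono sum_abs)
      moreover have "\<bar>(\<Sum>t<n. \<zeta> t \<omega>) / n\<bar> = \<bar>\<Sum>t<n. \<zeta> t \<omega>\<bar> / n" by simp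
      ultimately show "\<bar>(\<Sum>t<n. x (int t) k \<omega> * x (int t) l \<omega>) / n - Gam k l\<bar>
          \<le> (\<Sum>t<n. \<bar>?\<delta> t \<omega>\<bar>) / n + \<bar>\<Sum>t<n. \<zeta> t \<omega>\<bar> / n + \<bar>Gm m k l - Gam k l\<bar>"
        unfolding eq by linarith
    qed
    also have "\<dots> = expectation (\<lambda>\<omega>. (\<Sum>t<n. \<bar>?\<delta> t \<omega>\<bar>) / n) + expectation (\<lambda>\<omega>. \<bar>\<Sum>t<n. \<zeta> t \<omega>\<bar> / n) + \<bar>Gm m k l - Gam k l\<bar>"
      unfolding Bochner_Integration.integral_add[OF iAB iC] Bochner_Integration.integral_add[OF iA iB]
      by (simp add: prob_space)
    also have "expectation (\<lambda>\<omega>. (\<Sum>t<n. \<bar>?\<delta> t \<omega>\<bar>) / n) \<le> tau m k l"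
    proof -
      have "expectation (\<lambda>\<omega>. (\<Sum>t<n. \<bar>?\<delta> t \<omega>\<bar>) / n) = (\<Sum>t<n. expectation (\<lambda>\<omega>. \<bar>?\<delta> t \<omega>\<bar>)) / n"
        using integrable_abs[OF i\<delta>] by (simp add: Bochner_Integration.integral_sum)
      also have "\<dots> \<le> (\<Sum>t<n. tau m k l) / n"
        by (intro divide_right_mono sum_mono x_product_approx(2)[OF kl]) auto
      finally show ?thesis using n by simp
    qed
    also have "expectation (\<lambda>\<omega>. \<bar>\<Sum>t<n. \<zeta> t \<omega>\<bar> / n) \<le> sqrt D / sqrt n"
    proof -
      have "expectation (\<lambda>\<omega>. \<bar>\<Sum>t<n. \<zeta> t \<omega>\<bar>) \<le> sqrt (n * D)"
        using L2_expectation_abs_le[OF L2_sum[of "{..<n}" \<zeta>, OF L2\<zeta>]] sumsq[of n]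
        by (meson order_trans real_sqrt_le_mono)
      then have "expectation (\<lambda>\<omega>. \<bar>\<Sum>t<n. \<zeta> t \<omega>\<bar> / n) \<le> sqrt (n * D) / n"
        by (simp add: divide_right_mono)
      also have "\<dots> = sqrt D / sqrt n"
        using n real_div_sqrt[of n] by (simp add: real_sqrt_mult field_simps)
      finally show ?thesis .
    qed
    finally show ?thesis by simp
  qed
  have "(\<lambda>n. sqrt D / sqrt (real n)) \<longlonglongrightarrow> 0"
    by (rule real_tendsto_divide_at_top[OF tendsto_const])
      (rule filterlim_compose[OF sqrt_at_top filterlim_real_sequentially])
  then have "\<forall>\<^sub>F n in sequentially. sqrt D / sqrt (real n) < r / 2"
    using r by (intro order_tendstoD(2)) auto
  then obtain N where N: "\<And>n. n \<ge> N \<Longrightarrow> sqrt D / sqrt (real n) < r / 2"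
    unfolding eventually_sequentially by blast
  show "\<exists>N. \<forall>n\<ge>N. norm (expectation (\<lambda>\<omega>. \<bar>(\<Sum>t<n. x (int t) k \<omega> * x (int t) l \<omega>) / n - Gam k l\<bar>) - 0) < r"
  proof (intro exI allI impI)
    fix n assume n: "n \<ge> max N 1"
    have "0 \<le> expectation (\<lambda>\<omega>. \<bar>(\<Sum>t<n. x (int t) k \<omega> * x (int t) l \<omega>) / n - Gam k l\<bar>)"
      by (auto intro: integral_nonneg_AE)
    moreover have "expectation (\<lambda>\<omega>. \<bar>(\<Sum>t<n. x (int t) k \<omega> * x (int t) l \<omega>) / n - Gam k l\<bar>) < r"
      using bound[of n] N[of n] m n by linarith
    ultimately show "norm (expectation (\<lambda>\<omega>. \<bar>(\<Sum>t<n. x (int t) k \<omega> * x (int t) l \<omega>) / n - Gam k l\<bar>) - 0) < r"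
      by simp
  qed
qed

end

section \<open>Inverses and powers of matrices\<close>

lemma inv_mat_carrier:
  assumes "A \<in> carrier_mat n n"
  shows "inv_mat A \<in> carrier_mat n n"
proof (cases "mat_inverse A")
  case None
  then show ?thesis using assms by (auto simp: inv_mat_def)
next
  case (Some B)
  then show ?thesis using mat_inverse(2)[OF assms Some] by (simp add: inv_mat_def)
qed

lemma inv_mat_unique:
  assumes A: "A \<in> carrier_mat n n" and C: "C \<in> carrier_mat n n" and AC: "A * C = 1\<^sub>m n"
  shows "inv_mat A = C"
proof -
  have "det A * det C = 1" using det_mult[OF A C] AC by simp
  then have "det A \<noteq> 0" by auto
  then have "A \<in> Units (ring_mat TYPE(real) n ())" by (rule det_non_zero_imp_unit[OF A])
  then obtain B where B: "mat_inverse A = Some B" using mat_inverse(1)[OF A, where b = "()"] by (cases "mat_inverse A") auto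
  note B' = mat_inverse(2)[OF A B]
  have "B = B * (A * C)" unfolding AC using B' right_mult_one_mat[of B n n] by simp
  also have "\<dots> = (B * A) * C" by (rule assoc_mult_mat[symmetric]) (use A B' C in auto)
  also have "\<dots> = C" using B' C by simp
  finally show ?thesis using B by (simp add: inv_mat_def)
qed

text \<open>The adjugate formula with an explicit case for singular matrices expresses each entry of
  the inverse through determinants. Measurability and convergence of inverses are thereby reduced to
  those of determinants.\<close>

lemma inv_mat_det:
  assumes A: "A \<in> carrier_mat n n"
  shows "inv_mat A = (if det A = 0 then 0\<^sub>m n n else (1 / det A) \<cdot>\<^sub>m adj_mat A)"
proof (cases "det A = 0")
  case True
  have "mat_inverse A = None"
  proof (rule ccontr)
    assume "mat_inverse A \<noteq> None"
    then obtain B where "mat_inverse A = Some B" by auto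
    then have "A * B = 1\<^sub>m n" "B \<in> carrier_mat n n" using mat_inverse(2)[OF A] by auto
    then have "det A * det B = 1" using det_mult[OF A, of B] by simp
    then show False using True by simp
  qed
  then show ?thesis using A True by (auto simp: inv_mat_def)
next
  case False
  have "A * ((1 / det A) \<cdot>\<^sub>m adj_mat A) = (1 / det A) \<cdot>\<^sub>m (A * adj_mat A)"
    using A adj_mat[OF A] by (simp add: mult_smult_distrib)
  also have "\<dots> = 1\<^sub>m n"
    unfolding adj_mat(2)[OF A] using False by (intro eq_matI) auto
  finally show ?thesis using inv_mat_unique[OF A] adj_mat[OF A] False by auto
qed

lemma inv_mat_mult:
  assumes A: "A \<in> carrier_mat n n" and det: "det A \<noteq> 0"
  shows "A * inv_mat A = 1\<^sub>m n" "inv_mat A * A = 1\<^sub>m n"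
proof -
  have "A \<in> Units (ring_mat TYPE(real) n ())" by (rule det_non_zero_imp_unit[OF A det])
  then obtain B where B: "mat_inverse A = Some B" using mat_inverse(1)[OF A, where b = "()"] by (cases "mat_inverse A") auto
  then show "A * inv_mat A = 1\<^sub>m n" "inv_mat A * A = 1\<^sub>m n"
    using mat_inverse(2)[OF A B] by (auto simp: inv_mat_def)
qed

text \<open>These are the two facts by which the limit law is recognised as the Gaussian law with
  precision matrix \<open>A\<close>.\<close>

lemma inv_mat_inv_mat:
  assumes A: "A \<in> carrier_mat n n" and det: "det A \<noteq> 0"
  shows "inv_mat (inv_mat A) = A" "det (inv_mat A) = 1 / det A"
proof -
  show "inv_mat (inv_mat A) = A"
    by (rule inv_mat_unique[OF inv_mat_carrier[OF A] A inv_mat_mult(2)[OF A det]])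
  have "det A * det (inv_mat A) = 1"
    using det_mult[OF A inv_mat_carrier[OF A]] inv_mat_mult(1)[OF A det] by simp
  then show "det (inv_mat A) = 1 / det A" using det by (simp add: field_simps)
qed

text \<open>For singular \<open>A\<close> both sides are zero, so the Gram matrix can be rescaled on
  every sample without an exceptional set.\<close>

lemma inv_mat_smult:
  assumes A: "A \<in> carrier_mat n n" and c: "c \<noteq> 0"
  shows "inv_mat (c \<cdot>\<^sub>m A) = (1 / c) \<cdot>\<^sub>m inv_mat A"
proof (cases "det A = 0")
  case True
  then have "det (c \<cdot>\<^sub>m A) = 0" using A by simp
  then show ?thesis using True A by (auto simp: inv_mat_det[OF A] inv_mat_det[of "c \<cdot>\<^sub>m A" n])
next
  case False
  note I = inv_mat_carrier[OF A]
  have "(c \<cdot>\<^sub>m A) * ((1 / c) \<cdot>\<^sub>m inv_mat A) = (c * (1 / c)) \<cdot>\<^sub>m (A * inv_mat A)"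
    using A I by (intro eq_matI) auto
  also have "\<dots> = 1\<^sub>m n" unfolding inv_mat_mult(1)[OF A False] using c by (intro eq_matI) auto
  finally show ?thesis using A I by (intro inv_mat_unique) auto
qed

lemma inv_mat_symmetric:
  assumes A: "A \<in> carrier_mat n n" and det: "det A \<noteq> 0" and sym: "A\<^sup>T = A"
  shows "(inv_mat A)\<^sup>T = inv_mat A"
proof -
  note I = inv_mat_carrier[OF A]
  have "A * (inv_mat A)\<^sup>T = (inv_mat A * A)\<^sup>T"
    using transpose_mult[OF I A] sym by simp
  also have "\<dots> = 1\<^sub>m n" unfolding inv_mat_mult(2)[OF A det] by simp
  finally show ?thesis using inv_mat_unique[OF A, of "(inv_mat A)\<^sup>T"] I by simp
qed

lemma det_tendsto:
  fixes A :: "'b \<Rightarrow> real mat"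
  assumes A: "\<And>k. A k \<in> carrier_mat n n" and B: "B \<in> carrier_mat n n"
    and lim: "\<And>i j. i < n \<Longrightarrow> j < n \<Longrightarrow> ((\<lambda>k. A k $$ (i, j)) \<longlongrightarrow> B $$ (i, j)) F"
  shows "((\<lambda>k. det (A k)) \<longlongrightarrow> det B) F"
  unfolding det_def'[OF A] det_def'[OF B]
proof (intro tendsto_sum tendsto_mult tendsto_const tendsto_prod lim)
  fix p i assume "p \<in> {p. p permutes {0..<n}}" "i \<in> {0..<n}"
  then show "i < n" "p i < n" using permutes_in_image[of p "{0..<n}" i] by auto
qed

lemma mat_delete_entry:
  assumes "A \<in> carrier_mat n n" "i < n - 1" "j < n - 1"
  shows "mat_delete A a b $$ (i, j) = A $$ (if i < a then i else Suc i, if j < b then j else Suc j)"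
  using assms by (auto simp: mat_delete_def)

lemma adj_mat_tendsto:
  fixes A :: "'b \<Rightarrow> real mat"
  assumes A: "\<And>k. A k \<in> carrier_mat n n" and B: "B \<in> carrier_mat n n"
    and lim: "\<And>i j. i < n \<Longrightarrow> j < n \<Longrightarrow> ((\<lambda>k. A k $$ (i, j)) \<longlongrightarrow> B $$ (i, j)) F"
    and ij: "i < n" "j < n"
  shows "((\<lambda>k. adj_mat (A k) $$ (i, j)) \<longlongrightarrow> adj_mat B $$ (i, j)) F"
proof -
  have adj: "adj_mat C $$ (i, j) = (- 1) ^ (j + i) * det (mat_delete C j i)" if "C \<in> carrier_mat n n" for C :: "real mat"
    using that ij by (auto simp: adj_mat_def cofactor_def)
  show ?thesis
    unfolding adj[OF A] adj[OF B]
  proof (intro tendsto_mult tendsto_const det_tendsto[where n = "n - 1"])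
    show "mat_delete (A k) j i \<in> carrier_mat (n - 1) (n - 1)" for k by (rule mat_delete_carrier[OF A])
    show "mat_delete B j i \<in> carrier_mat (n - 1) (n - 1)" by (rule mat_delete_carrier[OF B])
    show "((\<lambda>k. mat_delete (A k) j i $$ (a, b)) \<longlongrightarrow> mat_delete B j i $$ (a, b)) F"
      if "a < n - 1" "b < n - 1" for a b
      unfolding mat_delete_entry[OF A that] mat_delete_entry[OF B that] using that
      by (intro lim) auto
  qed
qed

lemma inv_mat_tendsto:
  fixes A :: "'b \<Rightarrow> real mat"
  assumes A: "\<And>k. A k \<in> carrier_mat n n" and B: "B \<in> carrier_mat n n" and det: "det B \<noteq> 0"
    and lim: "\<And>i j. i < n \<Longrightarrow> j < n \<Longrightarrow> ((\<lambda>k. A k $$ (i, j)) \<longlongrightarrow> B $$ (i, j)) F"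
    and ij: "i < n" "j < n"
  shows "((\<lambda>k. inv_mat (A k) $$ (i, j)) \<longlongrightarrow> inv_mat B $$ (i, j)) F"
proof -
  have d: "((\<lambda>k. det (A k)) \<longlongrightarrow> det B) F" by (rule det_tendsto[OF A B lim])
  have eq: "inv_mat C $$ (i, j) = 1 / det C * adj_mat C $$ (i, j)"
    if "C \<in> carrier_mat n n" "det C \<noteq> 0" for C
    using that ij adj_mat(1)[OF that(1)] by (simp add: inv_mat_det[OF that(1)])
  have "\<forall>\<^sub>F k in F. 1 / det (A k) * adj_mat (A k) $$ (i, j) = inv_mat (A k) $$ (i, j)"
    using tendsto_imp_eventually_ne[OF d det] by eventually_elim (simp add: eq[OF A])
  moreover have "((\<lambda>k. 1 / det (A k) * adj_mat (A k) $$ (i, j)) \<longlongrightarrow> inv_mat B $$ (i, j)) F"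
    unfolding eq[OF B det]
    by (intro tendsto_mult tendsto_divide tendsto_const d det adj_mat_tendsto[OF A B lim ij])
  ultimately show ?thesis by (rule Lim_transform_eventually[rotated])
qed

lemma inv_mat_continuous:
  assumes B: "B \<in> carrier_mat n n" and det: "det B \<noteq> 0" and r: "r > 0"
  shows "\<exists>\<delta>>0. \<forall>A\<in>carrier_mat n n. (\<forall>i<n. \<forall>j<n. \<bar>A $$ (i, j) - B $$ (i, j)\<bar> < \<delta>) \<longrightarrow>
    (\<forall>i<n. \<forall>j<n. \<bar>inv_mat A $$ (i, j) - inv_mat B $$ (i, j)\<bar> < r)"
proof (rule ccontr)
  assume "\<not> ?thesis"
  then have neg: "\<exists>A\<in>carrier_mat n n. (\<forall>i<n. \<forall>j<n. \<bar>A $$ (i, j) - B $$ (i, j)\<bar> < \<delta>) \<and>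
    \<not> (\<forall>i<n. \<forall>j<n. \<bar>inv_mat A $$ (i, j) - inv_mat B $$ (i, j)\<bar> < r)" if "\<delta> > 0" for \<delta>
    using that by blast
  have "\<forall>k. \<exists>A\<in>carrier_mat n n. (\<forall>i<n. \<forall>j<n. \<bar>A $$ (i, j) - B $$ (i, j)\<bar> < 1 / Suc k) \<and>
    \<not> (\<forall>i<n. \<forall>j<n. \<bar>inv_mat A $$ (i, j) - inv_mat B $$ (i, j)\<bar> < r)"
    by (intro allI neg) simp
  then obtain A where A: "\<And>k. A k \<in> carrier_mat n n"
    "\<And>k i j. i < n \<Longrightarrow> j < n \<Longrightarrow> \<bar>A k $$ (i, j) - B $$ (i, j)\<bar> < 1 / Suc k"
    "\<And>k. \<not> (\<forall>i<n. \<forall>j<n. \<bar>inv_mat (A k) $$ (i, j) - inv_mat B $$ (i, j)\<bar> < r)"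
    by metis
  have lim: "(\<lambda>k. A k $$ (i, j)) \<longlonglongrightarrow> B $$ (i, j)" if "i < n" "j < n" for i j
  proof (rule LIM_zero_cancel, rule Lim_null_comparison)
    show "\<forall>\<^sub>F k in sequentially. norm (A k $$ (i, j) - B $$ (i, j)) \<le> 1 / Suc k"
      by (intro always_eventually allI less_imp_le) (use A(2)[OF that] in simp)
    show "(\<lambda>k. 1 / real (Suc k)) \<longlonglongrightarrow> 0" using LIMSEQ_inverse_real_of_nat by (simp add: inverse_eq_divide)
  qed
  have "\<forall>\<^sub>F k in sequentially. \<forall>i\<in>{..<n}. \<forall>j\<in>{..<n}. dist (inv_mat (A k) $$ (i, j)) (inv_mat B $$ (i, j)) < r"
    by (intro eventually_ball_finite ballI tendstoD[OF inv_mat_tendsto[OF A(1) B det lim]] r) auto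
  then obtain k where "\<forall>i\<in>{..<n}. \<forall>j\<in>{..<n}. dist (inv_mat (A k) $$ (i, j)) (inv_mat B $$ (i, j)) < r"
    using eventually_happens'[OF sequentially_bot] by blast
  then show False using A(3)[of k] by (simp add: dist_real_def)
qed

lemma borel_measurable_det:
  fixes A :: "'b \<Rightarrow> real mat"
  assumes A: "\<And>\<omega>. A \<omega> \<in> carrier_mat n n"
    and meas: "\<And>i j. i < n \<Longrightarrow> j < n \<Longrightarrow> (\<lambda>\<omega>. A \<omega> $$ (i, j)) \<in> borel_measurable M"
  shows "(\<lambda>\<omega>. det (A \<omega>)) \<in> borel_measurable M"
  unfolding det_def'[OF A]
proof (intro borel_measurable_sum borel_measurable_times borel_measurable_const borel_measurable_prod meas)
  fix p i assume "p \<in> {p. p permutes {0..<n}}" "i \<in> {0..<n}"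
  then show "i < n" "p i < n" using permutes_in_image[of p "{0..<n}" i] by auto
qed

lemma borel_measurable_inv_mat:
  fixes A :: "'b \<Rightarrow> real mat"
  assumes A: "\<And>\<omega>. A \<omega> \<in> carrier_mat n n"
    and meas: "\<And>i j. i < n \<Longrightarrow> j < n \<Longrightarrow> (\<lambda>\<omega>. A \<omega> $$ (i, j)) \<in> borel_measurable M"
    and ij: "i < n" "j < n"
  shows "(\<lambda>\<omega>. inv_mat (A \<omega>) $$ (i, j)) \<in> borel_measurable M"
proof -
  have [measurable]: "(\<lambda>\<omega>. det (A \<omega>)) \<in> borel_measurable M"
    by (rule borel_measurable_det[OF A meas])
  have [measurable]: "(\<lambda>\<omega>. det (mat_delete (A \<omega>) j i)) \<in> borel_measurable M"
  proof (rule borel_measurable_det[where n = "n - 1"])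
    show "mat_delete (A \<omega>) j i \<in> carrier_mat (n - 1) (n - 1)" for \<omega> by (rule mat_delete_carrier[OF A])
    show "(\<lambda>\<omega>. mat_delete (A \<omega>) j i $$ (a, b)) \<in> borel_measurable M" if "a < n - 1" "b < n - 1" for a b
      unfolding mat_delete_entry[OF A that] using that by (intro meas) auto
  qed
  have "inv_mat (A \<omega>) $$ (i, j) = (if det (A \<omega>) = 0 then 0
      else 1 / det (A \<omega>) * ((- 1) ^ (j + i) * det (mat_delete (A \<omega>) j i)))" for \<omega>
    using A[of \<omega>] ij adj_mat(1)[OF A[of \<omega>]]
    by (simp add: inv_mat_det[OF A]) (auto simp: adj_mat_def cofactor_def)
  then show ?thesis by simp
qed

lemma smult_mat_pow:
  assumes A: "A \<in> carrier_mat n n"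
  shows "(c \<cdot>\<^sub>m A) ^\<^sub>m k = c ^ k \<cdot>\<^sub>m (A ^\<^sub>m k :: 'a :: comm_ring_1 mat)"
proof (induction k)
  case 0
  then show ?case using A by (auto intro!: eq_matI)
next
  case (Suc k)
  have "(c \<cdot>\<^sub>m A) ^\<^sub>m Suc k = (c ^ k \<cdot>\<^sub>m A ^\<^sub>m k) * (c \<cdot>\<^sub>m A)" using Suc by simp
  also have "\<dots> = c ^ Suc k \<cdot>\<^sub>m (A ^\<^sub>m k * A)"
    using A pow_carrier_mat[OF A, of k]
    by (intro eq_matI) (auto simp: mult_ac)
  finally show ?case by simp
qed

text \<open>Powers of a matrix with spectral radius below 1 are bounded. Applied to B / s with
  \<open>s\<close> strictly between the spectral radius of B and 1, this yields geometric decay c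
  s^k.\<close>

lemma pow_mat_tendsto_0:
  fixes B :: "real mat"
  assumes B: "B \<in> carrier_mat n n" and n: "n > 0"
    and sr: "spectral_radius (map_mat complex_of_real B) < 1" and ij: "i < n" "j < n"
  shows "(\<lambda>k. (B ^\<^sub>m k) $$ (i, j)) \<longlonglongrightarrow> 0"
proof -
  define A where "A = map_mat complex_of_real B"
  have A: "A \<in> carrier_mat n n" using B by (simp add: A_def)
  \<comment> \<open>The midpoint lies strictly between the spectral radius and 1; the maximum with
    1/2 makes positivity evident.\<close>
  define s where "s = max (1 / 2) ((1 + spectral_radius A) / 2)"
  have s: "0 < s" "s < 1" "spectral_radius A < s" using sr by (auto simp: s_def A_def max_def)
  define A' where "A' = complex_of_real (1 / s) \<cdot>\<^sub>m A"
  have A': "A' \<in> carrier_mat n n" using A by (simp add: A'_def)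
  have "spectral_radius A' < 1"
  proof -
    obtain z where z: "z \<in> spectrum A'" "spectral_radius A' = cmod z"
      using spectral_radius_mem_max(1)[OF A' n] by auto
    then obtain v where v: "v \<in> carrier_vec n" "v \<noteq> 0\<^sub>v n" "A' *\<^sub>v v = z \<cdot>\<^sub>v v"
      using A' by (auto simp: spectrum_def eigenvalue_def eigenvector_def)
    have "A' *\<^sub>v v = complex_of_real (1 / s) \<cdot>\<^sub>v (A *\<^sub>v v)"
      unfolding A'_def using A v by (intro eq_vecI) auto
    then have "complex_of_real s \<cdot>\<^sub>v (z \<cdot>\<^sub>v v) = complex_of_real s \<cdot>\<^sub>v (complex_of_real (1 / s) \<cdot>\<^sub>v (A *\<^sub>v v))"
      using v(3) by simp
    then have "(s * z) \<cdot>\<^sub>v v = A *\<^sub>v v" using s by (simp add: smult_smult_assoc)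
    then have "s * z \<in> spectrum A"
      using v A by (auto simp: spectrum_def eigenvalue_def eigenvector_def intro!: exI[of _ v])
    then have "cmod (s * z) \<le> spectral_radius A" by (intro spectral_radius_mem_max(2)[OF A n]) auto
    then have "s * cmod z \<le> spectral_radius A" using s by (simp add: norm_mult)
    then have "s * cmod z < s * 1" using s by linarith
    then show ?thesis using s z by simp
  qed
  from spectral_radius_jnf_norm_bound_less_1_upper_triangular[OF A' this]
  obtain c where c: "\<And>k. norm_bound (A' ^\<^sub>m k) c" by auto
  have "norm ((B ^\<^sub>m k) $$ (i, j)) \<le> c * s ^ k" for k
  proof -
    have "A' ^\<^sub>m k = complex_of_real (1 / s) ^ k \<cdot>\<^sub>m map_mat complex_of_real (B ^\<^sub>m k)"
      unfolding A'_def smult_mat_pow[OF A] unfolding A_def of_real_hom.mat_hom_pow[OF B] ..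
    then have eq: "(A' ^\<^sub>m k) $$ (i, j) = complex_of_real (1 / s) ^ k * complex_of_real ((B ^\<^sub>m k) $$ (i, j))"
      using ij carrier_matD[OF pow_carrier_mat[OF B, of k]] by simp
    have "cmod ((A' ^\<^sub>m k) $$ (i, j)) \<le> c"
      using c[of k] carrier_matD[OF A'] ij by (simp add: norm_bound_def)
    then have "(1 / s) ^ k * \<bar>(B ^\<^sub>m k) $$ (i, j)\<bar> \<le> c"
      unfolding eq norm_mult norm_power norm_of_real using s by simp
    then show ?thesis using s by (simp add: power_divide field_simps)
  qed
  then have ev: "\<forall>\<^sub>F k in sequentially. norm ((B ^\<^sub>m k) $$ (i, j)) \<le> c * s ^ k"
    by (intro always_eventually allI)
  have "(\<lambda>k. c * s ^ k) \<longlonglongrightarrow> 0"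
    using tendsto_mult[OF tendsto_const LIMSEQ_realpow_zero[of s], of c] s by simp
  with ev show ?thesis by (rule Lim_null_comparison)
qed

section \<open>The NIRVAR process as a stable autoregression\<close>

lemma sum_lessThan_add: "(\<Sum>k<a + b. f k) = (\<Sum>k<a. f k) + (\<Sum>j<b. f (a + j :: nat) :: 'b :: comm_monoid_add)"
  by (induction b) (auto simp: add.assoc)

lemma sum_blocks:
  fixes f :: "nat \<Rightarrow> 'b :: comm_monoid_add"
  shows "(\<Sum>k<T * N. f k) = (\<Sum>t<T. \<Sum>i<N. f (t * N + i))"
proof (induction T)
  case (Suc T)
  have "(\<Sum>k<Suc T * N. f k) = (\<Sum>k<T * N + N. f k)" by (simp add: add.commute)
  then show ?case using Suc by (simp add: sum_lessThan_add)
qed simp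

context nirvar
begin

definition xs :: "int \<Rightarrow> nat \<Rightarrow> 'a \<Rightarrow> real" where
  "xs t k \<omega> = X (k div N) t \<omega> $ (k mod N)"

definition es :: "int \<Rightarrow> nat \<Rightarrow> 'a \<Rightarrow> real" where
  "es t k \<omega> = eps (k div N) t \<omega> $ (k mod N)"

definition coef :: "real mat" where
  "coef = block_mat N Q (\<lambda>p r. Adj p r \<odot>\<^sub>H W p r)"

definition Gam :: "nat \<Rightarrow> nat \<Rightarrow> real" where
  "Gam k l = expectation (\<lambda>\<omega>. xs 0 k \<omega> * xs 0 l \<omega>)"

text \<open>Block diagonal, since noise vectors of different features are independent and
  centred.\<close>

definition Om :: "nat \<Rightarrow> nat \<Rightarrow> real" where
  "Om k l = (if k div N = l div N then Sig (k div N) $$ (k mod N, l mod N) else 0)"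

lemma div_mod_less:
  assumes "k < N * Q"
  shows "k div N < Q" "k mod N < N"
  using assms N_pos less_mult_imp_div_less[of k Q N] by (auto simp: mult.commute)

lemma block_index:
  assumes "r < Q" "j < N"
  shows "r * N + j < N * Q" "(r * N + j) div N = r" "(r * N + j) mod N = j"
proof -
  have "r * N + j < r * N + N" using assms by simp
  also have "\<dots> = Suc r * N" by simp
  also have "\<dots> \<le> Q * N" using assms by (intro mult_right_mono) auto
  finally show "r * N + j < N * Q" by (simp add: mult.commute)
qed (use assms in auto)

lemma X_measurable: "p < Q \<Longrightarrow> i < N \<Longrightarrow> (\<lambda>\<omega>. X p t \<omega> $ i) \<in> borel_measurable M"
  using X_random by (auto simp: random_vec_def)

lemma eps_measurable: "p < Q \<Longrightarrow> i < N \<Longrightarrow> (\<lambda>\<omega>. eps p t \<omega> $ i) \<in> borel_measurable M"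
  using eps_random by (auto simp: random_vec_def)

lemma coef_carrier: "coef \<in> carrier_mat (N * Q) (N * Q)"
  by (simp add: coef_def block_mat_def)

lemma coef_index:
  assumes "p < Q" "i < N" "r < Q" "j < N"
  shows "coef $$ (p * N + i, r * N + j) = Adj p r $$ (i, j) * W p r $$ (i, j)"
  using assms block_index Adj_carrier[of p r] by (auto simp: coef_def block_mat_def hadamard_def)

lemma var_step:
  "AE \<omega> in M. \<forall>t. \<forall>k<N * Q. xs t k \<omega> = (\<Sum>l<N * Q. coef $$ (k, l) * xs (t - 1) l \<omega>) + es t k \<omega>"
proof -
  have "AE \<omega> in M. \<forall>t. \<forall>p\<in>{..<Q}. \<forall>i<N.
      X p t \<omega> $ i = (\<Sum>r<Q. ((Adj p r \<odot>\<^sub>H W p r) *\<^sub>v X r (t - 1) \<omega>) $ i) + eps p t \<omega> $ i"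
    unfolding AE_all_countable by (intro allI AE_finite_allI model) auto
  then show ?thesis using AE_space
  proof eventually_elim
    case (elim \<omega>)
    show ?case
    proof (intro allI impI)
      fix t k assume k: "k < N * Q"
      define p i where "p = k div N" and "i = k mod N"
      have pi: "p < Q" "i < N" "k = p * N + i" using div_mod_less[OF k] by (auto simp: p_def i_def)
      have "xs t k \<omega> = X p t \<omega> $ i" by (simp add: xs_def p_def i_def)
      also have "\<dots> = (\<Sum>r<Q. ((Adj p r \<odot>\<^sub>H W p r) *\<^sub>v X r (t - 1) \<omega>) $ i) + es t k \<omega>"
        using elim(1) pi by (auto simp: es_def p_def[symmetric] i_def[symmetric])
      also have "(\<Sum>r<Q. ((Adj p r \<odot>\<^sub>H W p r) *\<^sub>v X r (t - 1) \<omega>) $ i)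
          = (\<Sum>r<Q. \<Sum>j<N. coef $$ (k, r * N + j) * xs (t - 1) (r * N + j) \<omega>)"
      proof (rule sum.cong[OF refl])
        fix r assume "r \<in> {..<Q}"
        then have r: "r < Q" by simp
        have "X r (t - 1) \<omega> \<in> carrier_vec N" using X_random[OF r] elim(2) by (auto simp: random_vec_def)
        moreover have "Adj p r \<in> carrier_mat N N" using Adj_carrier pi r by auto
        ultimately have "((Adj p r \<odot>\<^sub>H W p r) *\<^sub>v X r (t - 1) \<omega>) $ i
            = (\<Sum>j<N. (Adj p r $$ (i, j) * W p r $$ (i, j)) * X r (t - 1) \<omega> $ j)"
          using pi by (auto simp: scalar_prod_def hadamard_def lessThan_atLeast0 intro!: sum.cong)
        also have "\<dots> = (\<Sum>j<N. coef $$ (k, r * N + j) * xs (t - 1) (r * N + j) \<omega>)"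
          using pi r by (intro sum.cong) (auto simp: coef_index xs_def)
        finally show "((Adj p r \<odot>\<^sub>H W p r) *\<^sub>v X r (t - 1) \<omega>) $ i
            = (\<Sum>j<N. coef $$ (k, r * N + j) * xs (t - 1) (r * N + j) \<omega>)" .
      qed
      also have "\<dots> = (\<Sum>l<N * Q. coef $$ (k, l) * xs (t - 1) l \<omega>)"
        using sum_blocks[of "\<lambda>l. coef $$ (k, l) * xs (t - 1) l \<omega>" Q N] by (simp add: mult.commute)
      finally show "xs t k \<omega> = (\<Sum>l<N * Q. coef $$ (k, l) * xs (t - 1) l \<omega>) + es t k \<omega>" .
    qed
  qed
qed

lemma es_bdd4: "k < N * Q \<Longrightarrow> bdd4 (\<lambda>t. es t k)"
proof -
  assume k: "k < N * Q"
  note pi = div_mod_less[OF k]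
  obtain c where c: "\<And>p t i. p < Q \<Longrightarrow> i < N \<Longrightarrow>
      integrable M (\<lambda>\<omega>. eps p t \<omega> $ i * eps p t \<omega> $ i * eps p t \<omega> $ i * eps p t \<omega> $ i) \<and>
      expectation (\<lambda>\<omega>. \<bar>eps p t \<omega> $ i * eps p t \<omega> $ i * eps p t \<omega> $ i * eps p t \<omega> $ i\<bar>) \<le> c"
    using eps_fourth_moments by blast
  have eq: "y * y * y * y = y ^ 4" for y :: real by (simp add: eval_nat_numeral)
  show ?thesis
    unfolding bdd4_def es_def using c[OF pi] eps_measurable[OF pi] unfolding eq by auto
qed

lemma es_cov:
  assumes kl: "k < N * Q" "l < N * Q"
  shows "expectation (\<lambda>\<omega>. es t k \<omega> * es t l \<omega>) = Om k l"
proof (cases "k div N = l div N")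
  case True
  have "Sig (k div N) $$ (k mod N, l mod N) = cross_moment M N (eps (k div N) t) (eps (k div N) t) $$ (k mod N, l mod N)"
    using eps_covariance[of "k div N" t] div_mod_less[OF kl(1)] by simp
  also have "\<dots> = expectation (\<lambda>\<omega>. es t k \<omega> * es t l \<omega>)"
    using True div_mod_less[OF kl(1)] div_mod_less[OF kl(2)] by (simp add: cross_moment_def es_def)
  finally show ?thesis using True by (simp add: Om_def)
next
  case False
  let ?p = "k div N" and ?r = "l div N"
  have ind: "indep_var (\<Pi>\<^sub>M j\<in>{(?p, t)}. \<Pi>\<^sub>M i\<in>{..<N}. borel) (\<lambda>\<omega>. \<lambda>j\<in>{(?p, t)}. (case j of (p, t) \<Rightarrow> \<lambda>\<omega>. coords N (eps p t \<omega>)) \<omega>)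
     (\<Pi>\<^sub>M j\<in>{(?r, t)}. \<Pi>\<^sub>M i\<in>{..<N}. borel) (\<lambda>\<omega>. \<lambda>j\<in>{(?r, t)}. (case j of (p, t) \<Rightarrow> \<lambda>\<omega>. coords N (eps p t \<omega>)) \<omega>)"
    using False div_mod_less[OF kl(1)] div_mod_less[OF kl(2)]
    by (intro indep_var_restrict[OF eps_independent]) auto
  have ms: "(\<lambda>z. z (p, t) i) \<in> borel_measurable (\<Pi>\<^sub>M j\<in>{(p, t)}. \<Pi>\<^sub>M i\<in>{..<N}. (borel :: real measure))"
    if "i < N" for p i
  proof -
    have 1: "(\<lambda>z. z (p, t)) \<in> measurable (\<Pi>\<^sub>M j\<in>{(p, t)}. \<Pi>\<^sub>M i\<in>{..<N}. (borel :: real measure)) (\<Pi>\<^sub>M i\<in>{..<N}. borel)"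
      by (intro measurable_component_singleton) auto
    have 2: "(\<lambda>y. y i) \<in> borel_measurable (\<Pi>\<^sub>M i\<in>{..<N}. (borel :: real measure))"
      using that by (intro measurable_component_singleton) auto
    show ?thesis by (rule measurable_compose[OF 1 2])
  qed
  have "indep_var borel ((\<lambda>z. z (?p, t) (k mod N)) \<circ> (\<lambda>\<omega>. \<lambda>j\<in>{(?p, t)}. (case j of (p, t) \<Rightarrow> \<lambda>\<omega>. coords N (eps p t \<omega>)) \<omega>))
      borel ((\<lambda>z. z (?r, t) (l mod N)) \<circ> (\<lambda>\<omega>. \<lambda>j\<in>{(?r, t)}. (case j of (p, t) \<Rightarrow> \<lambda>\<omega>. coords N (eps p t \<omega>)) \<omega>))"
    by (rule indep_var_compose[OF ind ms[OF div_mod_less(2)[OF kl(1)]] ms[OF div_mod_less(2)[OF kl(2)]]])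
  then have "indep_var borel (es t k) borel (es t l)"
    using N_pos by (simp add: comp_def coords_def es_def[abs_def])
  then have "expectation (\<lambda>\<omega>. es t k \<omega> * es t l \<omega>) = expectation (es t k) * expectation (es t l)"
    by (rule indep_var_lebesgue_integral) (auto intro!: L2_integrable bdd4_L2[OF es_bdd4] kl)
  also have "expectation (es t k) = 0"
    using eps_zero_mean[OF div_mod_less[OF kl(1)]] by (simp add: es_def[abs_def])
  finally show ?thesis using False by (simp add: Om_def)
qed

text \<open>The family indexed by features and times is grouped into the blocks of constant time;
  flattening a block into one stacked vector is a measurable map of that block.\<close>

lemma es_indep: "indep_vars (\<lambda>_. \<Pi>\<^sub>M l\<in>{..<N * Q}. borel) (\<lambda>t \<omega>. \<lambda>l\<in>{..<N * Q}. es t l \<omega>) UNIV"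
proof -
  let ?K = "\<lambda>t. {..<Q} \<times> {t}"
  let ?E = "\<lambda>j. case j of (p, t) \<Rightarrow> \<lambda>\<omega>. coords N (eps p t \<omega>)"
  have "indep_vars (\<lambda>t. \<Pi>\<^sub>M j\<in>?K t. \<Pi>\<^sub>M i\<in>{..<N}. borel) (\<lambda>t \<omega>. restrict (\<lambda>j. ?E j \<omega>) (?K t)) (UNIV :: int set)"
    by (rule indep_vars_restrict[OF eps_independent]) (auto simp: disjoint_family_on_def)
  then have "indep_vars (\<lambda>_. \<Pi>\<^sub>M l\<in>{..<N * Q}. borel)
     (\<lambda>t \<omega>. (\<lambda>z. \<lambda>l\<in>{..<N * Q}. z (l div N, t) (l mod N)) (restrict (\<lambda>j. ?E j \<omega>) (?K t))) (UNIV :: int set)"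
  proof (rule indep_vars_compose2)
    fix t :: int
    show "(\<lambda>z. \<lambda>l\<in>{..<N * Q}. z (l div N, t) (l mod N)) \<in>
        measurable (\<Pi>\<^sub>M j\<in>?K t. \<Pi>\<^sub>M i\<in>{..<N}. borel) (\<Pi>\<^sub>M l\<in>{..<N * Q}. (borel :: real measure))"
    proof (rule measurable_restrict)
      fix l assume "l \<in> {..<N * Q}"
      then have l: "l div N < Q" "l mod N < N" using div_mod_less by auto
      have 1: "(\<lambda>z. z (l div N, t)) \<in> measurable (\<Pi>\<^sub>M j\<in>?K t. \<Pi>\<^sub>M i\<in>{..<N}. (borel :: real measure)) (\<Pi>\<^sub>M i\<in>{..<N}. borel)"
        using l by (intro measurable_component_singleton) auto
      have 2: "(\<lambda>y. y (l mod N)) \<in> borel_measurable (\<Pi>\<^sub>M i\<in>{..<N}. (borel :: real measure))"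
        using l by (intro measurable_component_singleton) auto
      show "(\<lambda>z. z (l div N, t) (l mod N)) \<in> borel_measurable (\<Pi>\<^sub>M j\<in>?K t. \<Pi>\<^sub>M i\<in>{..<N}. (borel :: real measure))"
        by (rule measurable_compose[OF 1 2])
    qed
  qed
  moreover have "(\<lambda>l\<in>{..<N * Q}. restrict (\<lambda>j. ?E j \<omega>) (?K t) (l div N, t) (l mod N)) = (\<lambda>l\<in>{..<N * Q}. es t l \<omega>)" for t \<omega>
    using div_mod_less by (intro restrict_ext) (auto simp: coords_def es_def)
  ultimately show ?thesis by simp
qed

lemma xs_L2: "k < N * Q \<Longrightarrow> L2 (xs t k)"
  using X_measurable X_square_integrable div_mod_less by (auto simp: L2_def xs_def[abs_def])

lemma cross_moment_stacked:
  "cross_moment M (N * Q) (stacked N Q X t) (stacked N Q X t) = mat (N * Q) (N * Q) (\<lambda>(k, l). Gam k l)"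
proof -
  have "cross_moment M (N * Q) (stacked N Q X t) (stacked N Q X t)
      = cross_moment M (N * Q) (stacked N Q X 0) (stacked N Q X 0)"
    using X_stationary[of t 0 0] by simp
  then show ?thesis
    by (auto simp: cross_moment_def Gam_def stacked_def xs_def intro!: eq_matI)
qed

lemma xs_cov:
  assumes "k < N * Q" "l < N * Q"
  shows "expectation (\<lambda>\<omega>. xs t k \<omega> * xs t l \<omega>) = Gam k l"
proof -
  have "Gam k l = cross_moment M (N * Q) (stacked N Q X t) (stacked N Q X t) $$ (k, l)"
    unfolding cross_moment_stacked using assms by simp
  then show ?thesis using assms by (simp add: cross_moment_def stacked_def xs_def)
qed

text \<open>\<open>P\<close> becomes the sequence of matrix powers of the stacked coefficient
  matrix; its decay is the point where stability is used.\<close>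

sublocale V: stable_var M "N * Q" "\<lambda>i j. coef $$ (i, j)" "\<lambda>m i j. (coef ^\<^sub>m m) $$ (i, j)" xs es Gam Om
proof
  show "L2 (xs t l)" if "l < N * Q" for t l using that by (rule xs_L2)
  show "expectation (\<lambda>\<omega>. xs t k \<omega> * xs t l \<omega>) = Gam k l" if "k < N * Q" "l < N * Q" for t k l
    using that by (rule xs_cov)
  show "AE \<omega> in M. xs t l \<omega> = (\<Sum>k<N * Q. coef $$ (l, k) * xs (t - 1) k \<omega>) + es t l \<omega>" if "l < N * Q" for t l
    using var_step by eventually_elim (use that in blast)
  show "indep_vars (\<lambda>_. \<Pi>\<^sub>M l\<in>{..<N * Q}. borel) (\<lambda>t \<omega>. \<lambda>l\<in>{..<N * Q}. es t l \<omega>) UNIV"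
    by (rule es_indep)
  show "bdd4 (\<lambda>t. es t l)" if "l < N * Q" for l using that by (rule es_bdd4)
  show "expectation (es t l) = 0" if "l < N * Q" for t l
    using eps_zero_mean[OF div_mod_less[OF that]] by (simp add: es_def[abs_def])
  show "expectation (\<lambda>\<omega>. es t k \<omega> * es t l \<omega>) = Om k l" if "k < N * Q" "l < N * Q" for t k l
    using that by (rule es_cov)
  show "(coef ^\<^sub>m 0) $$ (l, k) = (if l = k then 1 else 0)" if "l < N * Q" "k < N * Q" for l k
    using that coef_carrier by simp
  show "(coef ^\<^sub>m Suc m) $$ (l, k) = (\<Sum>j<N * Q. (coef ^\<^sub>m m) $$ (l, j) * coef $$ (j, k))"
    if "l < N * Q" "k < N * Q" for m l k
    using that carrier_matD[OF coef_carrier] carrier_matD[OF pow_carrier_mat[OF coef_carrier, of m]]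
    by (simp add: scalar_prod_def lessThan_atLeast0)
  show "(\<lambda>m. (coef ^\<^sub>m m) $$ (l, k)) \<longlonglongrightarrow> 0" if "l < N * Q" "k < N * Q" for l k
    using that N_pos Q_pos stable by (intro pow_mat_tendsto_0[OF coef_carrier]) (auto simp: coef_def)
qed

section \<open>Positive definiteness of the covariances\<close>

lemma Sig_carrier: "p < Q \<Longrightarrow> Sig p \<in> carrier_mat N N"
  using eps_covariance[of p 0, symmetric] by (simp add: cross_moment_def)

lemma Sig_index: "p < Q \<Longrightarrow> i < N \<Longrightarrow> j < N \<Longrightarrow> Sig p $$ (i, j) = expectation (\<lambda>\<omega>. eps p 0 \<omega> $ i * eps p 0 \<omega> $ j)"
  using eps_covariance[of p 0, symmetric] by (simp add: cross_moment_def)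

lemma eps_L2: "p < Q \<Longrightarrow> i < N \<Longrightarrow> L2 (\<lambda>\<omega>. eps p t \<omega> $ i)"
  using bdd4_L2[OF es_bdd4[of "p * N + i"], of t] by (simp add: block_index es_def[abs_def])

text \<open>The form at \<open>w\<close> is the mean square of Z = w' eps. If it vanishes, Z = 0
  almost surely, so Sigma w = E(eps Z) = 0, and nonsingularity forces w = 0.\<close>

lemma Sig_pos_def:
  assumes p: "p < Q"
  shows "pos_def N (\<lambda>i j. Sig p $$ (i, j))"
proof -
  have "bil N (\<lambda>i j. Sig p $$ (i, j)) w w > 0" if "\<exists>i<N. w i \<noteq> 0" for w
  proof -
    define Z where "Z = (\<lambda>\<omega>. \<Sum>i<N. w i * eps p 0 \<omega> $ i)"
    have Z: "L2 Z" unfolding Z_def by (intro L2_sum L2_cmult eps_L2[OF p]) auto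
    have lin: "expectation (\<lambda>\<omega>. eps p 0 \<omega> $ i * Z \<omega>) = (\<Sum>j<N. Sig p $$ (i, j) * w j)" if i: "i < N" for i
    proof -
      have "has_bochner_integral M (\<lambda>\<omega>. \<Sum>j<N. w j * (eps p 0 \<omega> $ i * eps p 0 \<omega> $ j)) (\<Sum>j<N. w j * Sig p $$ (i, j))"
        using p i by (intro has_bochner_integral_sum has_bochner_integral_mult_right)
          (simp add: has_bochner_integral_iff Sig_index L2_mult_integrable eps_L2)
      then show ?thesis by (simp add: Z_def has_bochner_integral_iff sum_distrib_left mult_ac)
    qed
    have "expectation (\<lambda>\<omega>. (Z \<omega>)\<^sup>2) = expectation (\<lambda>\<omega>. \<Sum>i<N. w i * (eps p 0 \<omega> $ i * Z \<omega>))"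
      by (simp add: power2_eq_square Z_def sum_distrib_right sum_distrib_left mult_ac)
    also have "\<dots> = (\<Sum>i<N. w i * expectation (\<lambda>\<omega>. eps p 0 \<omega> $ i * Z \<omega>))"
      using p by (intro has_bochner_integral_integral_eq has_bochner_integral_sum has_bochner_integral_mult_right)
        (simp add: has_bochner_integral_iff L2_mult_integrable eps_L2 Z)
    also have "\<dots> = bil N (\<lambda>i j. Sig p $$ (i, j)) w w"
      unfolding bil_def by (intro sum.cong refl) (subst lin, simp, simp add: sum_distrib_left mult_ac)
    finally have eq: "bil N (\<lambda>i j. Sig p $$ (i, j)) w w = expectation (\<lambda>\<omega>. (Z \<omega>)\<^sup>2)" ..
    have "expectation (\<lambda>\<omega>. (Z \<omega>)\<^sup>2) \<noteq> 0"
    proof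
      assume "expectation (\<lambda>\<omega>. (Z \<omega>)\<^sup>2) = 0"
      then have "AE \<omega> in M. (Z \<omega>)\<^sup>2 = 0"
        using Z by (subst (asm) integral_nonneg_eq_0_iff_AE) (auto simp: L2_def)
      then have "expectation (\<lambda>\<omega>. eps p 0 \<omega> $ i * Z \<omega>) = 0" for i
        by (intro integral_eq_zero_AE) auto
      then have "Sig p *\<^sub>v vec N w = 0\<^sub>v N"
        using Sig_carrier[OF p] lin by (intro eq_vecI) (auto simp: scalar_prod_def lessThan_atLeast0)
      moreover obtain B where B: "B * Sig p = 1\<^sub>m (dim_row B)" "Sig p * B = 1\<^sub>m (dim_row (Sig p))"
        using Sig_nonsingular[OF p] by (auto simp: invertible_mat_def inverts_mat_def)
      moreover have BN: "B \<in> carrier_mat N N"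
        using arg_cong[OF B(1), of dim_col] arg_cong[OF B(2), of dim_col] Sig_carrier[OF p] by auto
      ultimately have "(B * Sig p) *\<^sub>v vec N w = B *\<^sub>v 0\<^sub>v N"
        using assoc_mult_mat_vec[OF BN Sig_carrier[OF p], of "vec N w"] by simp
      also have "B *\<^sub>v 0\<^sub>v N = 0\<^sub>v N" using BN by (intro eq_vecI) auto
      also have "B * Sig p = 1\<^sub>m N" using B(1) BN by simp
      finally have "vec N w = 0\<^sub>v N" by simp
      then have "w i = 0" if "i < N" for i using that by (metis index_vec index_zero_vec(1))
      then show False using \<open>\<exists>i<N. w i \<noteq> 0\<close> by auto
    qed
    moreover have "expectation (\<lambda>\<omega>. (Z \<omega>)\<^sup>2) \<ge> 0" by (auto intro: integral_nonneg_AE)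
    ultimately show ?thesis unfolding eq by linarith
  qed
  then show ?thesis using p by (auto simp: pos_def_def Sig_index mult.commute)
qed

text \<open>\<open>Gam\<close> dominates \<open>Om\<close>, which is block diagonal with positive
  definite blocks: a nonzero vector has a nonzero block, and the other blocks contribute
  nonnegatively.\<close>

lemma Gam_pos_def: "pos_def (N * Q) Gam"
proof -
  have "bil (N * Q) Gam w w > 0" if w: "\<exists>k<N * Q. w k \<noteq> 0" for w
  proof -
    have "bil (N * Q) Om w w = (\<Sum>p<Q. bil N (\<lambda>i j. Sig p $$ (i, j)) (\<lambda>i. w (p * N + i)) (\<lambda>i. w (p * N + i)))"
    proof -
      have "bil (N * Q) Om w w = (\<Sum>p<Q. \<Sum>i<N. \<Sum>r<Q. \<Sum>j<N. Om (p * N + i) (r * N + j) * w (p * N + i) * w (r * N + j))"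
        unfolding bil_def mult.commute[of N Q] sum_blocks ..
      also have "\<dots> = (\<Sum>p<Q. \<Sum>i<N. \<Sum>r<Q. if p = r then \<Sum>j<N. Sig p $$ (i, j) * w (p * N + i) * w (p * N + j) else 0)"
        by (intro sum.cong refl) (auto simp: Om_def block_index)
      also have "\<dots> = (\<Sum>p<Q. bil N (\<lambda>i j. Sig p $$ (i, j)) (\<lambda>i. w (p * N + i)) (\<lambda>i. w (p * N + i)))"
        unfolding bil_def by simp
      finally show ?thesis .
    qed
    also have "\<dots> > 0"
    proof -
      obtain k where k: "k < N * Q" "w k \<noteq> 0" using w by auto
      have nonneg: "bil N (\<lambda>i j. Sig p $$ (i, j)) v v \<ge> 0" if "p < Q" for p v
      proof (cases "\<exists>i<N. v i \<noteq> 0")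
        case True
        then show ?thesis using Sig_pos_def[OF that] by (auto simp: pos_def_def intro: less_imp_le)
      next
        case False
        then show ?thesis by (simp add: bil_def)
      qed
      have "bil N (\<lambda>i j. Sig (k div N) $$ (i, j)) (\<lambda>i. w (k div N * N + i)) (\<lambda>i. w (k div N * N + i)) > 0"
        using Sig_pos_def[OF div_mod_less(1)[OF k(1)]] div_mod_less(2)[OF k(1)] k(2)
        unfolding pos_def_def by (metis div_mult_mod_eq)
      then show ?thesis
        using nonneg div_mod_less(1)[OF k(1)] by (intro sum_pos2[of _ "k div N"]) auto
    qed
    finally have "bil (N * Q) Om w w > 0" .
    also have "bil (N * Q) Om w w \<le> bil (N * Q) Gam w w"
      unfolding bil_def by (rule V.Gam_ge_Om)
    finally show ?thesis .
  qed
  moreover have "Gam k l = Gam l k" for k l by (simp add: Gam_def mult.commute)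
  ultimately show ?thesis by (auto simp: pos_def_def)
qed

end

section \<open>Slutsky's argument\<close>

context prob_space
begin

lemma markov_abs:
  fixes f :: "'a \<Rightarrow> real"
  assumes f: "integrable M f" and c: "c > 0"
  shows "prob {\<omega> \<in> space M. \<bar>f \<omega>\<bar> \<ge> c} \<le> expectation (\<lambda>\<omega>. \<bar>f \<omega>\<bar>) / c"
  using integral_Markov_inequality_measure[where M = M and u = "\<lambda>\<omega>. \<bar>f \<omega>\<bar>" and A = "{}" and c = c] f c
  by simp

text \<open>
  Slutsky's argument at the level of characteristic functions: replacing \<open>inv_mat (Hn T)\<close> by its
  limit changes them by at most \<open>2 P (bad T r) + r U c\<close> for every \<open>r > 0\<close>.
\<close>

lemma
  fixes w :: "nat \<Rightarrow> nat \<Rightarrow> 'a \<Rightarrow> real" and Hn :: "nat \<Rightarrow> 'a \<Rightarrow> real mat"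
  assumes H: "H \<in> carrier_mat n n" and pd: "pos_def n (\<lambda>i j. H $$ (i, j))"
    and Hn: "\<And>T \<omega>. Hn T \<omega> \<in> carrier_mat n n"
    and Hn_int: "\<And>T i j. i < n \<Longrightarrow> j < n \<Longrightarrow> integrable M (\<lambda>\<omega>. Hn T \<omega> $$ (i, j))"
    and Hn_lim: "\<And>i j. i < n \<Longrightarrow> j < n \<Longrightarrow> (\<lambda>T. expectation (\<lambda>\<omega>. \<bar>Hn T \<omega> $$ (i, j) - H $$ (i, j)\<bar>)) \<longlonglongrightarrow> 0"
    and w_int: "\<And>T a. a < n \<Longrightarrow> integrable M (w T a)"
    and w_bound: "\<And>T a. a < n \<Longrightarrow> expectation (\<lambda>\<omega>. \<bar>w T a \<omega>\<bar>) \<le> C"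
    and w_char: "\<And>z. (\<lambda>T. \<integral>\<omega>. iexp (\<Sum>a<n. z a * w T a \<omega>) \<partial>M) \<longlonglongrightarrow> exp (- bil n (\<lambda>i j. H $$ (i, j)) z z / 2)"
    and rv: "\<And>T. random_vec M n (Z T)"
    and Z: "\<And>T. T > 0 \<Longrightarrow> AE \<omega> in M. \<forall>j<n. Z T \<omega> $ j = (\<Sum>a<n. inv_mat (Hn T \<omega>) $$ (j, a) * w T a \<omega>)"
  shows slutsky_tight: "\<And>e. e > 0 \<Longrightarrow> \<exists>k>0. \<forall>\<^sub>F T in sequentially. prob {\<omega> \<in> space M. \<exists>i<n. \<bar>Z T \<omega> $ i\<bar> > k} < e"
    and slutsky_tends_to_in_dist: "tends_to_in_dist M n Z (multivariate_normal n (0\<^sub>v n) (inv_mat H))"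
proof -
  have matH: "mat n n (\<lambda>(i, j). H $$ (i, j)) = H" using H by (intro eq_matI) auto
  have det: "det H \<noteq> 0" using det_pos_def[OF pd] unfolding matH by simp
  define J where "J = inv_mat H"
  have J: "J \<in> carrier_mat n n" unfolding J_def by (rule inv_mat_carrier[OF H])
  define bad where "bad = (\<lambda>T r. {\<omega> \<in> space M. \<not> (\<forall>i<n. \<forall>j<n. \<bar>inv_mat (Hn T \<omega>) $$ (i, j) - J $$ (i, j)\<bar> < r)})"
  have inv_meas[measurable]: "(\<lambda>\<omega>. inv_mat (Hn T \<omega>) $$ (i, j)) \<in> borel_measurable M" if "i < n" "j < n" for T i j
    using Hn_int that by (intro borel_measurable_inv_mat[OF Hn]) auto
  have w_meas[measurable]: "w T a \<in> borel_measurable M" if "a < n" for T a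
    using w_int[OF that] by simp
  have Z_meas[measurable]: "(\<lambda>\<omega>. Z T \<omega> $ j) \<in> borel_measurable M" if "j < n" for T j
    using rv that by (auto simp: random_vec_def)
  have bad_events[measurable]: "bad T r \<in> events" for T r unfolding bad_def by measurable
  \<comment> \<open>Continuity of inversion at \<open>H\<close> converts the event into a deviation
    of some entry of \<open>Hn\<close> by at least \<delta>; a union bound and Markov's inequality
    finish.\<close>
  have bad_lim: "(\<lambda>T. prob (bad T r)) \<longlonglongrightarrow> 0" if r: "r > 0" for r
  proof -
    obtain \<delta> where \<delta>: "\<delta> > 0" "\<And>A. A \<in> carrier_mat n n \<Longrightarrow> (\<forall>i<n. \<forall>j<n. \<bar>A $$ (i, j) - H $$ (i, j)\<bar> < \<delta>) \<Longrightarrow>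
        (\<forall>i<n. \<forall>j<n. \<bar>inv_mat A $$ (i, j) - J $$ (i, j)\<bar> < r)"
      using inv_mat_continuous[OF H det r] unfolding J_def by blast
    let ?E = "\<lambda>T i j. {\<omega> \<in> space M. \<bar>Hn T \<omega> $$ (i, j) - H $$ (i, j)\<bar> \<ge> \<delta>}"
    have E_events: "?E T i j \<in> events" if "i < n" "j < n" for T i j
    proof -
      have [measurable]: "(\<lambda>\<omega>. Hn T \<omega> $$ (i, j)) \<in> borel_measurable M" using Hn_int[OF that] by simp
      show ?thesis by measurable
    qed
    have le: "prob (bad T r) \<le> (\<Sum>i<n. \<Sum>j<n. expectation (\<lambda>\<omega>. \<bar>Hn T \<omega> $$ (i, j) - H $$ (i, j)\<bar>) / \<delta>)" for T
    proof -
      have "prob (bad T r) \<le> prob (\<Union>i\<in>{..<n}. \<Union>j\<in>{..<n}. ?E T i j)"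
      proof (rule finite_measure_mono)
        show "bad T r \<subseteq> (\<Union>i\<in>{..<n}. \<Union>j\<in>{..<n}. ?E T i j)"
        proof
          fix \<omega> assume \<omega>: "\<omega> \<in> bad T r"
          then have "\<not> (\<forall>i<n. \<forall>j<n. \<bar>Hn T \<omega> $$ (i, j) - H $$ (i, j)\<bar> < \<delta>)"
            using \<delta>(2)[OF Hn] unfolding bad_def by blast
          then show "\<omega> \<in> (\<Union>i\<in>{..<n}. \<Union>j\<in>{..<n}. ?E T i j)"
            using \<omega> by (auto simp: bad_def not_less)
        qed
        show "(\<Union>i\<in>{..<n}. \<Union>j\<in>{..<n}. ?E T i j) \<in> events"
          using E_events by (intro sets.finite_UN) auto
      qed
      also have "\<dots> \<le> (\<Sum>i<n. prob (\<Union>j\<in>{..<n}. ?E T i j))"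
        using E_events by (intro finite_measure_subadditive_finite) (auto intro!: sets.finite_UN)
      also have "\<dots> \<le> (\<Sum>i<n. \<Sum>j<n. prob (?E T i j))"
        using E_events by (intro sum_mono finite_measure_subadditive_finite) auto
      also have "\<dots> \<le> (\<Sum>i<n. \<Sum>j<n. expectation (\<lambda>\<omega>. \<bar>Hn T \<omega> $$ (i, j) - H $$ (i, j)\<bar>) / \<delta>)"
        using Hn_int \<delta>(1) by (intro sum_mono markov_abs) auto
      finally show ?thesis .
    qed
    have ev: "\<forall>\<^sub>F T in sequentially. norm (prob (bad T r)) \<le>
        (\<Sum>i<n. \<Sum>j<n. expectation (\<lambda>\<omega>. \<bar>Hn T \<omega> $$ (i, j) - H $$ (i, j)\<bar>) / \<delta>)"
      by (intro always_eventually allI) (use le in simp)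
    have "(\<lambda>T. \<Sum>i<n. \<Sum>j<n. expectation (\<lambda>\<omega>. \<bar>Hn T \<omega> $$ (i, j) - H $$ (i, j)\<bar>) / \<delta>) \<longlonglongrightarrow> (\<Sum>i<n. \<Sum>j<n. 0 / \<delta>)"
      using \<delta>(1) by (intro tendsto_sum tendsto_divide tendsto_const Hn_lim) auto
    then show ?thesis by (intro Lim_null_comparison[OF ev]) simp
  qed
  define s where "s = (\<lambda>T \<omega>. \<Sum>a<n. \<bar>w T a \<omega>\<bar>)"
  have s_int: "integrable M (s T)" for T
    unfolding s_def by (intro Bochner_Integration.integrable_sum integrable_abs w_int) auto
  define c where "c = n * C"
  have s_bound: "expectation (s T) \<le> c" for T
  proof -
    have "expectation (s T) = (\<Sum>a<n. expectation (\<lambda>\<omega>. \<bar>w T a \<omega>\<bar>))"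
      unfolding s_def by (intro Bochner_Integration.integral_sum integrable_abs w_int) auto
    also have "\<dots> \<le> (\<Sum>a<n. C)" by (intro sum_mono w_bound) auto
    finally show ?thesis by (simp add: c_def)
  qed
  have s_nonneg: "s T \<omega> \<ge> 0" for T \<omega> unfolding s_def by (intro sum_nonneg) auto
  have "expectation (s 0) \<ge> 0" using s_nonneg by (intro integral_nonneg_AE) auto
  then have c0: "c \<ge> 0" using s_bound[of 0] by linarith
  define h where "h = (\<Sum>i<n. \<Sum>a<n. \<bar>J $$ (i, a)\<bar>)"
  have h0: "h \<ge> 0" unfolding h_def by (intro sum_nonneg) auto
  have h: "\<bar>J $$ (i, a)\<bar> \<le> h" if "i < n" "a < n" for i a
  proof -
    have "\<bar>J $$ (i, a)\<bar> \<le> (\<Sum>a<n. \<bar>J $$ (i, a)\<bar>)" using that by (intro member_le_sum) auto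
    also have "\<dots> \<le> h" unfolding h_def using that by (intro member_le_sum[of i "{..<n}" "\<lambda>i. \<Sum>a<n. \<bar>J $$ (i, a)\<bar>"]) (auto intro: sum_nonneg)
    finally show ?thesis .
  qed
  show tight: "\<exists>k>0. \<forall>\<^sub>F T in sequentially. prob {\<omega> \<in> space M. \<exists>i<n. \<bar>Z T \<omega> $ i\<bar> > k} < e" if e: "e > 0" for e
  proof (intro exI conjI)
    \<comment> \<open>Off \<open>bad T 1\<close> the entries of the inverse are at most h + 1, so
      \<open>k\<close> is exceeded only if \<open>s T\<close> reaches k / (h + 1) = 2(c + 1) / e,
      which by Markov has probability at most e/2. The shift to c + 1 guards against c = 0.\<close>
    define k where "k = 2 * (c + 1) * (h + 1) / e"
    show k: "k > 0" unfolding k_def using c0 h0 e by auto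
    have "\<forall>\<^sub>F T in sequentially. prob (bad T 1) < e / 2"
      using e by (intro order_tendstoD(2)[OF bad_lim]) auto
    then show "\<forall>\<^sub>F T in sequentially. prob {\<omega> \<in> space M. \<exists>i<n. \<bar>Z T \<omega> $ i\<bar> > k} < e"
      using eventually_gt_at_top[of "0 :: nat"]
    proof eventually_elim
      case (elim T)
      let ?S = "{\<omega> \<in> space M. \<bar>s T \<omega>\<bar> \<ge> k / (h + 1)}"
      have S_events: "?S \<in> events" unfolding s_def by measurable
      have "prob {\<omega> \<in> space M. \<exists>i<n. \<bar>Z T \<omega> $ i\<bar> > k} \<le> prob (bad T 1 \<union> ?S)"
      proof (rule finite_measure_mono_AE)
        show "AE \<omega> in M. \<omega> \<in> {\<omega> \<in> space M. \<exists>i<n. \<bar>Z T \<omega> $ i\<bar> > k} \<longrightarrow> \<omega> \<in> bad T 1 \<union> ?S"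
          using Z[OF elim(2)]
        proof eventually_elim
          case (elim \<omega>)
          show ?case
          proof (rule impI, rule ccontr)
            assume \<omega>: "\<omega> \<in> {\<omega> \<in> space M. \<exists>i<n. \<bar>Z T \<omega> $ i\<bar> > k}" "\<omega> \<notin> bad T 1 \<union> ?S"
            then obtain i where i: "i < n" "\<bar>Z T \<omega> $ i\<bar> > k" and sp: "\<omega> \<in> space M" by auto
            have good: "\<bar>inv_mat (Hn T \<omega>) $$ (i, a) - J $$ (i, a)\<bar> < 1" if "a < n" for a
              using \<omega>(2) sp that i unfolding bad_def by blast
            have sk: "s T \<omega> < k / (h + 1)" using \<omega>(2) sp s_nonneg[of T \<omega>] by auto
            have "\<bar>Z T \<omega> $ i\<bar> \<le> (\<Sum>a<n. \<bar>inv_mat (Hn T \<omega>) $$ (i, a) * w T a \<omega>\<bar>)"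
              using elim i by (simp add: sum_abs)
            also have "\<dots> \<le> (\<Sum>a<n. (h + 1) * \<bar>w T a \<omega>\<bar>)"
            proof (rule sum_mono)
              fix a assume "a \<in> {..<n}"
              then have "\<bar>inv_mat (Hn T \<omega>) $$ (i, a)\<bar> \<le> h + 1"
                using good[of a] h[OF i(1), of a] by auto
              then show "\<bar>inv_mat (Hn T \<omega>) $$ (i, a) * w T a \<omega>\<bar> \<le> (h + 1) * \<bar>w T a \<omega>\<bar>"
                unfolding abs_mult by (rule mult_right_mono) simp
            qed
            also have "\<dots> = (h + 1) * s T \<omega>" by (simp add: s_def sum_distrib_left)
            also have "\<dots> < (h + 1) * (k / (h + 1))" using sk h0 by (intro mult_strict_left_mono) auto
            finally show False using i(2) h0 by simp
          qed
        qed
        show "bad T 1 \<union> ?S \<in> events" using S_events by auto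
      qed
      also have "\<dots> \<le> prob (bad T 1) + prob ?S"
        using S_events by (intro measure_Un_le) auto
      also have "prob ?S \<le> expectation (\<lambda>\<omega>. \<bar>s T \<omega>\<bar>) / (k / (h + 1))"
        using k h0 by (intro markov_abs s_int) auto
      also have "\<dots> \<le> c / (k / (h + 1))"
        using s_bound[of T] s_nonneg k h0 by (intro divide_right_mono) auto
      also have "\<dots> = e / 2 * (c / (c + 1))"
      proof -
        have "k / (h + 1) = 2 * (c + 1) / e" using h0 by (simp add: k_def)
        then show ?thesis by simp
      qed
      also have "\<dots> \<le> e / 2 * 1"
        using e c0 by (intro mult_left_mono) auto
      finally show ?case using elim(1) by simp
    qed
  qed
  note L = inv_mat_inv_mat[OF H det]
  have pdJ: "prob_space (multivariate_normal n (0\<^sub>v n) J)"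
    "sets (multivariate_normal n (0\<^sub>v n) J) = sets (\<Pi>\<^sub>M i\<in>{..<n}. (borel :: real measure))"
    unfolding J_def by (rule prob_space_multivariate_normal[OF H pd L] sets_multivariate_normal[OF H pd L])+
  have "tends_to_in_dist M n Z (multivariate_normal n (0\<^sub>v n) J)"
  proof (rule tends_to_in_distI[OF rv pdJ _ tight])
    fix u :: "nat \<Rightarrow> real"
    \<comment> \<open>The frequency dual to \<open>u\<close>: since H z = u, the limiting
      characteristic function of \<open>w\<close> at \<open>z\<close> is that of the normal law at
      \<open>u\<close>.\<close>
    define z where "z = (\<lambda>a. \<Sum>j<n. J $$ (j, a) * u j)"
    have "H\<^sup>T = H" using H pd by (intro eq_matI) (auto simp: pos_def_def)
    from inv_mat_symmetric[OF H det this] have JT: "J\<^sup>T = J" by (simp add: J_def)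
    have symJ: "J $$ (j, a) = J $$ (a, j)" if "j < n" "a < n" for j a
      using arg_cong[OF JT, of "\<lambda>A. A $$ (a, j)"] J that by simp
    have Hz: "(\<Sum>a<n. H $$ (i, a) * z a) = u i" if i: "i < n" for i
    proof -
      have "(\<Sum>a<n. H $$ (i, a) * z a) = (\<Sum>j<n. (\<Sum>a<n. H $$ (i, a) * J $$ (a, j)) * u j)"
        unfolding z_def sum_distrib_left sum_distrib_right
        by (subst sum.swap) (auto intro!: sum.cong simp: symJ mult_ac)
      also have "\<dots> = (\<Sum>j<n. (H * J) $$ (i, j) * u j)"
        using H J i by (intro sum.cong) (auto simp: scalar_prod_def lessThan_atLeast0)
      also have "H * J = 1\<^sub>m n" unfolding J_def by (rule inv_mat_mult(1)[OF H det])
      also have "(\<Sum>j<n. 1\<^sub>m n $$ (i, j) * u j) = (\<Sum>j<n. if j = i then u j else 0)"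
        using i by (intro sum.cong) auto
      finally show ?thesis using i by simp
    qed
    have target: "(\<integral>x. iexp (\<Sum>i<n. u i * x i) \<partial>multivariate_normal n (0\<^sub>v n) J)
        = exp (- bil n (\<lambda>i j. H $$ (i, j)) z z / 2)"
      using char_multivariate_normal[OF H pd L, of z] unfolding J_def[symmetric] by (simp add: Hz)
    have zw: "(\<Sum>a<n. z a * w T a \<omega>) = (\<Sum>j<n. u j * (\<Sum>a<n. J $$ (j, a) * w T a \<omega>))" for T \<omega>
      unfolding z_def sum_distrib_left sum_distrib_right by (subst sum.swap) (simp add: mult_ac)
    define U where "U = (\<Sum>j<n. \<bar>u j\<bar>)"
    have U0: "U \<ge> 0" unfolding U_def by (intro sum_nonneg) auto
    have i1: "integrable M (\<lambda>\<omega>. iexp (\<Sum>i<n. u i * Z T \<omega> $ i))" for T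
      by (rule integrable_const_bound[where B=1]) auto
    have i2: "integrable M (\<lambda>\<omega>. iexp (\<Sum>a<n. z a * w T a \<omega>))" for T
      by (rule integrable_const_bound[where B=1]) auto
    \<comment> \<open>On \<open>bad\<close> two numbers of modulus 1 differ by at most 2; off it the
      exponents differ by at most \<open>r * U * s T\<close>, and the exponential is
      1-Lipschitz.\<close>
    have close: "cmod ((\<integral>\<omega>. iexp (\<Sum>i<n. u i * Z T \<omega> $ i) \<partial>M) - (\<integral>\<omega>. iexp (\<Sum>a<n. z a * w T a \<omega>) \<partial>M))
        \<le> 2 * prob (bad T r) + r * U * c" if T: "T > 0" and r: "r > 0" for T r
    proof -
      have ib: "integrable M (\<lambda>\<omega>. 2 * indicator (bad T r) \<omega> :: real)"
        by (intro integrable_mult_right integrable_real_indicator) (auto simp: less_top[symmetric])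
      have isU: "integrable M (\<lambda>\<omega>. r * U * s T \<omega>)" using s_int by (intro integrable_mult_right)
      have "cmod ((\<integral>\<omega>. iexp (\<Sum>i<n. u i * Z T \<omega> $ i) \<partial>M) - (\<integral>\<omega>. iexp (\<Sum>a<n. z a * w T a \<omega>) \<partial>M))
          = cmod (\<integral>\<omega>. iexp (\<Sum>i<n. u i * Z T \<omega> $ i) - iexp (\<Sum>a<n. z a * w T a \<omega>) \<partial>M)"
        by (subst Bochner_Integration.integral_diff[OF i1 i2]) simp
      also have "\<dots> \<le> (\<integral>\<omega>. cmod (iexp (\<Sum>i<n. u i * Z T \<omega> $ i) - iexp (\<Sum>a<n. z a * w T a \<omega>)) \<partial>M)"
        by (rule integral_norm_bound)
      also have "\<dots> \<le> (\<integral>\<omega>. 2 * indicator (bad T r) \<omega> + r * U * s T \<omega> \<partial>M)"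
      proof (rule integral_mono_AE)
        show "integrable M (\<lambda>\<omega>. cmod (iexp (\<Sum>i<n. u i * Z T \<omega> $ i) - iexp (\<Sum>a<n. z a * w T a \<omega>)))"
          by (intro integrable_norm Bochner_Integration.integrable_diff i1 i2)
        show "integrable M (\<lambda>\<omega>. 2 * indicator (bad T r) \<omega> + r * U * s T \<omega>)"
          by (rule Bochner_Integration.integrable_add[OF ib isU])
        show "AE \<omega> in M. cmod (iexp (\<Sum>i<n. u i * Z T \<omega> $ i) - iexp (\<Sum>a<n. z a * w T a \<omega>))
            \<le> 2 * indicator (bad T r) \<omega> + r * U * s T \<omega>"
          using Z[OF T] AE_space
        proof eventually_elim
          case (elim \<omega>)
          have rUs: "r * U * s T \<omega> \<ge> 0" using r U0 s_nonneg by auto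
          show ?case
          proof (cases "\<omega> \<in> bad T r")
            case True
            have "cmod (iexp (\<Sum>i<n. u i * Z T \<omega> $ i) - iexp (\<Sum>a<n. z a * w T a \<omega>)) \<le> 1 + 1"
              by (rule order_trans[OF norm_triangle_ineq4]) simp
            then show ?thesis using True rUs by simp
          next
            case False
            have good: "\<bar>inv_mat (Hn T \<omega>) $$ (i, a) - J $$ (i, a)\<bar> \<le> r" if "i < n" "a < n" for i a
              using False elim(2) that unfolding bad_def by (auto intro: less_imp_le)
            have "cmod (iexp (\<Sum>i<n. u i * Z T \<omega> $ i) - iexp (\<Sum>a<n. z a * w T a \<omega>))
                \<le> \<bar>(\<Sum>i<n. u i * Z T \<omega> $ i) - (\<Sum>a<n. z a * w T a \<omega>)\<bar>"
              by (rule iexp_diff_le)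
            also have "(\<Sum>i<n. u i * Z T \<omega> $ i) - (\<Sum>a<n. z a * w T a \<omega>)
                = (\<Sum>i<n. u i * (\<Sum>a<n. (inv_mat (Hn T \<omega>) $$ (i, a) - J $$ (i, a)) * w T a \<omega>))"
              unfolding zw using elim(1) by (simp add: left_diff_distrib sum_subtractf right_diff_distrib)
            also have "\<bar>\<dots>\<bar> \<le> (\<Sum>i<n. \<bar>u i\<bar> * (r * s T \<omega>))"
            proof (intro order_trans[OF sum_abs] sum_mono)
              fix i assume "i \<in> {..<n}"
              then have i: "i < n" by simp
              have "\<bar>\<Sum>a<n. (inv_mat (Hn T \<omega>) $$ (i, a) - J $$ (i, a)) * w T a \<omega>\<bar>
                  \<le> (\<Sum>a<n. r * \<bar>w T a \<omega>\<bar>)"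
                unfolding abs_mult using good[OF i]
                by (intro order_trans[OF sum_abs] sum_mono) (auto simp: abs_mult intro: mult_right_mono)
              also have "\<dots> = r * s T \<omega>" by (simp add: s_def sum_distrib_left)
              finally show "\<bar>u i * (\<Sum>a<n. (inv_mat (Hn T \<omega>) $$ (i, a) - J $$ (i, a)) * w T a \<omega>)\<bar> \<le> \<bar>u i\<bar> * (r * s T \<omega>)"
                unfolding abs_mult by (rule mult_left_mono) simp
            qed
            also have "\<dots> = r * U * s T \<omega>" by (simp add: U_def sum_distrib_left sum_distrib_right mult_ac)
            finally show ?thesis using False by simp
          qed
        qed
      qed
      also have "\<dots> = 2 * prob (bad T r) + r * U * expectation (s T)"
        using Bochner_Integration.integral_add[OF ib isU] by simp
      also have "\<dots> \<le> 2 * prob (bad T r) + r * U * c"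
        using s_bound[of T] r U0 by (intro add_left_mono mult_left_mono) auto
      finally show ?thesis .
    qed
    have "(\<lambda>T. (\<integral>\<omega>. iexp (\<Sum>i<n. u i * Z T \<omega> $ i) \<partial>M) - (\<integral>\<omega>. iexp (\<Sum>a<n. z a * w T a \<omega>) \<partial>M)) \<longlonglongrightarrow> 0"
    proof (rule tendstoI)
      fix e :: real assume e: "e > 0"
      \<comment> \<open>Chosen so that \<open>r * U * c\<close> is at most e/2; the remaining e/2
        covers twice the probability of \<open>bad\<close>.\<close>
      define r where "r = e / (2 * (U * c + 1))"
      have Uc: "U * c \<ge> 0" using U0 c0 by simp
      have r: "r > 0" unfolding r_def using e Uc by (auto intro!: divide_pos_pos)
      have rU: "r * U * c \<le> e / 2"
      proof -
        have "r * U * c = e / 2 * (U * c / (U * c + 1))" unfolding r_def using Uc by (simp add: field_simps)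
        also have "\<dots> \<le> e / 2 * 1" using e Uc by (intro mult_left_mono) auto
        finally show ?thesis by simp
      qed
      have "\<forall>\<^sub>F T in sequentially. prob (bad T r) < e / 4"
        using e by (intro order_tendstoD(2)[OF bad_lim[OF r]]) auto
      then show "\<forall>\<^sub>F T in sequentially.
          dist ((\<integral>\<omega>. iexp (\<Sum>i<n. u i * Z T \<omega> $ i) \<partial>M) - (\<integral>\<omega>. iexp (\<Sum>a<n. z a * w T a \<omega>) \<partial>M)) 0 < e"
        using eventually_gt_at_top[of "0 :: nat"]
      proof eventually_elim
        case (elim T)
        show ?case using close[OF elim(2) r] elim(1) rU unfolding dist_norm by simp
      qed
    qed
    from tendsto_add[OF this w_char[of z]]
    show "(\<lambda>T. \<integral>\<omega>. iexp (\<Sum>i<n. u i * Z T \<omega> $ i) \<partial>M) \<longlonglongrightarrow> (\<integral>x. iexp (\<Sum>i<n. u i * x i) \<partial>multivariate_normal n (0\<^sub>v n) J)"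
      unfolding target by simp
  qed
  then show "tends_to_in_dist M n Z (multivariate_normal n (0\<^sub>v n) (inv_mat H))" unfolding J_def .
qed

end

section \<open>Restriction matrices and Kronecker products\<close>

lemma length_filter_upt: "length (filter p [0..<L]) = card {k. k < L \<and> p k}"
  unfolding length_filter_conv_card by (auto intro!: arg_cong[where f = card])

text \<open>The number of smaller indices satisfying \<open>p\<close> is the position of
  \<open>i\<close> in the filtered list. This links the restriction matrix, defined by partial sums,
  to the restricted parameters, defined by filtering.\<close>

lemma filter_upt_nth_card:
  assumes "i < L" "p i"
  shows "filter p [0..<L] ! card {k. k < i \<and> p k} = i"
proof -
  have "[0..<L] = [0..<i] @ i # [Suc i..<L]"
    using assms(1) upt_add_eq_append[of 0 i "L - i"] upt_conv_Cons[of i L] by simp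
  then have "filter p [0..<L] = filter p [0..<i] @ i # filter p [Suc i..<L]" using assms(2) by simp
  then show ?thesis by (simp add: nth_append length_filter_upt)
qed

lemma card_below_less:
  fixes i L :: nat
  assumes "i < L" "p i"
  shows "card {k. k < i \<and> p k} < card {k. k < L \<and> p k}"
proof (rule psubset_card_mono)
  have "{k. k < i \<and> p k} \<subseteq> {k. k < L \<and> p k}" "i \<in> {k. k < L \<and> p k}" "i \<notin> {k. k < i \<and> p k}"
    using assms by auto
  then show "{k. k < i \<and> p k} \<subset> {k. k < L \<and> p k}" by blast
qed simp

lemma ex_card_below:
  assumes "j < card {k :: nat. k < L \<and> p k}"
  shows "\<exists>i<L. p i \<and> card {k. k < i \<and> p k} = j"
proof -
  let ?f = "filter p [0..<L]"
  have j: "j < length ?f" using assms by (simp add: length_filter_upt)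
  define i where "i = ?f ! j"
  have i: "i < L" "p i" using nth_mem[OF j] by (auto simp: i_def)
  have "?f ! card {k. k < i \<and> p k} = ?f ! j" using filter_upt_nth_card[of i L p] i by (simp add: i_def)
  then have "card {k. k < i \<and> p k} = j"
    using card_below_less[of i L p] i j nth_eq_iff_index_eq[of ?f] by (simp add: length_filter_upt)
  then show ?thesis using i by blast
qed

lemma vectorise_index:
  assumes "B \<in> carrier_mat N m" "k < N * m"
  shows "vectorise B $ k = B $$ (k mod N, k div N)" "k mod N < N" "k div N < m"
proof -
  have N: "N > 0" using assms by (cases N) auto
  show "vectorise B $ k = B $$ (k mod N, k div N)" using assms by (auto simp: vectorise_def)
  show "k mod N < N" using N by simp
  show "k div N < m" using assms less_mult_imp_div_less[of k m N] by (simp add: mult.commute)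
qed

lemma nnz_conv_vectorise:
  assumes B: "B \<in> carrier_mat N m"
  shows "nnz B = card {k. k < N * m \<and> vectorise B $ k \<noteq> 0}"
proof -
  have "bij_betw (\<lambda>k. (k mod N, k div N)) {k. k < N * m \<and> vectorise B $ k \<noteq> 0}
      {(i, j). i < dim_row B \<and> j < dim_col B \<and> B $$ (i, j) \<noteq> 0}"
  proof (rule bij_betwI[where g = "\<lambda>(i, j). j * N + i"])
    show "(\<lambda>k. (k mod N, k div N)) \<in> {k. k < N * m \<and> vectorise B $ k \<noteq> 0} \<rightarrow>
        {(i, j). i < dim_row B \<and> j < dim_col B \<and> B $$ (i, j) \<noteq> 0}"
      using B vectorise_index[OF B] by auto
    have *: "j * N + i < N * m" if "i < N" "j < m" for i j
    proof -
      have "j * N + i < Suc j * N" using that by simp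
      also have "\<dots> \<le> m * N" using that by (intro mult_right_mono) auto
      finally show ?thesis by (simp add: mult.commute)
    qed
    show "(\<lambda>(i, j). j * N + i) \<in> {(i, j). i < dim_row B \<and> j < dim_col B \<and> B $$ (i, j) \<noteq> 0} \<rightarrow>
        {k. k < N * m \<and> vectorise B $ k \<noteq> 0}"
      using B * by (auto simp: vectorise_index(1)[OF B])
  qed (use B in auto)
  then show ?thesis unfolding nnz_def by (auto dest!: bij_betw_same_card)
qed

lemma binary_vectorise:
  assumes "B \<in> carrier_mat N m" "binary_mat B" "k < N * m"
  shows "vectorise B $ k = 0 \<or> vectorise B $ k = 1"
proof -
  have "B $$ (k mod N, k div N) \<in> elements_mat B"
    using assms(1) vectorise_index(2,3)[OF assms(1,3)] by (intro elements_matI[of _ N m]) auto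
  then show ?thesis using assms(2) vectorise_index(1)[OF assms(1,3)] by (auto simp: binary_mat_def)
qed

lemma restriction_mat_carrier: "B \<in> carrier_mat N m \<Longrightarrow> restriction_mat B \<in> carrier_mat (N * m) (nnz B)"
  by (auto simp: restriction_mat_def)

text \<open>For a binary matrix the partial sums count the preceding nonzero entries, so column
  \<open>a\<close> is the unit vector of the nonzero entry of rank \<open>a\<close>.\<close>

lemma restriction_mat_index:
  assumes B: "B \<in> carrier_mat N m" "binary_mat B" and k: "k < N * m" "a < nnz B"
  shows "restriction_mat B $$ (k, a) =
    (if vectorise B $ k \<noteq> 0 \<and> card {k'. k' < k \<and> vectorise B $ k' \<noteq> 0} = a then 1 else 0)"
proof -
  have "(\<Sum>k'<k. vectorise B $ k') = (\<Sum>k'<k. if vectorise B $ k' \<noteq> 0 then 1 else 0)"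
  proof (rule sum.cong[OF refl])
    fix k' assume "k' \<in> {..<k}"
    then have "k' < N * m" using k(1) by simp
    from binary_vectorise[OF B this]
    show "vectorise B $ k' = (if vectorise B $ k' \<noteq> 0 then 1 else 0)" by auto
  qed
  also have "\<dots> = real (card {k'. k' < k \<and> vectorise B $ k' \<noteq> 0})"
    by (simp add: sum.If_cases Int_def)
  finally have "(\<Sum>k'<k. vectorise B $ k') = real (card {k'. k' < k \<and> vectorise B $ k' \<noteq> 0})" .
  then show ?thesis
    using B(1) k binary_vectorise[OF B k(1)] by (auto simp: restriction_mat_def)
qed

text \<open>Full column rank: for every column there is a row whose only nonzero entry lies in
  it.\<close>

lemma restriction_mat_inj:
  assumes B: "B \<in> carrier_mat N m" "binary_mat B"
    and 0: "\<And>k. k < N * m \<Longrightarrow> (\<Sum>a<nnz B. restriction_mat B $$ (k, a) * z a) = 0" and a: "a < nnz B"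
  shows "z a = 0"
proof -
  obtain k where k: "k < N * m" "vectorise B $ k \<noteq> 0" "card {k'. k' < k \<and> vectorise B $ k' \<noteq> 0} = a"
    using ex_card_below[of a "N * m" "\<lambda>k. vectorise B $ k \<noteq> 0"] a unfolding nnz_conv_vectorise[OF B(1)] by auto
  have "(\<Sum>b<nnz B. restriction_mat B $$ (k, b) * z b) = (\<Sum>b<nnz B. if b = a then z b else 0)"
    using k by (intro sum.cong) (auto simp: restriction_mat_index[OF B])
  then show ?thesis using 0[OF k(1)] a by simp
qed

lemma restriction_mat_restricted_params:
  assumes B: "B \<in> carrier_mat N m" "binary_mat B" and \<beta>: "\<beta> \<in> carrier_vec (N * m)"
    and 0: "\<And>k. k < N * m \<Longrightarrow> vectorise B $ k = 0 \<Longrightarrow> \<beta> $ k = 0"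
  shows "restricted_params \<beta> B \<in> carrier_vec (nnz B)"
    and "restriction_mat B *\<^sub>v restricted_params \<beta> B = \<beta>"
proof -
  let ?p = "\<lambda>k. vectorise B $ k \<noteq> 0"
  let ?f = "filter ?p [0..<N * m]"
  have len: "length ?f = nnz B" unfolding length_filter_upt nnz_conv_vectorise[OF B(1)] ..
  have \<gamma>: "restricted_params \<beta> B = vec_of_list (map (\<lambda>i. \<beta> $ i) ?f)"
    using \<beta> by (simp add: restricted_params_def)
  show car: "restricted_params \<beta> B \<in> carrier_vec (nnz B)" unfolding \<gamma> using len by (intro carrier_vecI) simp
  show "restriction_mat B *\<^sub>v restricted_params \<beta> B = \<beta>"
  proof (rule eq_vecI)
    show "dim_vec (restriction_mat B *\<^sub>v restricted_params \<beta> B) = dim_vec \<beta>"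
      using B(1) \<beta> by (simp add: restriction_mat_def)
    fix k assume "k < dim_vec \<beta>"
    then have k: "k < N * m" using \<beta> by simp
    let ?c = "card {k'. k' < k \<and> ?p k'}"
    have "(restriction_mat B *\<^sub>v restricted_params \<beta> B) $ k
        = (\<Sum>a<nnz B. restriction_mat B $$ (k, a) * restricted_params \<beta> B $ a)"
      using k car restriction_mat_carrier[OF B(1)] by (auto simp: scalar_prod_def lessThan_atLeast0 intro!: sum.cong)
    also have "\<dots> = (\<Sum>a<nnz B. if a = ?c then if ?p k then restricted_params \<beta> B $ a else 0 else 0)"
      using k by (intro sum.cong) (auto simp: restriction_mat_index[OF B])
    also have "\<dots> = \<beta> $ k"
    proof (cases "?p k")
      case True
      have c: "?c < nnz B" using card_below_less[of k "N * m" ?p] k True unfolding nnz_conv_vectorise[OF B(1)] by simp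
      have "restricted_params \<beta> B $ ?c = \<beta> $ (?f ! ?c)"
        unfolding \<gamma> using c len by (simp add: vec_of_list_index)
      also have "?f ! ?c = k" using filter_upt_nth_card[of k "N * m" ?p] k True by simp
      finally show ?thesis using c True by simp
    next
      case False
      then show ?thesis using 0[OF k] by simp
    qed
    finally show "(restriction_mat B *\<^sub>v restricted_params \<beta> B) $ k = \<beta> $ k" .
  qed
qed

section \<open>Kronecker products acting on stacked vectors\<close>

lemma kronecker_carrier:
  "D \<in> carrier_mat d T \<Longrightarrow> S \<in> carrier_mat N N \<Longrightarrow> D \<otimes>\<^sub>K S \<in> carrier_mat (N * d) (N * T)"
  by (auto simp: kronecker_def mult.commute)

lemma kronecker_index:
  assumes "D \<in> carrier_mat d T" "S \<in> carrier_mat N N" "k < N * d" "c < N * T"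
  shows "(D \<otimes>\<^sub>K S) $$ (k, c) = D $$ (k div N, c div N) * S $$ (k mod N, c mod N)"
  using assms by (auto simp: kronecker_def mult.commute)

lemma kronecker_mult_vec:
  fixes D S :: "'a :: comm_semiring_0 mat"
  assumes D: "D \<in> carrier_mat d T" and S: "S \<in> carrier_mat N N" and v: "v \<in> carrier_vec (N * T)" and k: "k < N * d"
  shows "((D \<otimes>\<^sub>K S) *\<^sub>v v) $ k = (\<Sum>t<T. \<Sum>i<N. D $$ (k div N, t) * S $$ (k mod N, i) * v $ (t * N + i))"
proof -
  have "((D \<otimes>\<^sub>K S) *\<^sub>v v) $ k = (\<Sum>c<T * N. (D \<otimes>\<^sub>K S) $$ (k, c) * v $ c)"
    using kronecker_carrier[OF D S] k v
    by (auto simp: scalar_prod_def lessThan_atLeast0 mult.commute intro!: sum.cong)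
  also have "\<dots> = (\<Sum>c<T * N. D $$ (k div N, c div N) * S $$ (k mod N, c mod N) * v $ c)"
    using k by (intro sum.cong) (auto simp: kronecker_index[OF D S] mult.commute)
  also have "\<dots> = (\<Sum>t<T. \<Sum>i<N. D $$ (k div N, t) * S $$ (k mod N, i) * v $ (t * N + i))"
    unfolding sum_blocks by (intro sum.cong) auto
  finally show ?thesis .
qed

text \<open>The identity (D x S) y - (D D' x S) \<beta> = (D x S)(y - (D' x I) \<beta>), read
  entrywise: the residuals of \<beta> appear weighted by regressors and by S.\<close>

lemma score_index:
  fixes D S :: "real mat"
  assumes D: "D \<in> carrier_mat d T" and S: "S \<in> carrier_mat N N" and y: "y \<in> carrier_vec (N * T)"
    and \<beta>: "\<beta> \<in> carrier_vec (N * d)" and k: "k < N * d"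
  shows "((D \<otimes>\<^sub>K S) *\<^sub>v y - ((D * D\<^sup>T) \<otimes>\<^sub>K S) *\<^sub>v \<beta>) $ k
    = (\<Sum>t<T. \<Sum>i<N. D $$ (k div N, t) * S $$ (k mod N, i) * (y $ (t * N + i) - (\<Sum>l<d. D $$ (l, t) * \<beta> $ (l * N + i))))"
proof -
  have DD: "D * D\<^sup>T \<in> carrier_mat d d" using D by simp
  have kd: "k div N < d" using k less_mult_imp_div_less[of k d N] by (simp add: mult.commute)
  have DDi: "(D * D\<^sup>T) $$ (k div N, l) = (\<Sum>t<T. D $$ (k div N, t) * D $$ (l, t))" if "l < d" for l
    using D kd that by (auto simp: scalar_prod_def lessThan_atLeast0 intro!: sum.cong)
  have "(((D * D\<^sup>T) \<otimes>\<^sub>K S) *\<^sub>v \<beta>) $ k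
      = (\<Sum>l<d. \<Sum>i<N. \<Sum>t<T. D $$ (k div N, t) * S $$ (k mod N, i) * (D $$ (l, t) * \<beta> $ (l * N + i)))"
    unfolding kronecker_mult_vec[OF DD S \<beta> k]
    by (rule sum.cong[OF refl], rule sum.cong[OF refl], simp add: DDi sum_distrib_right,
        rule sum.cong[OF refl], simp add: mult_ac)
  also have "\<dots> = (\<Sum>i<N. \<Sum>t<T. \<Sum>l<d. D $$ (k div N, t) * S $$ (k mod N, i) * (D $$ (l, t) * \<beta> $ (l * N + i)))"
    by (subst sum.swap, rule sum.cong[OF refl], rule sum.swap)
  also have "\<dots> = (\<Sum>t<T. \<Sum>i<N. D $$ (k div N, t) * S $$ (k mod N, i) * (\<Sum>l<d. D $$ (l, t) * \<beta> $ (l * N + i)))"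
    by (subst sum.swap) (simp add: sum_distrib_left)
  finally have 1: "(((D * D\<^sup>T) \<otimes>\<^sub>K S) *\<^sub>v \<beta>) $ k
      = (\<Sum>t<T. \<Sum>i<N. D $$ (k div N, t) * S $$ (k mod N, i) * (\<Sum>l<d. D $$ (l, t) * \<beta> $ (l * N + i)))" .
  have "((D \<otimes>\<^sub>K S) *\<^sub>v y - ((D * D\<^sup>T) \<otimes>\<^sub>K S) *\<^sub>v \<beta>) $ k
      = ((D \<otimes>\<^sub>K S) *\<^sub>v y) $ k - (((D * D\<^sup>T) \<otimes>\<^sub>K S) *\<^sub>v \<beta>) $ k"
    using kronecker_carrier[OF DD S] k by (intro index_minus_vec) auto
  then show ?thesis
    unfolding 1 kronecker_mult_vec[OF D S y k] by (simp add: right_diff_distrib sum_subtractf)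
qed

lemma transpose_mult_vec_index:
  fixes R :: "'a :: comm_semiring_0 mat"
  assumes "R \<in> carrier_mat L n" "v \<in> carrier_vec L" "a < n"
  shows "(R\<^sup>T *\<^sub>v v) $ a = (\<Sum>k<L. R $$ (k, a) * v $ k)"
  using assms by (auto simp: scalar_prod_def lessThan_atLeast0 intro!: sum.cong)

text \<open>Estimator and centring share the factor \<open>inv_mat (...) * R'\<close>, which is
  pulled out. The computation is purely algebraic and holds for samples with a singular Gram matrix
  too.\<close>

lemma estimation_error:
  assumes B: "B \<in> carrier_mat N m" and Sg: "Sg \<in> carrier_mat N N"
    and D: "D \<in> carrier_mat m T" and y: "y \<in> carrier_vec (N * T)"
    and A: "A \<in> carrier_mat N m" and \<gamma>: "\<gamma> \<in> carrier_vec (nnz A)"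
  shows "gls_estimator Sg B D y - misspec_mat Sg B A D *\<^sub>v \<gamma> =
    inv_mat ((restriction_mat B)\<^sup>T * ((D * D\<^sup>T) \<otimes>\<^sub>K inv_mat Sg) * restriction_mat B)
      *\<^sub>v ((restriction_mat B)\<^sup>T *\<^sub>v ((D \<otimes>\<^sub>K inv_mat Sg) *\<^sub>v y
          - ((D * D\<^sup>T) \<otimes>\<^sub>K inv_mat Sg) *\<^sub>v (restriction_mat A *\<^sub>v \<gamma>)))"
proof -
  define R where "R = restriction_mat B"
  define RA where "RA = restriction_mat A"
  define K where "K = (D * D\<^sup>T) \<otimes>\<^sub>K inv_mat Sg"
  define E where "E = D \<otimes>\<^sub>K inv_mat Sg"
  define I where "I = inv_mat (R\<^sup>T * K * R)"
  have R: "R \<in> carrier_mat (N * m) (nnz B)" "R\<^sup>T \<in> carrier_mat (nnz B) (N * m)"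
    using restriction_mat_carrier[OF B] by (auto simp: R_def)
  have RA: "RA \<in> carrier_mat (N * m) (nnz A)" using restriction_mat_carrier[OF A] by (simp add: RA_def)
  note S = inv_mat_carrier[OF Sg]
  have K: "K \<in> carrier_mat (N * m) (N * m)" unfolding K_def using D by (intro kronecker_carrier S) auto
  have E: "E \<in> carrier_mat (N * m) (N * T)" unfolding E_def by (rule kronecker_carrier[OF D S])
  have I: "I \<in> carrier_mat (nnz B) (nnz B)" unfolding I_def using R K by (intro inv_mat_carrier) auto
  have IR: "I * R\<^sup>T \<in> carrier_mat (nnz B) (N * m)" using I R by auto
  have 1: "I * R\<^sup>T * E *\<^sub>v y = I *\<^sub>v (R\<^sup>T *\<^sub>v (E *\<^sub>v y))"
    unfolding assoc_mult_mat_vec[OF IR E y] using E y by (intro assoc_mult_mat_vec[OF I R(2)]) auto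
  have RA\<gamma>: "RA *\<^sub>v \<gamma> \<in> carrier_vec (N * m)" using RA \<gamma> by auto
  have 2: "I * R\<^sup>T * K * RA *\<^sub>v \<gamma> = I *\<^sub>v (R\<^sup>T *\<^sub>v (K *\<^sub>v (RA *\<^sub>v \<gamma>)))"
  proof -
    have "I * R\<^sup>T * K * RA *\<^sub>v \<gamma> = I * R\<^sup>T * K *\<^sub>v (RA *\<^sub>v \<gamma>)"
      using IR K by (intro assoc_mult_mat_vec[OF _ RA \<gamma>]) auto
    also have "\<dots> = I * R\<^sup>T *\<^sub>v (K *\<^sub>v (RA *\<^sub>v \<gamma>))" by (rule assoc_mult_mat_vec[OF IR K RA\<gamma>])
    also have "\<dots> = I *\<^sub>v (R\<^sup>T *\<^sub>v (K *\<^sub>v (RA *\<^sub>v \<gamma>)))"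
      using K RA\<gamma> by (intro assoc_mult_mat_vec[OF I R(2)]) auto
    finally show ?thesis .
  qed
  have "I *\<^sub>v (R\<^sup>T *\<^sub>v (E *\<^sub>v y - K *\<^sub>v (RA *\<^sub>v \<gamma>)))
      = I *\<^sub>v (R\<^sup>T *\<^sub>v (E *\<^sub>v y)) - I *\<^sub>v (R\<^sup>T *\<^sub>v (K *\<^sub>v (RA *\<^sub>v \<gamma>)))"
    using E y K RA\<gamma> R
    by (subst mult_minus_distrib_mat_vec[OF R(2)], (auto)[2], subst mult_minus_distrib_mat_vec[OF I]) auto
  then show ?thesis
    unfolding gls_estimator_def misspec_mat_def
    unfolding R_def[symmetric] RA_def[symmetric] K_def[symmetric] E_def[symmetric] I_def[symmetric] 1 2 ..
qed

lemma sandwich_index: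
  fixes R K :: "'a :: comm_semiring_0 mat"
  assumes R: "R \<in> carrier_mat L n" and K: "K \<in> carrier_mat L L" and ab: "a < n" "b < n"
  shows "(R\<^sup>T * K * R) $$ (a, b) = (\<Sum>k<L. \<Sum>k'<L. R $$ (k, a) * K $$ (k, k') * R $$ (k', b))"
proof -
  define RK where "RK = R\<^sup>T * K"
  have RKc: "RK \<in> carrier_mat n L" using R K by (auto simp: RK_def)
  have RK: "RK $$ (a, k') = (\<Sum>k<L. R $$ (k, a) * K $$ (k, k'))" if "k' < L" for k'
    unfolding RK_def using R K ab that by (auto simp: scalar_prod_def lessThan_atLeast0 intro!: sum.cong)
  have "(RK * R) $$ (a, b) = (\<Sum>k'<L. RK $$ (a, k') * R $$ (k', b))"
    using R RKc ab by (auto simp: scalar_prod_def lessThan_atLeast0 intro!: sum.cong)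
  also have "\<dots> = (\<Sum>k'<L. \<Sum>k<L. R $$ (k, a) * K $$ (k, k') * R $$ (k', b))"
    by (intro sum.cong refl) (simp add: RK sum_distrib_right)
  also have "\<dots> = (\<Sum>k<L. \<Sum>k'<L. R $$ (k, a) * K $$ (k, k') * R $$ (k', b))"
    by (rule sum.swap)
  finally show ?thesis unfolding RK_def .
qed

section \<open>Limits of the Gram matrix and the score\<close>

locale nirvar_fit = nirvar +
  fixes q :: nat and A_hat :: "real mat"
  assumes q: "q < Q" and A_hat: "A_hat \<in> carrier_mat N (N * Q)" "binary_mat A_hat"
begin

abbreviation "n \<equiv> nnz A_hat"
abbreviation "d \<equiv> N * Q"

definition R :: "real mat" where "R = restriction_mat A_hat"
definition S :: "real mat" where "S = inv_mat (Sig q)"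

definition Dm :: "nat \<Rightarrow> 'a \<Rightarrow> real mat" where "Dm = regressors N Q X"
definition Hlim :: "real mat" where "Hlim = R\<^sup>T * (mat d d (\<lambda>(k, l). Gam k l) \<otimes>\<^sub>K S) * R"
definition Hn :: "nat \<Rightarrow> 'a \<Rightarrow> real mat" where
  "Hn T \<omega> = R\<^sup>T * (((1 / T) \<cdot>\<^sub>m (Dm T \<omega> * (Dm T \<omega>)\<^sup>T)) \<otimes>\<^sub>K S) * R"

definition rz :: "(nat \<Rightarrow> real) \<Rightarrow> nat \<Rightarrow> real" where
  "rz z k = (\<Sum>a<n. R $$ (k, a) * z a)"

text \<open>Entry \<open>i\<close> of Sigma^-1 applied to the l-th block of R z. It is the
  coefficient of regressor \<open>l\<close> times noise component \<open>i\<close> of feature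
  \<open>q\<close> in the linear combination of scores with weights \<open>z\<close>.\<close>

definition kap :: "(nat \<Rightarrow> real) \<Rightarrow> nat \<Rightarrow> nat \<Rightarrow> real" where
  "kap z l i = (\<Sum>b<N. rz z (l * N + b) * S $$ (b, i))"

text \<open>\<open>kap\<close> extended by zero to the noise components of all other features, as
  the stacked system demands.\<close>

definition Kc :: "(nat \<Rightarrow> real) \<Rightarrow> nat \<Rightarrow> nat \<Rightarrow> real" where
  "Kc z k l = (if k div N = q then kap z l (k mod N) else 0)"

text \<open>Entry \<open>a\<close> of R' (X x Sigma^-1) u. The noise of the t-th column belongs to
  time \<open>t + 1\<close>, one step after its regressor.\<close>

definition score :: "nat \<Rightarrow> nat \<Rightarrow> 'a \<Rightarrow> real" where
  "score T a \<omega> = (\<Sum>k<N * d. R $$ (k, a) *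
     (\<Sum>t<T. \<Sum>i<N. xs (int t) (k div N) \<omega> * S $$ (k mod N, i) * es (int t + 1) (q * N + i) \<omega>))"

lemma Sig_q: "Sig q \<in> carrier_mat N N" "det (Sig q) \<noteq> 0" "(Sig q)\<^sup>T = Sig q"
proof -
  show c: "Sig q \<in> carrier_mat N N" by (rule Sig_carrier[OF q])
  have "mat N N (\<lambda>(i, j). Sig q $$ (i, j)) = Sig q" using c by (intro eq_matI) auto
  then show "det (Sig q) \<noteq> 0" using det_pos_def[OF Sig_pos_def[OF q]] by simp
  show "(Sig q)\<^sup>T = Sig q" using c Sig_pos_def[OF q] by (intro eq_matI) (auto simp: pos_def_def)
qed

lemma S_carrier: "S \<in> carrier_mat N N"
  unfolding S_def by (rule inv_mat_carrier[OF Sig_q(1)])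

lemma S_sym: "i < N \<Longrightarrow> j < N \<Longrightarrow> S $$ (i, j) = S $$ (j, i)"
  using arg_cong[OF inv_mat_symmetric[OF Sig_q], of "\<lambda>A. A $$ (j, i)"] S_carrier by (simp add: S_def)

lemma S_Sig: "b < N \<Longrightarrow> j < N \<Longrightarrow> (\<Sum>i<N. S $$ (b, i) * Sig q $$ (i, j)) = (if b = j then 1 else 0)"
  using arg_cong[OF inv_mat_mult(2)[OF Sig_q(1,2)], of "\<lambda>A. A $$ (b, j)"] S_carrier Sig_q(1)
  by (simp add: S_def[symmetric] scalar_prod_def lessThan_atLeast0)

lemma R_carrier: "R \<in> carrier_mat (N * d) n"
  unfolding R_def by (rule restriction_mat_carrier[OF A_hat(1)])

lemma Dm_carrier: "Dm T \<omega> \<in> carrier_mat d T"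
  unfolding Dm_def regressors_def using mat_of_cols_carrier(1)[of d "map (\<lambda>t. stacked N Q X (int t) \<omega>) [0..<T]"] by simp

lemma Dm_index: "l < d \<Longrightarrow> t < T \<Longrightarrow> Dm T \<omega> $$ (l, t) = xs (int t) l \<omega>"
  unfolding Dm_def regressors_def by (subst mat_of_cols_index) (auto simp: stacked_def xs_def)

lemma Hlim_carrier: "Hlim \<in> carrier_mat n n"
  unfolding Hlim_def using R_carrier kronecker_carrier[OF _ S_carrier, of "mat d d (\<lambda>(k, l). Gam k l)" d d]
  by auto

lemma moment_carrier: "(1 / real T) \<cdot>\<^sub>m (Dm T \<omega> * (Dm T \<omega>)\<^sup>T) \<in> carrier_mat d d"
  using Dm_carrier[of T \<omega>] by auto

lemma gram_index:
  assumes "k < d" "l < d"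
  shows "(Dm T \<omega> * (Dm T \<omega>)\<^sup>T) $$ (k, l) = (\<Sum>t<T. xs (int t) k \<omega> * xs (int t) l \<omega>)"
  using Dm_carrier[of T \<omega>] assms
  by (auto simp: scalar_prod_def lessThan_atLeast0 Dm_index intro!: sum.cong)

lemma moment_index:
  assumes "k < d" "l < d"
  shows "((1 / real T) \<cdot>\<^sub>m (Dm T \<omega> * (Dm T \<omega>)\<^sup>T)) $$ (k, l) = (\<Sum>t<T. xs (int t) k \<omega> * xs (int t) l \<omega>) / T"
  using assms Dm_carrier[of T \<omega>] gram_index[OF assms, of T \<omega>] by simp

lemma Hn_carrier: "Hn T \<omega> \<in> carrier_mat n n"
  unfolding Hn_def using R_carrier kronecker_carrier[OF moment_carrier S_carrier, of T \<omega>] by auto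

lemma div_d_less: "k < N * d \<Longrightarrow> k div N < d" "k < N * d \<Longrightarrow> k mod N < N"
  using less_mult_imp_div_less[of k d N] N_pos by (auto simp: mult.commute)

lemma Hlim_index:
  assumes "a < n" "b < n"
  shows "Hlim $$ (a, b) = (\<Sum>k<N * d. \<Sum>k'<N * d.
      R $$ (k, a) * (Gam (k div N) (k' div N) * S $$ (k mod N, k' mod N)) * R $$ (k', b))"
  unfolding Hlim_def
  by (subst sandwich_index[OF R_carrier kronecker_carrier[OF _ S_carrier] assms], simp,
      intro sum.cong refl, subst kronecker_index[OF _ S_carrier], auto simp: div_d_less)

lemma Hn_index:
  assumes "a < n" "b < n"
  shows "Hn T \<omega> $$ (a, b) = (\<Sum>k<N * d. \<Sum>k'<N * d.
      R $$ (k, a) * ((\<Sum>t<T. xs (int t) (k div N) \<omega> * xs (int t) (k' div N) \<omega>) / T * S $$ (k mod N, k' mod N)) * R $$ (k', b))"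
  unfolding Hn_def
  by (subst sandwich_index[OF R_carrier kronecker_carrier[OF moment_carrier S_carrier] assms],
      intro sum.cong refl, subst kronecker_index[OF moment_carrier S_carrier])
    (auto simp: div_d_less moment_index)

lemma Om_block:
  assumes "i < N" "j < N"
  shows "Om (q * N + i) (q * N + j) = Sig q $$ (i, j)"
  using assms block_index[OF q] by (simp add: Om_def)

lemma sum_Kc:
  assumes "\<And>k l. F k l 0 = (0 :: real)"
  shows "(\<Sum>k<d. \<Sum>l<d. F k l (Kc z k l)) = (\<Sum>i<N. \<Sum>l<d. F (q * N + i) l (kap z l i))"
proof -
  have "(\<Sum>k<d. \<Sum>l<d. F k l (Kc z k l)) = (\<Sum>p<Q. \<Sum>i<N. \<Sum>l<d. F (p * N + i) l (Kc z (p * N + i) l))"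
    using sum_blocks[of "\<lambda>k. \<Sum>l<d. F k l (Kc z k l)" Q N] by (simp add: mult.commute)
  also have "\<dots> = (\<Sum>p<Q. if p = q then \<Sum>i<N. \<Sum>l<d. F (q * N + i) l (kap z l i) else 0)"
    by (intro sum.cong) (auto simp: Kc_def block_index assms)
  finally show ?thesis using q by simp
qed

text \<open>The Cramer-Wold reduction: every linear combination of the scores is one scalar sum of
  the kind covered by the central limit theorem.\<close>

lemma score_combination: "(\<Sum>a<n. z a * score T a \<omega>) = V.Ssum (Kc z) xs T \<omega>"
proof -
  let ?u = "\<lambda>l b. \<Sum>t<T. \<Sum>i<N. xs (int t) l \<omega> * S $$ (b, i) * es (int t + 1) (q * N + i) \<omega>"
  have "(\<Sum>a<n. z a * score T a \<omega>) = (\<Sum>a<n. \<Sum>k<N * d. R $$ (k, a) * z a * ?u (k div N) (k mod N))"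
    unfolding score_def by (simp add: sum_distrib_left mult_ac)
  also have "\<dots> = (\<Sum>k<N * d. rz z k * ?u (k div N) (k mod N))"
    unfolding rz_def sum_distrib_right by (rule sum.swap)
  also have "\<dots> = (\<Sum>l<d. \<Sum>b<N. rz z (l * N + b) * ?u l b)"
    using sum_blocks[of "\<lambda>k. rz z k * ?u (k div N) (k mod N)" d N] by (simp add: mult.commute[of N d])
  also have "\<dots> = (\<Sum>l<d. \<Sum>b<N. \<Sum>t<T. \<Sum>i<N.
      rz z (l * N + b) * S $$ (b, i) * (xs (int t) l \<omega> * es (int t + 1) (q * N + i) \<omega>))"
    unfolding sum_distrib_left by (simp add: mult_ac)
  also have "\<dots> = (\<Sum>t<T. \<Sum>i<N. \<Sum>l<d. \<Sum>b<N.
      rz z (l * N + b) * S $$ (b, i) * (xs (int t) l \<omega> * es (int t + 1) (q * N + i) \<omega>))"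
    by (rule sum_swap_pairs)
  also have "\<dots> = (\<Sum>t<T. \<Sum>i<N. \<Sum>l<d. kap z l i * (xs (int t) l \<omega> * es (int t + 1) (q * N + i) \<omega>))"
    unfolding kap_def sum_distrib_right ..
  also have "\<dots> = V.Ssum (Kc z) xs T \<omega>"
    unfolding V.Ssum_def V.xi_def
    by (intro sum.cong refl sum_Kc[of "\<lambda>k l c. c * (xs (int _) l \<omega> * es (int _ + 1) k \<omega>)", symmetric]) simp
  finally show ?thesis .
qed

lemma bil_Hlim: "bil n (\<lambda>a b. Hlim $$ (a, b)) z z =
  (\<Sum>l<d. \<Sum>l'<d. Gam l l' * (\<Sum>b<N. \<Sum>b'<N. rz z (l * N + b) * S $$ (b, b') * rz z (l' * N + b')))"
proof -
  let ?c = "\<lambda>k k'. Gam (k div N) (k' div N) * S $$ (k mod N, k' mod N)"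
  have "bil n (\<lambda>a b. Hlim $$ (a, b)) z z
      = (\<Sum>a<n. \<Sum>b<n. \<Sum>k<N * d. \<Sum>k'<N * d. (R $$ (k, a) * z a) * ?c k k' * (R $$ (k', b) * z b))"
    unfolding bil_def by (intro sum.cong refl) (simp add: Hlim_index sum_distrib_left sum_distrib_right mult_ac)
  also have "\<dots> = (\<Sum>k<N * d. \<Sum>k'<N * d. \<Sum>a<n. \<Sum>b<n. (R $$ (k, a) * z a) * ?c k k' * (R $$ (k', b) * z b))"
    by (rule sum_swap_pairs)
  also have "\<dots> = (\<Sum>k<N * d. \<Sum>k'<N * d. rz z k * ?c k k' * rz z k')"
    unfolding rz_def by (simp add: sum_distrib_left sum_distrib_right mult_ac)
  also have "\<dots> = (\<Sum>l<d. \<Sum>b<N. \<Sum>l'<d. \<Sum>b'<N. rz z (l * N + b) * (Gam l l' * S $$ (b, b')) * rz z (l' * N + b'))"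
    unfolding mult.commute[of N d] sum_blocks by simp
  also have "\<dots> = (\<Sum>l<d. \<Sum>l'<d. \<Sum>b<N. \<Sum>b'<N. rz z (l * N + b) * (Gam l l' * S $$ (b, b')) * rz z (l' * N + b'))"
    by (rule sum.cong[OF refl], rule sum.swap)
  also have "\<dots> = (\<Sum>l<d. \<Sum>l'<d. Gam l l' * (\<Sum>b<N. \<Sum>b'<N. rz z (l * N + b) * S $$ (b, b') * rz z (l' * N + b')))"
    unfolding sum_distrib_left by (simp add: mult_ac)
  finally show ?thesis .
qed

text \<open>Multiplying by Sigma undoes Sigma^-1, so R z can be recovered from \<open>kap\<close>.
  The variance computation and the proof of definiteness both rest on this.\<close>

lemma kap_Sig: "c < N \<Longrightarrow> (\<Sum>i<N. kap z l i * Sig q $$ (i, c)) = rz z (l * N + c)"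
proof -
  assume c: "c < N"
  have "(\<Sum>i<N. kap z l i * Sig q $$ (i, c)) = (\<Sum>b<N. rz z (l * N + b) * (\<Sum>i<N. S $$ (b, i) * Sig q $$ (i, c)))"
    unfolding kap_def sum_distrib_left sum_distrib_right by (subst sum.swap) (simp add: mult_ac)
  also have "\<dots> = (\<Sum>b<N. if b = c then rz z (l * N + b) else 0)"
    using c by (intro sum.cong) (auto simp: S_Sig)
  finally show ?thesis using c by simp
qed

text \<open>Here \<open>\<Sigma>\<inverse>\<close> enters in the form \<open>\<Sigma>\<inverse> \<Sigma> \<Sigma>\<inverse>\<close>.\<close>

lemma bil_Hlim_kap: "bil n (\<lambda>a b. Hlim $$ (a, b)) z z =
  (\<Sum>l<d. \<Sum>l'<d. Gam l l' * (\<Sum>i<N. \<Sum>j<N. kap z l i * Sig q $$ (i, j) * kap z l' j))"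
proof -
  have "(\<Sum>i<N. \<Sum>j<N. kap z l i * Sig q $$ (i, j) * kap z l' j)
      = (\<Sum>b<N. \<Sum>b'<N. rz z (l * N + b) * S $$ (b, b') * rz z (l' * N + b'))" for l l'
  proof -
    have "(\<Sum>i<N. \<Sum>j<N. kap z l i * Sig q $$ (i, j) * kap z l' j)
        = (\<Sum>j<N. (\<Sum>i<N. kap z l i * Sig q $$ (i, j)) * kap z l' j)"
      unfolding sum_distrib_right by (rule sum.swap)
    also have "\<dots> = (\<Sum>j<N. rz z (l * N + j) * kap z l' j)" by (simp add: kap_Sig)
    also have "\<dots> = (\<Sum>b<N. \<Sum>b'<N. rz z (l * N + b) * S $$ (b, b') * rz z (l' * N + b'))"
      unfolding kap_def sum_distrib_left by (intro sum.cong refl) (simp add: S_sym mult_ac)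
    finally show ?thesis .
  qed
  then show ?thesis unfolding bil_Hlim by simp
qed

text \<open>The limiting variance of the score equals the limit of the normalised Gram matrix; hence
  the limit covariance is a single inverse and not a sandwich.\<close>

lemma qf_Kc: "V.qf (Kc z) Gam = bil n (\<lambda>a b. Hlim $$ (a, b)) z z"
proof -
  have "V.qf (Kc z) Gam = (\<Sum>k<d. \<Sum>l<d. \<Sum>k'<d. \<Sum>l'<d. Kc z k l * Kc z k' l' * (Gam l l' * Om k k'))"
    unfolding V.qf_def by (rule sum.cong[OF refl], rule sum.swap)
  also have "\<dots> = (\<Sum>i<N. \<Sum>l<d. \<Sum>k'<d. \<Sum>l'<d. kap z l i * Kc z k' l' * (Gam l l' * Om (q * N + i) k'))"
    by (rule sum_Kc[of "\<lambda>k l c. \<Sum>k'<d. \<Sum>l'<d. c * Kc z k' l' * (Gam l l' * Om k k')"]) simp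
  also have "\<dots> = (\<Sum>i<N. \<Sum>l<d. \<Sum>j<N. \<Sum>l'<d. kap z l i * kap z l' j * (Gam l l' * Om (q * N + i) (q * N + j)))"
    by (rule sum.cong[OF refl], rule sum.cong[OF refl], rule sum_Kc[of "\<lambda>k' l' c. kap z _ _ * c * (Gam _ l' * Om _ k')"]) simp
  also have "\<dots> = (\<Sum>l<d. \<Sum>i<N. \<Sum>j<N. \<Sum>l'<d. kap z l i * kap z l' j * (Gam l l' * Om (q * N + i) (q * N + j)))"
    by (rule sum.swap)
  also have "\<dots> = (\<Sum>l<d. \<Sum>i<N. \<Sum>l'<d. \<Sum>j<N. kap z l i * kap z l' j * (Gam l l' * Om (q * N + i) (q * N + j)))"
    by (rule sum.cong[OF refl], rule sum.cong[OF refl], rule sum.swap)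
  also have "\<dots> = (\<Sum>l<d. \<Sum>l'<d. \<Sum>i<N. \<Sum>j<N. kap z l i * kap z l' j * (Gam l l' * Om (q * N + i) (q * N + j)))"
    by (rule sum.cong[OF refl], rule sum.swap)
  also have "\<dots> = (\<Sum>l<d. \<Sum>l'<d. Gam l l' * (\<Sum>i<N. \<Sum>j<N. kap z l i * Sig q $$ (i, j) * kap z l' j))"
    unfolding sum_distrib_left by (intro sum.cong refl) (subst Om_block, simp, simp, simp only: mult_ac)
  finally show ?thesis unfolding bil_Hlim_kap .
qed

text \<open>The form at \<open>z\<close> is the expectation of Y' Sigma Y, where Y collects the
  combinations of regressors with coefficients \<open>kap\<close>. If it vanishes, Y = 0 almost
  surely; definiteness of \<open>Gam\<close> gives \<open>kap\<close> = 0, then R z = 0, and full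
  column rank gives z = 0.\<close>

lemma Hlim_pos_def: "pos_def n (\<lambda>a b. Hlim $$ (a, b))"
proof -
  have Gam_sym: "Gam k l = Gam l k" for k l by (simp add: Gam_def mult.commute)
  have sym: "Hlim $$ (a, b) = Hlim $$ (b, a)" if "a < n" "b < n" for a b
  proof -
    have "Hlim $$ (a, b) = (\<Sum>k'<N * d. \<Sum>k<N * d.
        R $$ (k, a) * (Gam (k div N) (k' div N) * S $$ (k mod N, k' mod N)) * R $$ (k', b))"
      unfolding Hlim_index[OF that] by (rule sum.swap)
    also have "\<dots> = Hlim $$ (b, a)"
      unfolding Hlim_index[OF that(2,1)]
    proof (intro sum.cong refl)
      fix k' k assume "k' \<in> {..<N * d}" "k \<in> {..<N * d}"
      then have "S $$ (k mod N, k' mod N) = S $$ (k' mod N, k mod N)" by (intro S_sym) (auto simp: div_d_less)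
      then show "R $$ (k, a) * (Gam (k div N) (k' div N) * S $$ (k mod N, k' mod N)) * R $$ (k', b)
          = R $$ (k', b) * (Gam (k' div N) (k div N) * S $$ (k' mod N, k mod N)) * R $$ (k, a)"
        using Gam_sym[of "k div N" "k' div N"] by (simp only: mult_ac)
    qed
    finally show ?thesis .
  qed
  have pos: "bil n (\<lambda>a b. Hlim $$ (a, b)) z z > 0" if z: "\<exists>a<n. z a \<noteq> 0" for z
  proof -
    define Y where "Y = (\<lambda>i \<omega>. \<Sum>l<d. kap z l i * xs 0 l \<omega>)"
    have Y: "L2 (Y i)" for i unfolding Y_def by (intro L2_sum L2_cmult xs_L2) auto
    have YY: "expectation (\<lambda>\<omega>. Y i \<omega> * Y j \<omega>) = (\<Sum>l<d. \<Sum>l'<d. kap z l i * kap z l' j * Gam l l')" for i j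
    proof -
      have "has_bochner_integral M (\<lambda>\<omega>. \<Sum>l<d. \<Sum>l'<d. kap z l i * kap z l' j * (xs 0 l \<omega> * xs 0 l' \<omega>))
          (\<Sum>l<d. \<Sum>l'<d. kap z l i * kap z l' j * Gam l l')"
        by (intro has_bochner_integral_sum has_bochner_integral_mult_right)
          (simp add: has_bochner_integral_iff xs_cov L2_mult_integrable xs_L2)
      then show ?thesis unfolding Y_def sum_product by (simp add: has_bochner_integral_iff mult_ac)
    qed
    let ?s = "\<lambda>i j. Sig q $$ (i, j)"
    have hb: "has_bochner_integral M (\<lambda>\<omega>. bil N ?s (\<lambda>i. Y i \<omega>) (\<lambda>i. Y i \<omega>))
        (\<Sum>i<N. \<Sum>j<N. ?s i j * expectation (\<lambda>\<omega>. Y i \<omega> * Y j \<omega>))"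
      unfolding bil_def mult.assoc
      by (intro has_bochner_integral_sum has_bochner_integral_mult_right)
        (simp add: has_bochner_integral_iff L2_mult_integrable Y)
    have "(\<Sum>i<N. \<Sum>j<N. ?s i j * expectation (\<lambda>\<omega>. Y i \<omega> * Y j \<omega>))
        = (\<Sum>i<N. \<Sum>j<N. \<Sum>l<d. \<Sum>l'<d. Gam l l' * (kap z l i * ?s i j * kap z l' j))"
      unfolding YY sum_distrib_left by (simp add: mult_ac)
    also have "\<dots> = (\<Sum>l<d. \<Sum>l'<d. \<Sum>i<N. \<Sum>j<N. Gam l l' * (kap z l i * ?s i j * kap z l' j))"
      by (rule sum_swap_pairs)
    also have "\<dots> = bil n (\<lambda>a b. Hlim $$ (a, b)) z z"
      unfolding bil_Hlim_kap sum_distrib_left ..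
    finally have hb: "has_bochner_integral M (\<lambda>\<omega>. bil N ?s (\<lambda>i. Y i \<omega>) (\<lambda>i. Y i \<omega>)) (bil n (\<lambda>a b. Hlim $$ (a, b)) z z)"
      using hb by simp
    have nonneg: "bil N ?s v v \<ge> 0" for v
    proof (cases "\<exists>i<N. v i \<noteq> 0")
      case True
      then show ?thesis using Sig_pos_def[OF q] by (auto simp: pos_def_def intro: less_imp_le)
    next
      case False
      then show ?thesis by (simp add: bil_def)
    qed
    have "bil n (\<lambda>a b. Hlim $$ (a, b)) z z \<noteq> 0"
    proof
      assume "bil n (\<lambda>a b. Hlim $$ (a, b)) z z = 0"
      then have "AE \<omega> in M. bil N ?s (\<lambda>i. Y i \<omega>) (\<lambda>i. Y i \<omega>) = 0"
        using hb nonneg by (subst integral_nonneg_eq_0_iff_AE[symmetric]) (auto simp: has_bochner_integral_iff)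
      then have AE0: "AE \<omega> in M. \<forall>i<N. Y i \<omega> = 0"
      proof eventually_elim
        case (elim \<omega>)
        show ?case
        proof (rule ccontr)
          assume "\<not> (\<forall>i<N. Y i \<omega> = 0)"
          then have "bil N ?s (\<lambda>i. Y i \<omega>) (\<lambda>i. Y i \<omega>) > 0"
            by (intro pos_defD[OF Sig_pos_def[OF q]]) auto
          then show False using elim by simp
        qed
      qed
      have "kap z l i = 0" if "i < N" "l < d" for i l
      proof (rule ccontr)
        assume "kap z l i \<noteq> 0"
        then have "bil d Gam (\<lambda>l. kap z l i) (\<lambda>l. kap z l i) > 0"
          using that by (intro pos_defD[OF Gam_pos_def]) auto
        moreover have "expectation (\<lambda>\<omega>. Y i \<omega> * Y i \<omega>) = 0"
          by (rule integral_eq_zero_AE) (use AE0 in \<open>eventually_elim, use that in auto\<close>)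
        ultimately show False unfolding YY by (simp add: bil_def mult_ac)
      qed
      then have "rz z k = 0" if "k < N * d" for k
        using kap_Sig[of "k mod N" z "k div N"] div_d_less[OF that] by simp
      then have "z a = 0" if "a < n" for a
        using restriction_mat_inj[OF A_hat _ that, of z] unfolding rz_def R_def by blast
      then show False using z by auto
    qed
    moreover have "bil n (\<lambda>a b. Hlim $$ (a, b)) z z \<ge> 0"
      unfolding has_bochner_integral_integral_eq[OF hb, symmetric]
      by (intro integral_nonneg_AE AE_I2 nonneg)
    ultimately show ?thesis by linarith
  qed
  show ?thesis using sym pos by (auto simp: pos_def_def)
qed

lemma xs_prod_mean_integrable:
  assumes "k < d" "l < d"
  shows "integrable M (\<lambda>\<omega>. (\<Sum>t<T. xs (int t) k \<omega> * xs (int t) l \<omega>) / T)"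
  using assms by (intro integrable_divide Bochner_Integration.integrable_sum L2_mult_integrable xs_L2) auto

lemma Hn_integrable: "a < n \<Longrightarrow> b < n \<Longrightarrow> integrable M (\<lambda>\<omega>. Hn T \<omega> $$ (a, b))"
  unfolding Hn_index
  by (intro Bochner_Integration.integrable_sum integrable_mult_left integrable_mult_right xs_prod_mean_integrable)
    (auto simp: div_d_less)

lemma Hn_lim:
  assumes ab: "a < n" "b < n"
  shows "(\<lambda>T. expectation (\<lambda>\<omega>. \<bar>Hn T \<omega> $$ (a, b) - Hlim $$ (a, b)\<bar>)) \<longlonglongrightarrow> 0"
proof -
  let ?m = "\<lambda>T k k' \<omega>. (\<Sum>t<T. xs (int t) (k div N) \<omega> * xs (int t) (k' div N) \<omega>) / real T - Gam (k div N) (k' div N)"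
  let ?c = "\<lambda>k k'. \<bar>R $$ (k, a)\<bar> * \<bar>S $$ (k mod N, k' mod N)\<bar> * \<bar>R $$ (k', b)\<bar>"
  have im: "integrable M (\<lambda>\<omega>. \<bar>?m T k k' \<omega>\<bar>)" if "k < N * d" "k' < N * d" for T k k'
    using that by (intro integrable_abs Bochner_Integration.integrable_diff xs_prod_mean_integrable) (auto simp: div_d_less)
  have le: "expectation (\<lambda>\<omega>. \<bar>Hn T \<omega> $$ (a, b) - Hlim $$ (a, b)\<bar>)
      \<le> (\<Sum>k<N * d. \<Sum>k'<N * d. ?c k k' * expectation (\<lambda>\<omega>. \<bar>?m T k k' \<omega>\<bar>))" for T
  proof -
    have "expectation (\<lambda>\<omega>. \<bar>Hn T \<omega> $$ (a, b) - Hlim $$ (a, b)\<bar>)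
        \<le> expectation (\<lambda>\<omega>. \<Sum>k<N * d. \<Sum>k'<N * d. ?c k k' * \<bar>?m T k k' \<omega>\<bar>)"
    proof (rule integral_mono)
      show "integrable M (\<lambda>\<omega>. \<bar>Hn T \<omega> $$ (a, b) - Hlim $$ (a, b)\<bar>)"
        by (intro integrable_abs Bochner_Integration.integrable_diff Hn_integrable ab) simp
      show "integrable M (\<lambda>\<omega>. \<Sum>k<N * d. \<Sum>k'<N * d. ?c k k' * \<bar>?m T k k' \<omega>\<bar>)"
        by (intro Bochner_Integration.integrable_sum integrable_mult_right im) auto
      fix \<omega>
      have eq: "Hn T \<omega> $$ (a, b) - Hlim $$ (a, b)
          = (\<Sum>k<N * d. \<Sum>k'<N * d. R $$ (k, a) * (?m T k k' \<omega> * S $$ (k mod N, k' mod N)) * R $$ (k', b))"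
        unfolding Hn_index[OF ab] Hlim_index[OF ab] sum_subtractf[symmetric]
        by (simp only: left_diff_distrib right_diff_distrib)
      show "\<bar>Hn T \<omega> $$ (a, b) - Hlim $$ (a, b)\<bar> \<le> (\<Sum>k<N * d. \<Sum>k'<N * d. ?c k k' * \<bar>?m T k k' \<omega>\<bar>)"
        unfolding eq
      proof (intro order_trans[OF sum_abs] sum_mono)
        fix k k'
        have "\<bar>r * (m * s) * r'\<bar> \<le> \<bar>r\<bar> * \<bar>s\<bar> * \<bar>r'\<bar> * \<bar>m\<bar>" for r m s r' :: real
          by (simp add: abs_mult)
        then show "\<bar>R $$ (k, a) * (?m T k k' \<omega> * S $$ (k mod N, k' mod N)) * R $$ (k', b)\<bar> \<le> ?c k k' * \<bar>?m T k k' \<omega>\<bar>" .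
      qed
    qed
    also have "\<dots> = (\<Sum>k<N * d. \<Sum>k'<N * d. ?c k k' * expectation (\<lambda>\<omega>. \<bar>?m T k k' \<omega>\<bar>))"
      using im by (intro has_bochner_integral_integral_eq has_bochner_integral_sum has_bochner_integral_mult_right)
        (simp add: has_bochner_integral_iff)
    finally show ?thesis .
  qed
  have ev: "\<forall>\<^sub>F T in sequentially. norm (expectation (\<lambda>\<omega>. \<bar>Hn T \<omega> $$ (a, b) - Hlim $$ (a, b)\<bar>))
      \<le> (\<Sum>k<N * d. \<Sum>k'<N * d. ?c k k' * expectation (\<lambda>\<omega>. \<bar>?m T k k' \<omega>\<bar>))"
  proof (intro always_eventually allI)
    fix T
    have "0 \<le> expectation (\<lambda>\<omega>. \<bar>Hn T \<omega> $$ (a, b) - Hlim $$ (a, b)\<bar>)" by (intro integral_nonneg_AE) auto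
    then show "norm (expectation (\<lambda>\<omega>. \<bar>Hn T \<omega> $$ (a, b) - Hlim $$ (a, b)\<bar>))
      \<le> (\<Sum>k<N * d. \<Sum>k'<N * d. ?c k k' * expectation (\<lambda>\<omega>. \<bar>?m T k k' \<omega>\<bar>))"
      using le[of T] by simp
  qed
  have "(\<lambda>T. \<Sum>k<N * d. \<Sum>k'<N * d. ?c k k' * expectation (\<lambda>\<omega>. \<bar>?m T k k' \<omega>\<bar>)) \<longlonglongrightarrow> (\<Sum>k<N * d. \<Sum>k'<N * d. ?c k k' * 0)"
    by (intro tendsto_sum tendsto_mult tendsto_const V.lln_x) (auto simp: div_d_less)
  then show ?thesis by (intro Lim_null_comparison[OF ev]) simp
qed

lemma score_eq_Ssum:
  assumes "a < n"
  shows "score T a \<omega> = V.Ssum (Kc (\<lambda>b. if b = a then 1 else 0)) xs T \<omega>"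
proof -
  have "(\<Sum>b<n. (if b = a then 1 else 0) * score T b \<omega>) = (\<Sum>b<n. if b = a then score T b \<omega> else 0)"
    by (intro sum.cong) auto
  then show ?thesis using assms score_combination[of "\<lambda>b. if b = a then 1 else 0" T \<omega>] by simp
qed

lemma score_integrable: "a < n \<Longrightarrow> integrable M (score T a)"
  using V.Ssum_x_integrable score_eq_Ssum by (simp add: fun_eq_iff cong: Bochner_Integration.integrable_cong)

lemma score_bound:
  "\<exists>C. \<forall>a<n. \<forall>T. expectation (\<lambda>\<omega>. \<bar>score T a \<omega> / sqrt T\<bar>) \<le> C"
proof -
  let ?e = "\<lambda>a b. if b = a then 1 else 0"
  let ?C = "\<lambda>a. sqrt (V.kappa (Kc (?e a)) * (2 * V.rho_sum 0))"
  have nn: "?C a \<ge> 0" for a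
    unfolding V.rho_sum_def by (intro real_sqrt_ge_zero mult_nonneg_nonneg V.kappa_nonneg sum_nonneg V.rho_nonneg) auto
  have "expectation (\<lambda>\<omega>. \<bar>score T a \<omega> / sqrt T\<bar>) \<le> (\<Sum>a<n. ?C a)" if a: "a < n" for a T
  proof -
    have "expectation (\<lambda>\<omega>. \<bar>score T a \<omega> / sqrt T\<bar>) = expectation (\<lambda>\<omega>. \<bar>V.Ssum (Kc (?e a)) xs T \<omega>\<bar>) / sqrt T"
      unfolding score_eq_Ssum[OF a] by simp
    also have "\<dots> \<le> sqrt T * ?C a / sqrt T"
      by (intro divide_right_mono V.Ssum_x_L1_bound) auto
    \<comment> \<open>For \<open>T = 0\<close> the quotient is 0 by the convention for division by
      zero.\<close>
    also have "\<dots> \<le> ?C a" using nn by (cases "T = 0") auto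
    also have "\<dots> \<le> (\<Sum>a<n. ?C a)" using a nn by (intro member_le_sum) auto
    finally show ?thesis .
  qed
  then show ?thesis by blast
qed

lemma score_char:
  "(\<lambda>T. \<integral>\<omega>. iexp (\<Sum>a<n. z a * (score T a \<omega> / sqrt T)) \<partial>M) \<longlonglongrightarrow> exp (- bil n (\<lambda>a b. Hlim $$ (a, b)) z z / 2)"
proof -
  have "(\<Sum>a<n. z a * (score T a \<omega> / sqrt T)) = V.Ssum (Kc z) xs T \<omega> / sqrt T" for T \<omega>
    unfolding score_combination[symmetric] by (simp add: sum_divide_distrib)
  then show ?thesis using V.clt_x[of "Kc z"] unfolding qf_Kc by simp
qed

end

section \<open>The estimation error\<close>

lemma (in prob_space) tends_to_0_in_probI:
  assumes rv: "\<And>T. random_vec M n (Z T)"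
    and lim: "\<And>i e. i < n \<Longrightarrow> e > 0 \<Longrightarrow> (\<lambda>T. prob {\<omega> \<in> space M. \<bar>Z T \<omega> $ i\<bar> \<ge> e}) \<longlonglongrightarrow> 0"
  shows "tends_to_0_in_prob M n Z"
  unfolding tends_to_0_in_prob_def
proof (intro conjI allI impI rv)
  fix e :: real assume e: "e > 0"
  \<comment> \<open>If all \<open>n\<close> coordinates are at most \<delta>, the norm is at most n
    \<delta> \<le> e; the denominator n + 1 also covers n = 0.\<close>
  define \<delta> where "\<delta> = e / (n + 1)"
  have \<delta>: "\<delta> > 0" "n * \<delta> \<le> e" using e by (auto simp: \<delta>_def field_simps)
  have events: "{\<omega> \<in> space M. \<bar>Z T \<omega> $ i\<bar> \<ge> \<delta>} \<in> events" if "i < n" for T i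
  proof -
    have [measurable]: "(\<lambda>\<omega>. Z T \<omega> $ i) \<in> borel_measurable M" using rv that by (auto simp: random_vec_def)
    show ?thesis by measurable
  qed
  have le: "prob {\<omega> \<in> space M. sqrt (scalar_prod (Z T \<omega>) (Z T \<omega>)) > e} \<le> (\<Sum>i<n. prob {\<omega> \<in> space M. \<bar>Z T \<omega> $ i\<bar> \<ge> \<delta>})" for T
  proof -
    have "prob {\<omega> \<in> space M. sqrt (scalar_prod (Z T \<omega>) (Z T \<omega>)) > e} \<le> prob (\<Union>i\<in>{..<n}. {\<omega> \<in> space M. \<bar>Z T \<omega> $ i\<bar> \<ge> \<delta>})"
    proof (rule finite_measure_mono)
      show "{\<omega> \<in> space M. sqrt (scalar_prod (Z T \<omega>) (Z T \<omega>)) > e} \<subseteq> (\<Union>i\<in>{..<n}. {\<omega> \<in> space M. \<bar>Z T \<omega> $ i\<bar> \<ge> \<delta>})"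
      proof (rule subsetI, rule ccontr)
        fix \<omega> assume \<omega>: "\<omega> \<in> {\<omega> \<in> space M. sqrt (scalar_prod (Z T \<omega>) (Z T \<omega>)) > e}"
          "\<omega> \<notin> (\<Union>i\<in>{..<n}. {\<omega> \<in> space M. \<bar>Z T \<omega> $ i\<bar> \<ge> \<delta>})"
        then have small: "\<bar>Z T \<omega> $ i\<bar> \<le> \<delta>" if "i < n" for i using that by (auto simp: not_le intro: less_imp_le)
        have dim: "dim_vec (Z T \<omega>) = n" using rv[of T] \<omega>(1) by (auto simp: random_vec_def)
        have "sqrt (scalar_prod (Z T \<omega>) (Z T \<omega>)) = L2_set (\<lambda>i. Z T \<omega> $ i) {..<n}"
          unfolding L2_set_def scalar_prod_def dim by (simp add: power2_eq_square lessThan_atLeast0)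
        also have "\<dots> \<le> (\<Sum>i<n. \<bar>Z T \<omega> $ i\<bar>)" by (rule L2_set_le_sum_abs)
        also have "\<dots> \<le> (\<Sum>i<n. \<delta>)" using small by (intro sum_mono) auto
        also have "\<dots> \<le> e" using \<delta>(2) by simp
        finally show False using \<omega>(1) by simp
      qed
      show "(\<Union>i\<in>{..<n}. {\<omega> \<in> space M. \<bar>Z T \<omega> $ i\<bar> \<ge> \<delta>}) \<in> events"
        using events by (intro sets.finite_UN) auto
    qed
    also have "\<dots> \<le> (\<Sum>i<n. prob {\<omega> \<in> space M. \<bar>Z T \<omega> $ i\<bar> \<ge> \<delta>})"
      using events by (intro finite_measure_subadditive_finite) auto
    finally show ?thesis .
  qed
  have ev: "\<forall>\<^sub>F T in sequentially. norm (prob {\<omega> \<in> space M. sqrt (scalar_prod (Z T \<omega>) (Z T \<omega>)) > e})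
      \<le> (\<Sum>i<n. prob {\<omega> \<in> space M. \<bar>Z T \<omega> $ i\<bar> \<ge> \<delta>})"
    by (intro always_eventually allI) (use le in simp)
  have "(\<lambda>T. \<Sum>i<n. prob {\<omega> \<in> space M. \<bar>Z T \<omega> $ i\<bar> \<ge> \<delta>}) \<longlonglongrightarrow> (\<Sum>i<n. 0)"
    using \<delta>(1) by (intro tendsto_sum lim) auto
  then show "(\<lambda>T. prob {\<omega> \<in> space M. sqrt (scalar_prod (Z T \<omega>) (Z T \<omega>)) > e}) \<longlonglongrightarrow> 0"
    by (intro Lim_null_comparison[OF ev]) simp
qed

text \<open>If a coordinate of \<open>Z T\<close> is at least \<open>e\<close>, the scaled
  coordinate is at least \<open>e\<close> sqrt T, which eventually exceeds the tightness radius
  \<open>k\<close>.\<close>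

lemma (in prob_space) tends_to_0_in_prob_of_tight:
  assumes rv: "\<And>T. random_vec M n (Z T)" "\<And>T. random_vec M n (\<lambda>\<omega>. sqrt (real T) \<cdot>\<^sub>v Z T \<omega>)"
    and tight: "\<And>e. e > 0 \<Longrightarrow> \<exists>k>0. \<forall>\<^sub>F T in sequentially.
      prob {\<omega> \<in> space M. \<exists>i<n. \<bar>(sqrt (real T) \<cdot>\<^sub>v Z T \<omega>) $ i\<bar> > k} < e"
  shows "tends_to_0_in_prob M n Z"
proof (rule tends_to_0_in_probI[OF rv(1)])
  fix i :: nat and e :: real assume i: "i < n" and e: "e > 0"
  show "(\<lambda>T. prob {\<omega> \<in> space M. \<bar>Z T \<omega> $ i\<bar> \<ge> e}) \<longlonglongrightarrow> 0"
  proof (rule tendstoI)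
    fix r :: real assume "r > 0"
    from tight[OF this] obtain k where k: "\<forall>\<^sub>F T in sequentially.
        prob {\<omega> \<in> space M. \<exists>i<n. \<bar>(sqrt (real T) \<cdot>\<^sub>v Z T \<omega>) $ i\<bar> > k} < r" by auto
    have "filterlim (\<lambda>T. sqrt (real T)) at_top sequentially"
      by (rule filterlim_compose[OF sqrt_at_top filterlim_real_sequentially])
    then have "\<forall>\<^sub>F T in sequentially. k / e < sqrt (real T)"
      by (rule spec[OF iffD1[OF filterlim_at_top_dense]])
    with k show "\<forall>\<^sub>F T in sequentially. dist (prob {\<omega> \<in> space M. \<bar>Z T \<omega> $ i\<bar> \<ge> e}) 0 < r"
    proof eventually_elim
      case (elim T)
      have [measurable]: "(\<lambda>\<omega>. (sqrt (real T) \<cdot>\<^sub>v Z T \<omega>) $ j) \<in> borel_measurable M" if "j < n" for j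
        using rv(2)[of T] that by (auto simp: random_vec_def)
      have "prob {\<omega> \<in> space M. \<bar>Z T \<omega> $ i\<bar> \<ge> e} \<le> prob {\<omega> \<in> space M. \<exists>i<n. \<bar>(sqrt (real T) \<cdot>\<^sub>v Z T \<omega>) $ i\<bar> > k}"
      proof (rule finite_measure_mono)
        show "{\<omega> \<in> space M. \<exists>i<n. \<bar>(sqrt (real T) \<cdot>\<^sub>v Z T \<omega>) $ i\<bar> > k} \<in> events" by measurable
        show "{\<omega> \<in> space M. \<bar>Z T \<omega> $ i\<bar> \<ge> e} \<subseteq> {\<omega> \<in> space M. \<exists>i<n. \<bar>(sqrt (real T) \<cdot>\<^sub>v Z T \<omega>) $ i\<bar> > k}"
        proof safe
          fix \<omega> assume \<omega>: "\<omega> \<in> space M" "\<bar>Z T \<omega> $ i\<bar> \<ge> e"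
          have dim: "dim_vec (Z T \<omega>) = n" using rv(1)[of T] \<omega>(1) by (auto simp: random_vec_def)
          have "k < sqrt (real T) * e" using elim(2) e by (simp add: field_simps)
          also have "\<dots> \<le> sqrt (real T) * \<bar>Z T \<omega> $ i\<bar>" using \<omega>(2) by (intro mult_left_mono) auto
          finally show "\<exists>i<n. \<bar>(sqrt (real T) \<cdot>\<^sub>v Z T \<omega>) $ i\<bar> > k"
            using i dim by (intro exI[of _ i]) (simp add: abs_mult)
        qed
      qed
      then show ?case using elim(1) by simp
    qed
  qed
qed

context nirvar_fit
begin

definition A_mat :: "real mat" where "A_mat = concat_cols N Q (Adj q)"
definition beta :: "real vec" where "beta = vectorise (concat_cols N Q (\<lambda>r. Adj q r \<odot>\<^sub>H W q r))"
definition yv :: "nat \<Rightarrow> 'a \<Rightarrow> real vec" where "yv T \<omega> = responses N (X q) T \<omega>"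
definition err :: "nat \<Rightarrow> 'a \<Rightarrow> real vec" where
  "err T \<omega> = gls_estimator (Sig q) A_hat (Dm T \<omega>) (yv T \<omega>)
     - misspec_mat (Sig q) A_hat A_mat (Dm T \<omega>) *\<^sub>v restricted_params beta A_mat"
definition Gn :: "nat \<Rightarrow> 'a \<Rightarrow> real mat" where
  "Gn T \<omega> = R\<^sup>T * ((Dm T \<omega> * (Dm T \<omega>)\<^sup>T) \<otimes>\<^sub>K S) * R"
text \<open>The score with the residuals of the true parameter in place of the noise. It is
  determined by the data at every sample point, whereas residuals and noise agree only almost
  surely.\<close>

definition sv :: "nat \<Rightarrow> 'a \<Rightarrow> nat \<Rightarrow> real" where
  "sv T \<omega> a = (\<Sum>k<N * d. R $$ (k, a) * (\<Sum>t<T. \<Sum>i<N. xs (int t) (k div N) \<omega> * S $$ (k mod N, i) *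
     (xs (int t + 1) (q * N + i) \<omega> - (\<Sum>l<d. xs (int t) l \<omega> * coef $$ (q * N + i, l)))))"

lemma A_mat: "A_mat \<in> carrier_mat N d" "binary_mat A_mat"
proof -
  show "A_mat \<in> carrier_mat N d" by (simp add: A_mat_def concat_cols_def)
  show "binary_mat A_mat"
    unfolding binary_mat_def
  proof
    fix v assume "v \<in> elements_mat A_mat"
    then obtain i j where ij: "i < N" "j < d" "v = Adj q (j div N) $$ (i, j mod N)"
      by (auto simp: elements_mat_def A_mat_def concat_cols_def)
    note dm = div_mod_less[OF ij(2)]
    have "v \<in> elements_mat (Adj q (j div N))"
      unfolding ij(3) using Adj_carrier[OF q dm(1)] ij(1) dm(2) by (intro elements_matI) auto
    then show "v \<in> {0, 1}" using Adj_binary[OF q dm(1)] by (auto simp: binary_mat_def)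
  qed
qed

lemma beta_carrier: "beta \<in> carrier_vec (N * d)"
  by (simp add: beta_def vectorise_def concat_cols_def)

text \<open>The first form places the parameters in block row \<open>q\<close> of the stacked
  coefficient matrix; the second shows that they vanish wherever the true restrictions do.\<close>

lemma beta_index:
  assumes "k < N * d"
  shows "beta $ k = coef $$ (q * N + k mod N, k div N)"
    and "beta $ k = vectorise A_mat $ k * W q (k div N div N) $$ (k mod N, k div N mod N)"
proof -
  let ?l = "k div N" and ?i = "k mod N"
  have li: "?l < d" "?i < N" using div_d_less[OF assms] by auto
  note dm = div_mod_less[OF li(1)]
  have "beta $ k = concat_cols N Q (\<lambda>r. Adj q r \<odot>\<^sub>H W q r) $$ (?i, ?l)"
    unfolding beta_def by (rule vectorise_index(1)[OF _ assms]) (simp add: concat_cols_def)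
  then have b: "beta $ k = Adj q (?l div N) $$ (?i, ?l mod N) * W q (?l div N) $$ (?i, ?l mod N)"
    using li dm Adj_carrier[OF q dm(1)] by (simp add: concat_cols_def hadamard_def)
  then show "beta $ k = coef $$ (q * N + ?i, ?l)"
    using coef_index[OF q li(2) dm] by simp
  show "beta $ k = vectorise A_mat $ k * W q (?l div N) $$ (?i, ?l mod N)"
    unfolding vectorise_index(1)[OF A_mat(1) assms] b using li by (simp add: A_mat_def concat_cols_def)
qed

lemma restricted_beta:
  "restricted_params beta A_mat \<in> carrier_vec (nnz A_mat)"
  "restriction_mat A_mat *\<^sub>v restricted_params beta A_mat = beta"
  by (rule restriction_mat_restricted_params[OF A_mat beta_carrier]; simp add: beta_index(2))+

lemma yv_carrier: "yv T \<omega> \<in> carrier_vec (N * T)"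
  by (simp add: yv_def responses_def vectorise_def)

lemma yv_index:
  assumes "t < T" "i < N"
  shows "yv T \<omega> $ (t * N + i) = xs (int t + 1) (q * N + i) \<omega>"
proof -
  have lt: "t * N + i < N * T"
  proof -
    have "t * N + i < Suc t * N" using assms by simp
    also have "\<dots> \<le> T * N" using assms by (intro mult_right_mono) auto
    finally show ?thesis by (simp add: mult.commute)
  qed
  have "yv T \<omega> $ (t * N + i) = mat_of_cols N (map (\<lambda>t. X q (int t) \<omega>) [1..<T + 1]) $$ ((t * N + i) mod N, (t * N + i) div N)"
    unfolding yv_def responses_def
    using mat_of_cols_carrier(1)[of N "map (\<lambda>t. X q (int t) \<omega>) [1..<T + 1]"]
    by (intro vectorise_index(1)[OF _ lt]) (simp del: upt_Suc)
  also have "\<dots> = X q (int (Suc t)) \<omega> $ i"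
    using assms by (simp add: mat_of_cols_index del: upt_Suc)
  finally show ?thesis using assms q by (simp add: xs_def block_index add.commute)
qed

lemma Gn_carrier: "Gn T \<omega> \<in> carrier_mat n n"
  unfolding Gn_def using R_carrier kronecker_carrier[OF _ S_carrier, of "Dm T \<omega> * (Dm T \<omega>)\<^sup>T" d d] Dm_carrier[of T \<omega>]
  by auto

text \<open>Valid at every sample point, since only residuals occur. This is what yields
  measurability of the error; the model equation is used later, up to a null set.\<close>

lemma err_eq: "err T \<omega> = inv_mat (Gn T \<omega>) *\<^sub>v vec n (sv T \<omega>)"
proof -
  let ?v = "(Dm T \<omega> \<otimes>\<^sub>K S) *\<^sub>v yv T \<omega> - ((Dm T \<omega> * (Dm T \<omega>)\<^sup>T) \<otimes>\<^sub>K S) *\<^sub>v beta"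
  have v: "?v \<in> carrier_vec (N * d)"
    using Dm_carrier[of T \<omega>]
    by (intro minus_carrier_vec mult_mat_vec_carrier[OF kronecker_carrier[OF _ S_carrier] yv_carrier]
        mult_mat_vec_carrier[OF kronecker_carrier[OF _ S_carrier] beta_carrier]) auto
  have vk: "?v $ k = (\<Sum>t<T. \<Sum>i<N. xs (int t) (k div N) \<omega> * S $$ (k mod N, i) *
     (xs (int t + 1) (q * N + i) \<omega> - (\<Sum>l<d. xs (int t) l \<omega> * coef $$ (q * N + i, l))))" if k: "k < N * d" for k
    unfolding score_index[OF Dm_carrier S_carrier yv_carrier beta_carrier k]
  proof (intro sum.cong refl)
    fix t i assume "t \<in> {..<T}" "i \<in> {..<N}"
    then have ti: "t < T" "i < N" by auto
    have b: "beta $ (l * N + i) = coef $$ (q * N + i, l)" if "l < d" for l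
    proof -
      have "l * N + i < N * d"
      proof -
        have "l * N + i < Suc l * N" using ti by simp
        also have "\<dots> \<le> d * N" using that by (intro mult_right_mono) auto
        finally show ?thesis by (simp add: mult.commute)
      qed
      from beta_index(1)[OF this] show ?thesis using ti by simp
    qed
    show "Dm T \<omega> $$ (k div N, t) * S $$ (k mod N, i) * (yv T \<omega> $ (t * N + i) - (\<Sum>l<d. Dm T \<omega> $$ (l, t) * beta $ (l * N + i)))
      = xs (int t) (k div N) \<omega> * S $$ (k mod N, i) *
        (xs (int t + 1) (q * N + i) \<omega> - (\<Sum>l<d. xs (int t) l \<omega> * coef $$ (q * N + i, l)))"
      using ti k by (simp add: Dm_index div_d_less yv_index b)
  qed
  have "R\<^sup>T *\<^sub>v ?v = vec n (sv T \<omega>)"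
  proof (rule eq_vecI)
    fix a assume "a < dim_vec (vec n (sv T \<omega>))"
    then have a: "a < n" by simp
    have "(R\<^sup>T *\<^sub>v ?v) $ a = (\<Sum>k<N * d. R $$ (k, a) * ?v $ k)"
      by (rule transpose_mult_vec_index[OF R_carrier v a])
    also have "\<dots> = sv T \<omega> a" unfolding sv_def by (intro sum.cong refl) (simp add: vk)
    finally show "(R\<^sup>T *\<^sub>v ?v) $ a = vec n (sv T \<omega>) $ a" using a by simp
  qed (use R_carrier in simp)
  then show ?thesis
    unfolding err_def estimation_error[OF A_hat(1) Sig_q(1) Dm_carrier yv_carrier A_mat(1) restricted_beta(1)]
      restricted_beta(2) S_def[symmetric] R_def[symmetric] Gn_def[symmetric] by simp
qed

lemma err_index: "j < n \<Longrightarrow> err T \<omega> $ j = (\<Sum>a<n. inv_mat (Gn T \<omega>) $$ (j, a) * sv T \<omega> a)"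
  using inv_mat_carrier[OF Gn_carrier, of T \<omega>]
  by (auto simp: err_eq scalar_prod_def lessThan_atLeast0 intro!: sum.cong)

lemma Gn_eq_Hn:
  assumes "T > 0"
  shows "Gn T \<omega> = real T \<cdot>\<^sub>m Hn T \<omega>"
proof (rule eq_matI)
  have DD: "Dm T \<omega> * (Dm T \<omega>)\<^sup>T \<in> carrier_mat d d" using Dm_carrier[of T \<omega>] by auto
  fix a b assume "a < dim_row (real T \<cdot>\<^sub>m Hn T \<omega>)" "b < dim_col (real T \<cdot>\<^sub>m Hn T \<omega>)"
  then have ab: "a < n" "b < n" using Hn_carrier[of T \<omega>] by auto
  have "Gn T \<omega> $$ (a, b) = (\<Sum>k<N * d. \<Sum>k'<N * d.
      R $$ (k, a) * ((Dm T \<omega> * (Dm T \<omega>)\<^sup>T) $$ (k div N, k' div N) * S $$ (k mod N, k' mod N)) * R $$ (k', b))"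
    unfolding Gn_def sandwich_index[OF R_carrier kronecker_carrier[OF DD S_carrier] ab]
    by (intro sum.cong refl) (simp add: kronecker_index[OF DD S_carrier])
  also have "\<dots> = (\<Sum>k<N * d. \<Sum>k'<N * d. real T *
      (R $$ (k, a) * ((\<Sum>t<T. xs (int t) (k div N) \<omega> * xs (int t) (k' div N) \<omega>) / T * S $$ (k mod N, k' mod N)) * R $$ (k', b)))"
  proof (intro sum.cong refl)
    fix k k' assume "k \<in> {..<N * d}" "k' \<in> {..<N * d}"
    then have kk: "k div N < d" "k' div N < d" by (auto simp: div_d_less)
    have "(Dm T \<omega> * (Dm T \<omega>)\<^sup>T) $$ (k div N, k' div N) = real T * ((\<Sum>t<T. xs (int t) (k div N) \<omega> * xs (int t) (k' div N) \<omega>) / T)"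
      using assms by (simp add: gram_index[OF kk])
    then show "R $$ (k, a) * ((Dm T \<omega> * (Dm T \<omega>)\<^sup>T) $$ (k div N, k' div N) * S $$ (k mod N, k' mod N)) * R $$ (k', b)
      = real T * (R $$ (k, a) * ((\<Sum>t<T. xs (int t) (k div N) \<omega> * xs (int t) (k' div N) \<omega>) / T * S $$ (k mod N, k' mod N)) * R $$ (k', b))"
      by (simp only: mult_ac)
  qed
  also have "\<dots> = real T * Hn T \<omega> $$ (a, b)"
    unfolding Hn_index[OF ab] sum_distrib_left ..
  finally show "Gn T \<omega> $$ (a, b) = (real T \<cdot>\<^sub>m Hn T \<omega>) $$ (a, b)" using ab Hn_carrier[of T \<omega>] by simp
qed (use Gn_carrier[of T \<omega>] Hn_carrier[of T \<omega>] in auto)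

lemma sv_eq_score: "AE \<omega> in M. \<forall>T. \<forall>a. sv T \<omega> a = score T a \<omega>"
  using var_step
proof eventually_elim
  case (elim \<omega>)
  have "xs (int t + 1) (q * N + i) \<omega> - (\<Sum>l<d. xs (int t) l \<omega> * coef $$ (q * N + i, l)) = es (int t + 1) (q * N + i) \<omega>"
    if "i < N" for t i
  proof -
    have "xs (int t + 1) (q * N + i) \<omega> = (\<Sum>l<d. coef $$ (q * N + i, l) * xs (int t + 1 - 1) l \<omega>) + es (int t + 1) (q * N + i) \<omega>"
      using elim block_index(1)[OF q that] by blast
    then show ?thesis by (simp add: mult.commute)
  qed
  then show ?case unfolding sv_def score_def by simp
qed

lemma scaled_err_index:
  assumes T: "T > 0"
  shows "AE \<omega> in M. \<forall>j<n. (sqrt (real T) \<cdot>\<^sub>v err T \<omega>) $ j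
    = (\<Sum>a<n. inv_mat (Hn T \<omega>) $$ (j, a) * (score T a \<omega> / sqrt T))"
  using sv_eq_score
proof eventually_elim
  case (elim \<omega>)
  show ?case
  proof (intro allI impI)
    fix j assume j: "j < n"
    have "inv_mat (Gn T \<omega>) = (1 / real T) \<cdot>\<^sub>m inv_mat (Hn T \<omega>)"
      unfolding Gn_eq_Hn[OF T] using T by (intro inv_mat_smult[OF Hn_carrier]) simp
    then have G: "inv_mat (Gn T \<omega>) $$ (j, a) = inv_mat (Hn T \<omega>) $$ (j, a) / real T" if "a < n" for a
      using inv_mat_carrier[OF Hn_carrier, of T \<omega>] j that by simp
    have dim: "dim_vec (err T \<omega>) = n" using inv_mat_carrier[OF Gn_carrier, of T \<omega>] by (simp add: err_eq)
    have s: "sqrt (real T) / real T = 1 / sqrt T"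
      using T real_div_sqrt[of "real T"] by (simp add: field_simps)
    have "(sqrt (real T) \<cdot>\<^sub>v err T \<omega>) $ j = (\<Sum>a<n. inv_mat (Hn T \<omega>) $$ (j, a) * ((sqrt (real T) / real T) * score T a \<omega>))"
      using j dim elim by (simp add: err_index sum_distrib_left G mult_ac)
    then show "(sqrt (real T) \<cdot>\<^sub>v err T \<omega>) $ j = (\<Sum>a<n. inv_mat (Hn T \<omega>) $$ (j, a) * (score T a \<omega> / sqrt T))"
      unfolding s by simp
  qed
qed

lemma xs_measurable: "k < d \<Longrightarrow> xs t k \<in> borel_measurable M"
  using xs_L2 by (rule L2_measurable)

lemma err_random_vec: "random_vec M n (err T)"
  unfolding random_vec_def
proof (intro conjI ballI allI impI)
  show "err T \<omega> \<in> carrier_vec n" for \<omega>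
    using inv_mat_carrier[OF Gn_carrier, of T \<omega>] by (simp add: err_eq)
  fix j assume j: "j < n"
  have sv: "(\<lambda>\<omega>. sv T \<omega> a) \<in> borel_measurable M" if "a < n" for a
    unfolding sv_def
    by (intro borel_measurable_sum borel_measurable_times borel_measurable_diff borel_measurable_const xs_measurable)
      (auto simp: div_d_less block_index[OF q])
  \<comment> \<open>Rescaling \<open>Hn\<close> recovers \<open>Gn\<close> only for
    \<open>T > 0\<close>. Without observations the regressor matrix has no columns and the Gram
    matrix is constant.\<close>
  have G: "(\<lambda>\<omega>. Gn T \<omega> $$ (a, b)) \<in> borel_measurable M" if ab: "a < n" "b < n" for a b
  proof (cases "T = 0")
    case True
    have "Gn T \<omega> = Gn T undefined" for \<omega>
    proof -
      have "Dm T \<omega> = Dm T undefined" using True by (intro eq_matI) (auto simp: carrier_matD[OF Dm_carrier])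
      then show ?thesis by (simp add: Gn_def)
    qed
    then have "(\<lambda>\<omega>. Gn T \<omega> $$ (a, b)) = (\<lambda>_. Gn T undefined $$ (a, b))" by (intro ext) metis
    then show ?thesis by simp
  next
    case False
    then have "(\<lambda>\<omega>. Gn T \<omega> $$ (a, b)) = (\<lambda>\<omega>. real T * Hn T \<omega> $$ (a, b))"
      using ab carrier_matD[OF Hn_carrier] by (simp add: Gn_eq_Hn)
    then show ?thesis using Hn_integrable[OF ab, of T] by simp
  qed
  have "(\<lambda>\<omega>. inv_mat (Gn T \<omega>) $$ (j, a)) \<in> borel_measurable M" if "a < n" for a
    using j that by (intro borel_measurable_inv_mat[OF Gn_carrier G])
  then show "(\<lambda>\<omega>. err T \<omega> $ j) \<in> borel_measurable M"
    unfolding err_index[OF j] using sv by (intro borel_measurable_sum borel_measurable_times) auto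
qed

lemma sqrt_err_random_vec: "random_vec M n (\<lambda>\<omega>. sqrt (real T) \<cdot>\<^sub>v err T \<omega>)"
  using err_random_vec[of T] unfolding random_vec_def
proof (intro conjI ballI allI impI)
  fix j assume "j < n"
  then have "err T \<omega> \<in> carrier_vec n" for \<omega>
    using inv_mat_carrier[OF Gn_carrier, of T \<omega>] by (simp add: err_eq)
  then have eq: "(\<lambda>\<omega>. (sqrt (real T) \<cdot>\<^sub>v err T \<omega>) $ j) = (\<lambda>\<omega>. sqrt (real T) * err T \<omega> $ j)"
    using \<open>j < n\<close> by (intro ext) (metis carrier_vecD index_smult_vec(1))
  have "(\<lambda>\<omega>. err T \<omega> $ j) \<in> borel_measurable M"
    using err_random_vec[of T] \<open>j < n\<close> by (simp add: random_vec_def)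
  then show "(\<lambda>\<omega>. (sqrt (real T) \<cdot>\<^sub>v err T \<omega>) $ j) \<in> borel_measurable M"
    unfolding eq by (intro borel_measurable_times borel_measurable_const)
qed auto

lemma err_limits:
  "tends_to_0_in_prob M n err"
  "tends_to_in_dist M n (\<lambda>T \<omega>. sqrt (real T) \<cdot>\<^sub>v err T \<omega>) (multivariate_normal n (0\<^sub>v n) (inv_mat Hlim))"
proof -
  obtain C where C: "\<And>a T. a < n \<Longrightarrow> expectation (\<lambda>\<omega>. \<bar>score T a \<omega> / sqrt T\<bar>) \<le> C"
    using score_bound by blast
  have i: "integrable M (\<lambda>\<omega>. score T a \<omega> / sqrt T)" if "a < n" for T a
    using score_integrable[OF that] by simp
  note slutsky = Hlim_carrier Hlim_pos_def Hn_carrier Hn_integrable Hn_lim i C score_char sqrt_err_random_vec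
    scaled_err_index
  show "tends_to_in_dist M n (\<lambda>T \<omega>. sqrt (real T) \<cdot>\<^sub>v err T \<omega>) (multivariate_normal n (0\<^sub>v n) (inv_mat Hlim))"
    by (rule slutsky_tends_to_in_dist[OF slutsky])
  show "tends_to_0_in_prob M n err"
    by (rule tends_to_0_in_prob_of_tight[OF err_random_vec sqrt_err_random_vec slutsky_tight[OF slutsky]])
qed

text \<open>The statement Gamma = plim X X' / T. Vectorising makes the Euclidean norm of the
  definition the Frobenius norm of the matrix difference.\<close>

lemma second_moment_limit:
  "tends_to_0_in_prob M (d * d) (\<lambda>T \<omega>. vectorise ((1 / real T) \<cdot>\<^sub>m (Dm T \<omega> * (Dm T \<omega>)\<^sup>T) - mat d d (\<lambda>(k, l). Gam k l)))"
proof -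
  let ?Z = "\<lambda>T \<omega>. vectorise ((1 / real T) \<cdot>\<^sub>m (Dm T \<omega> * (Dm T \<omega>)\<^sup>T) - mat d d (\<lambda>(k, l). Gam k l))"
  have car: "(1 / real T) \<cdot>\<^sub>m (Dm T \<omega> * (Dm T \<omega>)\<^sup>T) - mat d d (\<lambda>(k, l). Gam k l) \<in> carrier_mat d d" for T \<omega>
    using moment_carrier[of T \<omega>] by auto
  have idx: "?Z T \<omega> $ k = (\<Sum>t<T. xs (int t) (k mod d) \<omega> * xs (int t) (k div d) \<omega>) / T - Gam (k mod d) (k div d)"
    "k mod d < d" "k div d < d" if "k < d * d" for T \<omega> k
  proof -
    show kd: "k mod d < d" "k div d < d" using vectorise_index(2,3)[OF car that] by auto
    have "?Z T \<omega> $ k = ((1 / real T) \<cdot>\<^sub>m (Dm T \<omega> * (Dm T \<omega>)\<^sup>T) - mat d d (\<lambda>(k, l). Gam k l)) $$ (k mod d, k div d)"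
      by (rule vectorise_index(1)[OF car that])
    also have "\<dots> = ((1 / real T) \<cdot>\<^sub>m (Dm T \<omega> * (Dm T \<omega>)\<^sup>T)) $$ (k mod d, k div d) - Gam (k mod d) (k div d)"
      using kd by (subst index_minus_mat(1)) auto
    finally show "?Z T \<omega> $ k = (\<Sum>t<T. xs (int t) (k mod d) \<omega> * xs (int t) (k div d) \<omega>) / T - Gam (k mod d) (k div d)"
      unfolding moment_index[OF kd] .
  qed
  have int: "integrable M (\<lambda>\<omega>. ?Z T \<omega> $ k)" if "k < d * d" for T k
    unfolding idx(1)[OF that] using idx(2,3)[OF that] by (intro Bochner_Integration.integrable_diff xs_prod_mean_integrable) auto
  show ?thesis
  proof (rule tends_to_0_in_probI)
    show "random_vec M (d * d) (?Z T)" for T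
      unfolding random_vec_def using int[of _ T] carrier_matD[OF car, of T]
      by (auto simp: vectorise_def intro!: carrier_vecI)
    fix k :: nat and e :: real assume k: "k < d * d" and e: "e > 0"
    have ev: "\<forall>\<^sub>F T in sequentially. norm (prob {\<omega> \<in> space M. \<bar>?Z T \<omega> $ k\<bar> \<ge> e}) \<le> expectation (\<lambda>\<omega>. \<bar>?Z T \<omega> $ k\<bar>) / e"
      by (intro always_eventually allI) (use markov_abs[OF int[OF k] e] in simp)
    have "(\<lambda>T. expectation (\<lambda>\<omega>. \<bar>?Z T \<omega> $ k\<bar>) / e) \<longlonglongrightarrow> 0 / e"
      unfolding idx(1)[OF k] using e by (intro tendsto_divide tendsto_const V.lln_x idx(2,3)[OF k]) simp
    then show "(\<lambda>T. prob {\<omega> \<in> space M. \<bar>?Z T \<omega> $ k\<bar> \<ge> e}) \<longlonglongrightarrow> 0"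
      by (intro Lim_null_comparison[OF ev]) simp
  qed
qed

end

theorem proposition5p2:
  fixes M :: "'a measure"
    and N Q q :: nat
    and Adj W :: "nat \<Rightarrow> nat \<Rightarrow> real mat"
    and X eps :: "nat \<Rightarrow> int \<Rightarrow> 'a \<Rightarrow> real vec"
    and Sig :: "nat \<Rightarrow> real mat"
    and A A_hat \<Gamma> :: "real mat"
    and \<beta> \<gamma> :: "real vec"
    and D :: "nat \<Rightarrow> 'a \<Rightarrow> real mat"
    and err :: "nat \<Rightarrow> 'a \<Rightarrow> real vec"
    and s :: int
  assumes "nirvar M N Q Adj W X eps Sig"
    and "q < Q"
    and "A_hat \<in> carrier_mat N (N * Q)"
    and "binary_mat A_hat"
    and "A = concat_cols N Q (Adj q)"
    and "\<beta> = vectorise (concat_cols N Q (\<lambda>r. Adj q r \<odot>\<^sub>H W q r))"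
    and "\<gamma> = restricted_params \<beta> A"
    and "\<Gamma> = cross_moment M (N * Q) (stacked N Q X s) (stacked N Q X s)"
    and "D = regressors N Q X"
    and "err = (\<lambda>T \<omega>. gls_estimator (Sig q) A_hat (D T \<omega>) (responses N (X q) T \<omega>)
                        - misspec_mat (Sig q) A_hat A (D T \<omega>) *\<^sub>v \<gamma>)"
  shows "tends_to_0_in_prob M (nnz A_hat) err \<and>
         tends_to_in_dist M (nnz A_hat) (\<lambda>T \<omega>. sqrt (real T) \<cdot>\<^sub>v err T \<omega>)
           (multivariate_normal (nnz A_hat) (0\<^sub>v (nnz A_hat))
              (inv_mat ((restriction_mat A_hat)\<^sup>T * (\<Gamma> \<otimes>\<^sub>K inv_mat (Sig q)) * restriction_mat A_hat))) \<and>
         tends_to_0_in_prob M (N * Q * (N * Q))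
           (\<lambda>T \<omega>. vectorise ((1 / real T) \<cdot>\<^sub>m (D T \<omega> * (D T \<omega>)\<^sup>T) - \<Gamma>))"
proof -
  interpret nirvar M N Q Adj W X eps Sig by fact
  interpret nirvar_fit M N Q Adj W X eps Sig q A_hat
    using assms(2-4) by unfold_locales
  have D: "D = Dm" unfolding assms(9) Dm_def ..
  have err: "err = nirvar_fit.err N Q Adj W X Sig q A_hat"
    unfolding assms(10) assms(7) assms(6) assms(5) D err_def[abs_def] yv_def A_mat_def beta_def ..
  \<comment> \<open>Stationarity at lag 0 makes the second moment matrix at the arbitrary time
    \<open>s\<close> equal to that at time 0.\<close>
  have \<Gamma>: "\<Gamma> = mat (N * Q) (N * Q) (\<lambda>(k, l). Gam k l)"
    unfolding assms(8) by (rule cross_moment_stacked)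
  show ?thesis
    using err_limits second_moment_limit unfolding err D \<Gamma> Hlim_def R_def S_def by blast
qed

end
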